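(* Let $E$ be a Hermite–Biehler function such that every polynomial belongs to the de Branges space $\mathcal{H}(E)$. Let the spectral data $((t_n),(\nu_n))$ for $\mathcal{H}(E)$ be regular and let $(t_n)$ be lacunary. Assume also that $\Phi(u)\ge 0$. Then $\mathbb{H}_{\Phi,\mu}$ is bounded in $\mathcal{H}(E)$ if and only if the integrals $\lambda_n=\int_0^\infty\Phi(u)u^{-n}\,d\mu(u)$ exist for all $n\in\mathbb{Z}_+$, $C=\sup_{n\in\mathbb{Z}_+}\lambda_n<\infty$, and $\Phi(u)=0$ for $\mu$-a.e. $u\in(0,1)$. In this case, $$\|\mathbb{H}_{\Phi,\mu}\|_{\mathcal{H}(E)\to\mathcal{H}(E)}\le \mathrm{const}\int_1^\infty\Phi(u)\,d\mu(u),$$ where the constant $\mathrm{const}$ depends on $E$ only.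
   Context: $\mu$ is a regular positive Borel measure on $(0,\infty)$ and $\Phi$ is a $\mu$-measurable function on $(0,\infty)$. The Hausdorff operator is $$(\mathbb{H}_{\Phi,\mu}F)(z)=\int_0^\infty \Phi(u)\,F\left(\tfrac{z}{u}\right)d\mu(u),\quad z\in\mathbb{C}.$$ $\mathbb{Z}_+=\{0,1,2,\dots\}$. An entire function $E$ is in the Hermite–Biehler class if $|E(z)|>|E^{\#}(z)|$ for $z$ in the open upper half-plane $\mathbb{C}^+$, where $F^{\#}(z):=\overline{F(\overline z)}$. The de Branges space is $\mathcal{H}(E)=\{F \text{ entire}: F/E,\ F^{\#}/E\in H^2(\mathbb{C}^+)\}$ ($H^2(\mathbb{C}^+)$ is the Hardy space of the upper half-plane), a Hilbert space with norm $\|F\|_E^2=\int_{-\infty}^\infty |F(t)/E(t)|^2dt$. "$\mathbb{H}_{\Phi,\mu}$ is bounded in $\mathcal{H}(E)$" means that $\mathbb{H}_{\Phi,\mu}F$ is defined and belongs to $\mathcal{H}(E)$ for every $F\in\mathcal{H}(E)$ and that $\mathbb{H}_{\Phi,\mu}$ is a bounded linear operator on $\mathcal{H}(E)$. Spectral data: a pair $((t_n),(\nu_n))$, indexed by a set of consecutive integers, where $(t_n)$ is an increasing sequence of reals with no finite accumulation point, $\nu_n>0$, $\sum_n\nu_n/(1+t_n^2)<\infty$, is spectral data for $\mathcal{H}(E)$ if there is an entire function $A$, real on $\mathbb{R}$, with only simple zeros, located exactly at the points $t_n$, such that the functions $\nu_n^{1/2}A(z)/(z-t_n)$ form an orthonormal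 basis of $\mathcal{H}(E)$; equivalently $\mathcal{H}(E)$ consists of the functions $F(z)=A(z)\sum_n a_n\nu_n^{1/2}/(z-t_n)$, $(a_n)\in\ell^2$, with $\|F\|_E=\|(a_n)\|_{\ell^2}$. The sequence $(t_n)$ is lacunary if for some $\kappa>0$ one has $t_{n+1}-t_n\ge\kappa|t_n|$ for all $n$. The spectral data are regular if for some $c>0$ and any $n$, $$\sum_{|t_k|\le|t_n|}\nu_k+t_n^2\sum_{|t_k|>|t_n|}\frac{\nu_k}{t_k^2}\le c\,\nu_n.$$ *)

theory Defs
  imports "HOL-Complex_Analysis.Complex_Analysis"
begin

section \<open>Hermite--Biehler functions and de Branges spaces\<close>

definition reflect :: "(complex \<Rightarrow> complex) \<Rightarrow> complex \<Rightarrow> complex" where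
  "reflect F z = cnj (F (cnj z))"

definition hermite_biehler :: "(complex \<Rightarrow> complex) \<Rightarrow> bool" where
  "hermite_biehler E \<longleftrightarrow>
     E holomorphic_on UNIV \<and> (\<forall>z. Im z > 0 \<longrightarrow> cmod (E z) > cmod (reflect E z))"

definition hardy_H2 :: "(complex \<Rightarrow> complex) set" where
  "hardy_H2 = {f. f holomorphic_on {z. Im z > 0} \<and>
     (SUP y\<in>{0<..}. \<integral>\<^sup>+ x. ennreal ((cmod (f (Complex x y)))\<^sup>2) \<partial>lborel) < \<infinity>}"

definition de_branges :: "(complex \<Rightarrow> complex) \<Rightarrow> (complex \<Rightarrow> complex) set" where
  "de_branges E = {F. F holomorphic_on UNIV \<and>
     (\<lambda>z. F z / E z) \<in> hardy_H2 \<and> (\<lambda>z. reflect F z / E z) \<in> hardy_H2}"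

text \<open>
  The integrands below are only affected by the convention \<open>x / 0 = 0\<close> at the real zeros of
  \<open>E\<close>, a Lebesgue null set. On \<open>de_branges E\<close> all these integrals converge.
\<close>

definition de_branges_inner ::
    "(complex \<Rightarrow> complex) \<Rightarrow> (complex \<Rightarrow> complex) \<Rightarrow> (complex \<Rightarrow> complex) \<Rightarrow> complex" where
  "de_branges_inner E F G =
     (\<integral>t. (F (of_real t) / E (of_real t)) * cnj (G (of_real t) / E (of_real t)) \<partial>lborel)"

definition de_branges_norm :: "(complex \<Rightarrow> complex) \<Rightarrow> (complex \<Rightarrow> complex) \<Rightarrow> real" where
  "de_branges_norm E F = sqrt (\<integral>t. (cmod (F (of_real t) / E (of_real t)))\<^sup>2 \<partial>lborel)"

definition de_branges_bounded_linear ::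
    "(complex \<Rightarrow> complex) \<Rightarrow> ((complex \<Rightarrow> complex) \<Rightarrow> (complex \<Rightarrow> complex)) \<Rightarrow> bool" where
  "de_branges_bounded_linear E T \<longleftrightarrow>
     (\<forall>F\<in>de_branges E. T F \<in> de_branges E) \<and>
     (\<forall>F\<in>de_branges E. \<forall>G\<in>de_branges E. \<forall>a b.
        T (\<lambda>z. a * F z + b * G z) = (\<lambda>z. a * T F z + b * T G z)) \<and>
     (\<exists>c. \<forall>F\<in>de_branges E. de_branges_norm E (T F) \<le> c * de_branges_norm E F)"

text \<open>
  As for \<^const>\<open>onorm\<close>, the zero vector contributes \<open>0 / 0 = 0\<close>, and the value is
  meaningful only for bounded operators.
\<close>

definition de_branges_onorm ::
    "(complex \<Rightarrow> complex) \<Rightarrow> ((complex \<Rightarrow> complex) \<Rightarrow> (complex \<Rightarrow> complex)) \<Rightarrow> real" where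
  "de_branges_onorm E T =
     (SUP F\<in>de_branges E. de_branges_norm E (T F) / de_branges_norm E F)"

definition de_branges_orthonormal_basis ::
    "(complex \<Rightarrow> complex) \<Rightarrow> int set \<Rightarrow> (int \<Rightarrow> complex \<Rightarrow> complex) \<Rightarrow> bool" where
  "de_branges_orthonormal_basis E I e \<longleftrightarrow>
     (\<forall>n\<in>I. e n \<in> de_branges E) \<and>
     (\<forall>m\<in>I. \<forall>n\<in>I. de_branges_inner E (e m) (e n) = (if m = n then 1 else 0)) \<and>
     (\<forall>F\<in>de_branges E. \<forall>\<epsilon>>0. \<exists>J c. finite J \<and> J \<subseteq> I \<and>
        de_branges_norm E (\<lambda>z. F z - (\<Sum>n\<in>J. c n * e n z)) < \<epsilon>)"


section \<open>Spectral data\<close>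

text \<open>
  Sequences are total functions on the integers that matter only on an index set \<open>I\<close> of
  consecutive integers, which may be bounded or unbounded on either side.
\<close>

definition consecutive :: "int set \<Rightarrow> bool" where
  "consecutive I \<longleftrightarrow> (\<forall>i\<in>I. \<forall>j\<in>I. {i..j} \<subseteq> I)"

text \<open>
  The entire function \<open>A(z) / (z - s)\<close> for a zero \<open>s\<close> of \<open>A\<close>; the removable
  singularity at \<open>s\<close> is filled in explicitly, since HOL division would give \<open>0\<close> there.
\<close>

definition divided_zero :: "(complex \<Rightarrow> complex) \<Rightarrow> complex \<Rightarrow> complex \<Rightarrow> complex" where
  "divided_zero A s z = (if z = s then deriv A s else A z / (z - s))"

definition spectral_data ::
    "(complex \<Rightarrow> complex) \<Rightarrow> int set \<Rightarrow> (int \<Rightarrow> real) \<Rightarrow> (int \<Rightarrow> real) \<Rightarrow> bool" where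
  "spectral_data E I t \<nu> \<longleftrightarrow>
     consecutive I \<and>
     strict_mono_on I t \<and> (\<forall>x. \<not> x islimpt (t ` I)) \<and>
     (\<forall>n\<in>I. \<nu> n > 0) \<and> (\<lambda>n. \<nu> n / (1 + (t n)\<^sup>2)) summable_on I \<and>
     (\<exists>A. A holomorphic_on UNIV \<and>
        (\<forall>x::real. A (of_real x) \<in> \<real>) \<and>
        {z. A z = 0} = (\<lambda>n. of_real (t n)) ` I \<and>
        (\<forall>n\<in>I. deriv A (of_real (t n)) \<noteq> 0) \<and>
        de_branges_orthonormal_basis E I
          (\<lambda>n z. of_real (sqrt (\<nu> n)) * divided_zero A (of_real (t n)) z))"

definition lacunary :: "int set \<Rightarrow> (int \<Rightarrow> real) \<Rightarrow> bool" where
  "lacunary I t \<longleftrightarrow>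
     (\<exists>\<kappa>>0. \<forall>n. n \<in> I \<and> n + 1 \<in> I \<longrightarrow> t (n + 1) - t n \<ge> \<kappa> * \<bar>t n\<bar>)"

text \<open>
  For spectral data the first sum is finite and the second converges, because
  \<open>\<nu> n / (1 + (t n)\<^sup>2)\<close> is summable and the points \<open>t n\<close> do not accumulate at \<open>0\<close>.
\<close>

definition regular_data :: "int set \<Rightarrow> (int \<Rightarrow> real) \<Rightarrow> (int \<Rightarrow> real) \<Rightarrow> bool" where
  "regular_data I t \<nu> \<longleftrightarrow>
     (\<exists>c>0. \<forall>n\<in>I.
        (\<Sum>k\<in>{k\<in>I. \<bar>t k\<bar> \<le> \<bar>t n\<bar>}. \<nu> k) +
        (t n)\<^sup>2 * (\<Sum>\<^sub>\<infinity>k\<in>{k\<in>I. \<bar>t k\<bar> > \<bar>t n\<bar>}. \<nu> k / (t k)\<^sup>2) \<le> c * \<nu> n)"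


section \<open>Hausdorff operators\<close>

text \<open>
  Every Borel subset of the half-line is outer and inner regular. Finiteness on compact sets is
  not demanded; with it, regularity on the half-line is automatic, so measures that are regular
  in that narrower sense are included.
\<close>

definition regular_borel_halfline :: "real measure \<Rightarrow> bool" where
  "regular_borel_halfline \<mu> \<longleftrightarrow>
     space \<mu> = {0<..} \<and> sets \<mu> = sets (restrict_space borel {0<..}) \<and>
     (\<forall>B\<in>sets \<mu>.
        emeasure \<mu> B = (INF U\<in>{U. open U \<and> B \<subseteq> U \<and> U \<subseteq> {0<..}}. emeasure \<mu> U) \<and>
        emeasure \<mu> B = (SUP K\<in>{K. compact K \<and> K \<subseteq> B}. emeasure \<mu> K))"

text \<open>
  A \<open>\<mu>\<close>-measurable function is one measurable with respect to the completion of \<open>\<mu>\<close>, so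
  integrals are taken over the completion; for Borel functions this is the integral over \<open>\<mu>\<close>.
\<close>

definition hausdorff_op ::
    "(real \<Rightarrow> real) \<Rightarrow> real measure \<Rightarrow> (complex \<Rightarrow> complex) \<Rightarrow> complex \<Rightarrow> complex" where
  "hausdorff_op \<Phi> \<mu> F z = (\<integral>u. of_real (\<Phi> u) * F (z / of_real u) \<partial>completion \<mu>)"

definition hausdorff_bounded ::
    "(complex \<Rightarrow> complex) \<Rightarrow> (real \<Rightarrow> real) \<Rightarrow> real measure \<Rightarrow> bool" where
  "hausdorff_bounded E \<Phi> \<mu> \<longleftrightarrow>
     (\<forall>F\<in>de_branges E. \<forall>z.
        integrable (completion \<mu>) (\<lambda>u. of_real (\<Phi> u) * F (z / of_real u))) \<and>
     de_branges_bounded_linear E (hausdorff_op \<Phi> \<mu>)"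

end

theory Submission
  imports Defs
begin

text \<open>
  Why the theorem holds. Let \<open>A\<close> be the entire function with zeros \<open>t n\<close> that belongs to the spectral
  data, and write \<open>weight n = 1 / (sqrt (\<nu> n) * \<bar>A' (t n)\<bar>)\<close>. The orthonormal basis of the functions
  \<open>sqrt (\<nu> n) * A z / (z - t n)\<close> turns the norm into a weighted sum of squares of values,
  \<open>\<parallel>F\<parallel>\<^sup>2 = (\<Sum>n. (weight n * \<bar>F (t n)\<bar>)\<^sup>2)\<close>. The heart of the matter is the maximal estimate
  \<open>(\<Sum>n. (weight n * sup {\<bar>F z\<bar>. \<bar>z\<bar> \<le> \<bar>t n\<bar>})\<^sup>2) \<le> D\<^sup>2 * \<parallel>F\<parallel>\<^sup>2\<close> (\<open>maximal_function_bound\<close>). If \<open>\<Phi>\<close>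
  vanishes below \<open>1\<close> and \<open>H\<close> is the Hausdorff operator, then \<open>\<bar>H F (t n)\<bar>\<close> is at most
  \<open>\<integral>\<Phi> d\<mu>\<close> times that supremum, because \<open>\<bar>t n / u\<bar> \<le> \<bar>t n\<bar>\<close> for \<open>u \<ge> 1\<close>. So the maximal estimate bounds
  the norm of \<open>H\<close> by \<open>D * \<integral>\<Phi> d\<mu>\<close>, once the image is known to lie in the space.

  The maximal estimate rests on three facts.
  \<^item> The function \<open>A\<close> is a constant multiple of the product of the factors \<open>1 - z / t n\<close>, with
    the factor \<open>z\<close> for a zero at the origin (\<open>A_canonical_product\<close>). Since \<open>1\<close> lies in the space,
    \<open>1 / A\<close> has a partial fraction expansion with controlled coefficients. Multiplying it by the
    product gives a zero-free entire function of exponential type zero, which is constant.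
  \<^item> The functions \<open>A z / (z - t n)\<close> are therefore dominated by products of the factors
    \<open>1 + r / \<bar>t j\<bar>\<close>, which increase with \<open>r = \<bar>z\<bar>\<close>. By lacunarity, replacing
    \<open>\<bar>t n\<bar> + \<bar>t j\<bar>\<close> by \<open>\<bar>t n - t j\<bar>\<close> for all \<open>j \<noteq> n\<close> changes such a product at \<open>\<bar>t n\<bar>\<close> by a bounded factor only (\<open>separation_product_bounded\<close>).
  \<^item> What remains is the \<open>\<ell>\<^sup>2\<close> boundedness of the matrix
    \<open>(\<nu> k / \<nu> n)\<^bsup>1/2\<^esup> * \<bar>t n\<bar> / (\<bar>t n\<bar> + \<bar>t k\<bar>)\<close>. Regularity says that the partial sums of \<open>\<nu>\<close> and the tails
    of \<open>\<nu> k / (t k)\<^sup>2\<close> are comparable to their extreme terms, so that this is a discrete Hardy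
    inequality, applied once upwards and once downwards (\<open>regular_data_l2_bound\<close>).

  That the image of \<open>F\<close> lies in the space follows by approximation. The operator maps polynomials
  to polynomials; polynomials are dense, since partial products approximate the basis functions in
  norm, being dominated by the same majorants; and norm-bounded pointwise limits stay in the space
  by Fatou's lemma (\<open>de_branges_closed\<close>).

  Conversely, monomials are eigenvectors of the operator with eigenvalues \<open>\<lambda>\<^sub>n\<close>, so boundedness
  bounds the moments, and bounded moments \<open>\<integral>\<Phi> u * u\<^bsup>-n\<^esup> d\<mu>\<close> leave no mass below \<open>1\<close>. The bound on the
  operator norm does not involve the spectral data, so one regular lacunary choice of them provides
  a constant valid for every other choice.
\<close>

section \<open>Square means along horizontal lines\<close>

text \<open>
  A Phragmen--Lindelof principle. Division by \<open>1 - \<i> e z\<close>, whose modulus on the half-plane is at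
  least \<open>1\<close> and grows at infinity, makes the function small on large half-circles, so that the maximum
  principle on a half-disc applies; then \<open>e\<close> tends to \<open>0\<close>.
\<close>

lemma bounded_half_plane_le_boundary:
  fixes g :: "complex \<Rightarrow> complex"
  assumes cont: "continuous_on {z. Im z \<ge> 0} g"
    and hol: "g holomorphic_on {z. Im z > 0}"
    and bdd: "\<And>z. Im z \<ge> 0 \<Longrightarrow> norm (g z) \<le> K1"
    and bdry: "\<And>x. norm (g (of_real x)) \<le> K"
    and z: "Im z \<ge> 0"
  shows "norm (g z) \<le> K"
proof -
  have K0: "K \<ge> 0" "K1 \<ge> 0"
    using order_trans[OF norm_ge_zero bdry[of 0]] order_trans[OF norm_ge_zero bdd[of 0]] by auto
  have key: "norm (g z) \<le> (K + e) * norm (1 - \<i> * of_real e * z)" if e: "e > 0" for e :: real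
  proof -
    define R where "R = norm z + 1 + K1 / (e * e)"
    define S where "S = {z. Im z \<ge> 0} \<inter> cball 0 R"
    define h where "h = (\<lambda>w. g w / (1 - \<i> * of_real e * w))"
    have R: "R > 0" "norm z \<le> R" "K1 / (e * e) \<le> R"
    proof -
      have "K1 / (e * e) \<ge> 0" using K0 e by simp
      then show "R > 0" "norm z \<le> R" "K1 / (e * e) \<le> R"
        unfolding R_def using norm_ge_zero[of z] by linarith+
    qed
    have sq: "(norm (1 - \<i> * of_real e * w))\<^sup>2 = 1 + 2 * e * Im w + e\<^sup>2 * (norm w)\<^sup>2" for w
      unfolding cmod_power2 by (simp add: power2_eq_square algebra_simps)
    have ge1: "norm (1 - \<i> * of_real e * w) \<ge> 1" if "Im w \<ge> 0" for w
      by (rule power2_le_imp_le) (use that e sq[of w] in auto)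
    have geR: "norm (1 - \<i> * of_real e * w) \<ge> e * norm w" if "Im w \<ge> 0" for w
      by (rule power2_le_imp_le) (use that e sq[of w] in \<open>auto simp: power_mult_distrib\<close>)
    have nz: "1 - \<i> * of_real e * w \<noteq> 0" if "Im w \<ge> 0" for w
      using ge1[OF that] by force
    have clS: "closed S" unfolding S_def
      by (intro closed_Int closed_cball closed_halfspace_Im_ge)
    have intS: "interior S \<subseteq> {z. Im z > 0}"
    proof -
      have "interior S \<subseteq> interior {z. Im z \<ge> 0}" by (rule interior_mono) (auto simp: S_def)
      also have "interior {z. Im z \<ge> 0} = {z. Im z > 0}"
        using interior_halfspace_ge[of "\<i>" 0] by (simp add: inner_complex_def)
      finally show ?thesis .
    qed
    have "norm (h z) \<le> K + e"
    proof (rule maximum_modulus_frontier[where S = S and f = h])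
      show "h holomorphic_on interior S" unfolding h_def
        by (intro holomorphic_intros holomorphic_on_subset[OF hol] intS)
           (use intS nz in \<open>auto simp: less_imp_le subset_eq\<close>)
      show "continuous_on (closure S) h" unfolding h_def closure_closed[OF clS]
        by (intro continuous_intros continuous_on_subset[OF cont]) (use nz in \<open>auto simp: S_def\<close>)
      show "bounded S" by (simp add: S_def bounded_Int)
      show "z \<in> S" using z R by (simp add: S_def)
    next
      fix w assume w: "w \<in> frontier S"
      have wS: "w \<in> S" using w clS by (simp add: frontier_subset_closed subset_iff frontier_def)
      have "frontier S \<subseteq> frontier {z. Im z \<ge> 0} \<union> frontier (cball 0 R)"
        unfolding S_def by (rule frontier_Int_subset)
      moreover have "frontier {z. Im z \<ge> 0} = {z. Im z = 0}"
        using frontier_halfspace_ge[of "\<i>" 0] by (simp add: inner_complex_def)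
      moreover have "frontier (cball (0::complex) R) = sphere 0 R"
        by (simp add: frontier_cball)
      ultimately consider "Im w = 0" | "norm w = R" using w by auto
      then show "norm (h w) \<le> K + e"
      proof cases
        case 1
        have "w = of_real (Re w)" using 1 by (simp add: complex_eq_iff)
        then have "norm (g w) \<le> K" using bdry[of "Re w"] by metis
        moreover have "norm (h w) \<le> norm (g w)" unfolding h_def norm_divide
          using ge1[of w] 1 by (simp add: divide_le_eq mult_left_le_imp_le mult_le_cancel_left1)
        ultimately show ?thesis using e by linarith
      next
        case 2
        have w0: "Im w \<ge> 0" using wS by (simp add: S_def)
        have "K1 / e \<le> e * R" using R e by (simp add: field_simps)
        then have "K1 \<le> e * (e * R)" using e by (simp add: field_simps)
        have "norm (g w) \<le> K1" using bdd[OF w0] .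
        also have "\<dots> \<le> e * (e * R)" by fact
        also have "\<dots> \<le> e * norm (1 - \<i> * of_real e * w)"
          using geR[OF w0] 2 e by (intro mult_left_mono) auto
        finally have "norm (h w) \<le> e" unfolding h_def norm_divide
          using ge1[OF w0] by (subst pos_divide_le_eq) (linarith, simp)
        then show ?thesis using K0 by linarith
      qed
    qed
    then show ?thesis unfolding h_def norm_divide
      using ge1[OF z] by (subst (asm) pos_divide_le_eq) (linarith, simp)
  qed
  have "((\<lambda>e::real. (K + e) * norm (1 - \<i> * of_real e * z)) \<longlongrightarrow>
           (K + 0) * norm (1 - \<i> * of_real 0 * z)) (at_right 0)"
    by (intro tendsto_intros)
  moreover have "\<forall>\<^sub>F e in at_right (0::real). norm (g z) \<le> (K + e) * norm (1 - \<i> * of_real e * z)"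
    by (rule eventually_at_rightI[of 0 1]) (use key in auto)
  ultimately have "norm (g z) \<le> (K + 0) * norm (1 - \<i> * of_real 0 * z)"
    by (rule tendsto_lowerbound) simp
  then show ?thesis by simp
qed

lemma integral_segment_le_nn_integral:
  fixes h :: "real \<Rightarrow> real"
  assumes cont: "continuous_on {a..b} h" and nn: "\<And>x. h x \<ge> 0"
    and le: "(\<integral>\<^sup>+ x. ennreal (h x) \<partial>lborel) \<le> ennreal M" and M: "M \<ge> 0"
  shows "integral {a..b} h \<le> M"
proof -
  have si: "set_integrable lborel {a..b} h"
    using borel_integrable_atLeastAtMost'[OF cont] .
  have "ennreal (integral {a..b} h) = ennreal (LINT x:{a..b}|lborel. h x)"
    using set_borel_integral_eq_integral(2)[OF si] by simp
  also have "\<dots> = (\<integral>\<^sup>+ x. ennreal (indicator {a..b} x *\<^sub>R h x) \<partial>lborel)"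
    unfolding set_lebesgue_integral_def
    by (rule nn_integral_eq_integral[symmetric]) (use si nn in \<open>auto simp: set_integrable_def\<close>)
  also have "\<dots> \<le> (\<integral>\<^sup>+ x. ennreal (h x) \<partial>lborel)"
    by (intro nn_integral_mono) (auto simp: indicator_def nn)
  also note le
  finally show ?thesis using M by (simp add: ennreal_le_iff)
qed

lemma nn_integral_le_if_segments:
  fixes h :: "real \<Rightarrow> real"
  assumes cont: "continuous_on UNIV h" and nn: "\<And>x. h x \<ge> 0"
    and le: "\<And>n::nat. integral {- real n..real n} h \<le> M"
  shows "(\<integral>\<^sup>+ x. ennreal (h x) \<partial>lborel) \<le> ennreal M"
proof -
  let ?f = "\<lambda>n x. ennreal (h x) * indicator {- real n..real n} x"
  have [measurable]: "h \<in> borel_measurable borel"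
    using cont by (rule borel_measurable_continuous_onI)
  have inc: "incseq ?f"
    by (auto simp: incseq_def le_fun_def indicator_def)
  have sup: "(SUP n. ?f n x) = ennreal (h x)" for x
  proof (rule antisym)
    show "(SUP n. ?f n x) \<le> ennreal (h x)" by (auto intro!: SUP_least simp: indicator_def)
    obtain n :: nat where "\<bar>x\<bar> \<le> real n" using real_arch_simple by blast
    then have "ennreal (h x) \<le> ?f n x" by (auto simp: indicator_def abs_le_iff)
    then show "ennreal (h x) \<le> (SUP n. ?f n x)" by (rule order_trans) (auto intro: SUP_upper)
  qed
  have seg: "(\<integral>\<^sup>+ x. ?f n x \<partial>lborel) \<le> ennreal M" for n
  proof -
    have si: "set_integrable lborel {- real n..real n} h"
      by (intro borel_integrable_atLeastAtMost' continuous_on_subset[OF cont]) auto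
    have "(\<integral>\<^sup>+ x. ?f n x \<partial>lborel) = (\<integral>\<^sup>+ x. ennreal (indicator {- real n..real n} x *\<^sub>R h x) \<partial>lborel)"
      by (intro nn_integral_cong) (auto simp: indicator_def)
    also have "\<dots> = ennreal (LINT x:{- real n..real n}|lborel. h x)"
      unfolding set_lebesgue_integral_def
      by (rule nn_integral_eq_integral) (use si nn in \<open>auto simp: set_integrable_def\<close>)
    also have "\<dots> = ennreal (integral {- real n..real n} h)"
      using set_borel_integral_eq_integral(2)[OF si] by simp
    finally show ?thesis using le[of n] by (simp add: ennreal_leI)
  qed
  have "(\<integral>\<^sup>+ x. ennreal (h x) \<partial>lborel) = (\<integral>\<^sup>+ x. (SUP n. ?f n x) \<partial>lborel)"
    by (simp only: sup)
  also have "\<dots> = (SUP n. \<integral>\<^sup>+ x. ?f n x \<partial>lborel)"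
    by (rule nn_integral_monotone_convergence_SUP[OF inc]) auto
  also have "\<dots> \<le> ennreal M" by (rule SUP_least) (rule seg)
  finally show ?thesis .
qed

text \<open>
  Correlating \<open>f\<close> with the conjugate of its own restriction to a segment at height \<open>y\<close> gives a
  function \<open>g\<close> that is bounded on the half-plane, and whose value at \<open>\<i> y\<close> is the square mean of \<open>f\<close>
  over that segment. The maximum principle for \<open>g\<close> then compares this mean with the boundary.
\<close>

lemma hardy_line_le_boundary:
  fixes f :: "complex \<Rightarrow> complex"
  assumes cont: "continuous_on {z. Im z \<ge> 0} f"
    and hol: "f holomorphic_on {z. Im z > 0}"
    and bdd: "\<And>y. y > 0 \<Longrightarrow> (\<integral>\<^sup>+ x. ennreal ((cmod (f (Complex x y)))\<^sup>2) \<partial>lborel) \<le> ennreal M"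
    and bdry: "(\<integral>\<^sup>+ x. ennreal ((cmod (f (of_real x)))\<^sup>2) \<partial>lborel) \<le> ennreal N"
    and N: "N \<ge> 0" and M: "M \<ge> 0" and y: "y > 0"
  shows "(\<integral>\<^sup>+ x. ennreal ((cmod (f (Complex x y)))\<^sup>2) \<partial>lborel) \<le> ennreal N"
proof (rule nn_integral_le_if_segments)
  have cont_line: "continuous_on T (\<lambda>s. f (z + of_real s))" if "Im z \<ge> 0" for z T
    by (rule continuous_on_compose2[OF cont]) (use that in \<open>auto intro!: continuous_intros\<close>)
  have Complex0: "Complex s 0 = of_real s" for s by (simp add: complex_eq_iff)
  have Cx: "Complex s v = Complex 0 v + of_real s" for s v by (simp add: complex_eq_iff)
  show "continuous_on UNIV (\<lambda>x. (cmod (f (Complex x y)))\<^sup>2)"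
    using cont_line[of "Complex 0 y" UNIV] y by (subst Cx) (auto intro!: continuous_intros)
  fix n :: nat
  let ?S = "{- real n..real n}"
  define \<phi> where "\<phi> = (\<lambda>s. cnj (f (Complex 0 y + of_real s)))"
  define L where "L = integral ?S (\<lambda>s. (cmod (\<phi> s))\<^sup>2)"
  define g where "g = (\<lambda>z. integral ?S (\<lambda>s. f (z + of_real s) * \<phi> s))"
  have cphi: "continuous_on ?S \<phi>" unfolding \<phi>_def
    using cont_line[of "Complex 0 y" ?S] y by (auto intro!: continuous_intros)
  \<comment> \<open>The bound by arithmetic means loses nothing: at \<open>\<i> y\<close> it reads \<open>L \<le> (N + L) / 2\<close>, that is \<open>L \<le> N\<close>.\<close>
  have g_bound: "norm (g z) \<le> (K + L) / 2"
    if z: "Im z \<ge> 0" and K: "(\<integral>\<^sup>+ x. ennreal ((cmod (f (Complex x (Im z))))\<^sup>2) \<partial>lborel) \<le> ennreal K"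
      and K0: "K \<ge> 0" for z K
  proof -
    have shift: "z + of_real s = Complex (Re z + s) (Im z)" for s by (simp add: complex_eq_iff)
    have K': "integral ?S (\<lambda>s. (cmod (f (z + of_real s)))\<^sup>2) \<le> K"
    proof (rule integral_segment_le_nn_integral[OF _ _ _ K0])
      show "continuous_on ?S (\<lambda>s. (cmod (f (z + of_real s)))\<^sup>2)"
        by (intro continuous_intros cont_line z)
      have "(\<integral>\<^sup>+ s. ennreal ((cmod (f (z + of_real s)))\<^sup>2) \<partial>lborel)
          = (\<integral>\<^sup>+ x. ennreal ((cmod (f (Complex x (Im z))))\<^sup>2) \<partial>lborel)"
      proof -
        have c: "continuous_on UNIV (\<lambda>x. f (Complex x (Im z)))"
          using cont_line[of "Complex 0 (Im z)" UNIV] z by (subst Cx) auto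
        have [measurable]: "(\<lambda>x. f (Complex x (Im z))) \<in> borel_measurable borel"
          by (rule borel_measurable_continuous_onI[OF c])
        show ?thesis
          using nn_integral_real_affine[of "\<lambda>x. ennreal ((cmod (f (Complex x (Im z))))\<^sup>2)" 1 "Re z"]
          by (simp add: shift)
      qed
      then show "(\<integral>\<^sup>+ s. ennreal ((cmod (f (z + of_real s)))\<^sup>2) \<partial>lborel) \<le> ennreal K"
        using K by simp
    qed auto
    have int1: "(\<lambda>s. (cmod (f (z + of_real s)))\<^sup>2) integrable_on ?S"
      by (intro integrable_continuous_interval continuous_intros cont_line z)
    have int2: "(\<lambda>s. (cmod (\<phi> s))\<^sup>2) integrable_on ?S"
      by (intro integrable_continuous_interval continuous_intros cphi)
    have "norm (g z) \<le> integral ?S (\<lambda>s. ((cmod (f (z + of_real s)))\<^sup>2 + (cmod (\<phi> s))\<^sup>2) / 2)"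
      unfolding g_def
    proof (rule integral_norm_bound_integral)
      show "(\<lambda>s. f (z + of_real s) * \<phi> s) integrable_on ?S"
        by (intro integrable_continuous_interval continuous_intros cphi cont_line z)
      show "(\<lambda>s. ((cmod (f (z + of_real s)))\<^sup>2 + (cmod (\<phi> s))\<^sup>2) / 2) integrable_on ?S"
        by (intro integrable_continuous_interval continuous_intros cphi cont_line z) auto
      show "norm (f (z + of_real s) * \<phi> s) \<le> ((cmod (f (z + of_real s)))\<^sup>2 + (cmod (\<phi> s))\<^sup>2) / 2" for s
        using sum_squares_bound[of "cmod (f (z + of_real s))" "cmod (\<phi> s)"]
        by (simp add: norm_mult)
    qed
    also have "\<dots> = (integral ?S (\<lambda>s. (cmod (f (z + of_real s)))\<^sup>2) + L) / 2"
      unfolding L_def using int1 int2 by (simp add: Henstock_Kurzweil_Integration.integral_add)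
    finally show ?thesis using K' by simp
  qed
  have "norm (g (Complex 0 y)) \<le> (N + L) / 2"
  proof (rule bounded_half_plane_le_boundary[where g = g and ?K1.0 = "(max M N + L) / 2"])
    have "continuous_on ({z. Im z \<ge> 0} \<times> ?S) (\<lambda>(z, s). f (z + of_real s) * \<phi> s)"
      unfolding case_prod_beta
      by (intro continuous_intros continuous_on_compose2[OF cont] continuous_on_compose2[OF cphi])
         auto
    then show "continuous_on {z. Im z \<ge> 0} g"
      unfolding g_def using integral_continuous_on_param[of "{z. Im z \<ge> 0}" "- real n" "real n"
        "\<lambda>z s. f (z + of_real s) * \<phi> s"] by (simp add: cbox_interval)
    have "(\<lambda>z. integral (cbox (- real n) (real n)) (\<lambda>s. f (z + of_real s) * \<phi> s)) holomorphic_on {z. Im z > 0}"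
    proof (rule leibniz_rule_holomorphic)
      show "convex {z. Im z > 0}" by (rule convex_halfspace_Im_gt)
      show "(\<lambda>s. f (z + of_real s) * \<phi> s) integrable_on cbox (- real n) (real n)" if "z \<in> {z. Im z > 0}" for z
        using that by (intro integrable_continuous continuous_intros)
          (use cphi cont_line in \<open>auto\<close>)
      have ho: "open {z. Im z > 0}" by (rule open_halfspace_Im_gt)
      show "((\<lambda>z. f (z + of_real s) * \<phi> s) has_field_derivative deriv f (z + of_real s) * \<phi> s)
           (at z within {z. Im z > 0})" if "z \<in> {z. Im z > 0}" for z s
      proof -
        have "(f has_field_derivative deriv f (z + of_real s)) (at (z + of_real s))"
          by (rule holomorphic_derivI[OF hol ho]) (use that in auto)
        then have "((\<lambda>z. f (z + of_real s)) has_field_derivative deriv f (z + of_real s)) (at z)"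
          using DERIV_shift by blast
        then show ?thesis by (rule has_field_derivative_at_within[OF DERIV_cmult_right])
      qed
      show "continuous_on ({z. Im z > 0} \<times> cbox (- real n) (real n))
              (\<lambda>(z, s). deriv f (z + of_real s) * \<phi> s)"
        unfolding case_prod_beta
      proof (intro continuous_on_mult)
        have "continuous_on {z. Im z > 0} (deriv f)"
          by (rule holomorphic_on_imp_continuous_on[OF holomorphic_deriv[OF hol ho]])
        then show "continuous_on ({z. Im z > 0} \<times> cbox (- real n) (real n)) (\<lambda>p. deriv f (fst p + of_real (snd p)))"
          by (rule continuous_on_compose2) (auto intro!: continuous_intros)
        show "continuous_on ({z. Im z > 0} \<times> cbox (- real n) (real n)) (\<lambda>p. \<phi> (snd p))"
          by (rule continuous_on_compose2[OF cphi]) (auto intro!: continuous_intros)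
      qed
    qed
    then show "g holomorphic_on {z. Im z > 0}" by (simp add: g_def)
    show "norm (g z) \<le> (max M N + L) / 2" if "Im z \<ge> 0" for z
    proof (rule g_bound[OF that])
      show "(\<integral>\<^sup>+ x. ennreal ((cmod (f (Complex x (Im z))))\<^sup>2) \<partial>lborel) \<le> ennreal (max M N)"
      proof (cases "Im z = 0")
        case True
        have "ennreal N \<le> ennreal (max M N)" by (rule ennreal_leI) simp
        then show ?thesis using bdry unfolding True Complex0 by (rule order_trans[rotated])
      next
        case False
        have "ennreal M \<le> ennreal (max M N)" by (rule ennreal_leI) simp
        then show ?thesis using order_trans[OF bdd[of "Im z"]] that False by simp
      qed
      show "max M N \<ge> 0" using N by simp
    qed
    show "norm (g (of_real x)) \<le> (N + L) / 2" for x
      by (rule g_bound) (use bdry N in \<open>simp_all add: Complex0\<close>)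
    show "Im (Complex 0 y) \<ge> 0" using y by simp
  qed
  moreover have "g (Complex 0 y) = of_real L"
  proof -
    have "g (Complex 0 y) = integral ?S (\<lambda>s. of_real ((cmod (\<phi> s))\<^sup>2))"
      unfolding g_def \<phi>_def complex_mod_cnj
      by (intro integral_cong) (metis complex_norm_square)
    also have "\<dots> = of_real L"
    proof -
      have "(\<lambda>s. (cmod (\<phi> s))\<^sup>2) integrable_on ?S"
        by (intro integrable_continuous_interval continuous_intros cphi)
      from integral_linear[OF this bounded_linear_of_real[where 'a = complex]] show ?thesis
        by (simp add: o_def L_def)
    qed
    finally show ?thesis .
  qed
  moreover have "L \<ge> 0" unfolding L_def
    by (rule integral_nonneg) (auto intro!: integrable_continuous_interval continuous_intros cphi)
  ultimately have "L \<le> N" by simp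
  then show "integral ?S (\<lambda>x. (cmod (f (Complex x y)))\<^sup>2) \<le> N"
    unfolding L_def \<phi>_def complex_mod_cnj Cx[symmetric] .
qed auto

text \<open>
  This replaces the mean value property over discs. A primitive of \<open>F\<^sup>2\<close> changes by at most \<open>M\<close> under
  horizontal shifts of length at most \<open>1\<close>; by Cauchy's estimate for the derivative of that
  difference, \<open>F\<^sup>2\<close> itself oscillates by at most a multiple of \<open>M\<close> along the segment from \<open>z\<close> to
  \<open>z + 1\<close>, where its mean modulus is at most \<open>M\<close>.
\<close>

lemma entire_bound_by_segments:
  fixes F :: "complex \<Rightarrow> complex"
  assumes hol: "F holomorphic_on UNIV"
    and seg: "\<And>w. w \<in> cball z 1 \<Longrightarrow> integral {0..1} (\<lambda>s. (cmod (F (w + of_real s)))\<^sup>2) \<le> M"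
  shows "(cmod (F z))\<^sup>2 \<le> 3 * M"
proof -
  have contF: "continuous_on S F" for S
    using hol holomorphic_on_imp_continuous_on holomorphic_on_subset by blast
  have int2: "(\<lambda>s. (cmod (F (w + of_real s)))\<^sup>2) integrable_on {a..b}" for w and a b :: real
    by (intro integrable_continuous_interval continuous_intros continuous_on_compose2[OF contF[of UNIV]]) auto
  obtain G where G: "\<And>x. (G has_field_derivative (F x)\<^sup>2) (at x)"
    using holomorphic_convex_primitive'[of UNIV "\<lambda>x. (F x)\<^sup>2"] hol
    by (auto intro: holomorphic_intros)
  have G_diff: "cmod (G (w + of_real s) - G w) \<le> M" if w: "w \<in> cball z 1" and s: "s \<in> {0..1}" for w s
  proof -
    have "((\<lambda>x. (F (w + of_real x))\<^sup>2) has_integral (G (w + of_real s) - G (w + of_real 0))) {0..s}"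
    proof (rule fundamental_theorem_of_calculus)
      fix x :: real
      have "((\<lambda>x. G (w + of_real x)) has_vector_derivative (1 * (F (w + of_real x))\<^sup>2)) (at x)"
        by (rule field_vector_diff_chain_at[of "\<lambda>x. w + of_real x", unfolded o_def])
           (auto intro!: derivative_eq_intros G)
      then show "((\<lambda>x. G (w + of_real x)) has_vector_derivative (F (w + of_real x))\<^sup>2) (at x within {0..s})"
        using has_vector_derivative_at_within by fastforce
    qed (use s in auto)
    then have "cmod (G (w + of_real s) - G w) = cmod (integral {0..s} (\<lambda>x. (F (w + of_real x))\<^sup>2))"
      by (simp add: integral_unique)
    also have "\<dots> \<le> integral {0..s} (\<lambda>s. (cmod (F (w + of_real s)))\<^sup>2)"
      by (rule integral_norm_bound_integral)
         (auto intro!: int2 integrable_continuous_interval continuous_intros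
            continuous_on_compose2[OF contF[of UNIV]] simp: norm_power)
    also have "\<dots> \<le> integral {0..1} (\<lambda>s. (cmod (F (w + of_real s)))\<^sup>2)"
      by (rule integral_subset_le) (use s int2 in auto)
    also have "\<dots> \<le> M" by (rule seg[OF w])
    finally show ?thesis .
  qed
  have M0: "M \<ge> 0" using G_diff[of z 0] by simp
  have osc: "(cmod (F z))\<^sup>2 \<le> (cmod (F (z + of_real s)))\<^sup>2 + 2 * M" if s: "s \<in> {0..1}" for s
  proof -
    let ?D = "\<lambda>w. G (w + of_real s) - G w"
    have D: "(?D has_field_derivative (F (w + of_real s))\<^sup>2 - (F w)\<^sup>2) (at w)" for w
      using G[of "w + of_real s"] by (intro DERIV_diff G) (simp add: DERIV_shift)
    have *: "cmod ((deriv ^^ 1) ?D z) \<le> fact 1 * M' / 1 ^ 1" if "M' > M" for M'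
    proof (rule Cauchy_higher_deriv_bound)
      have h: "?D holomorphic_on UNIV" using D
        by (meson UNIV_I field_differentiable_at_within field_differentiable_def holomorphic_onI)
      then show "?D holomorphic_on ball z 1" by (rule holomorphic_on_subset) auto
      from h show "continuous_on (cball z 1) ?D"
        by (meson holomorphic_on_imp_continuous_on holomorphic_on_subset subset_UNIV)
      show "?D w \<in> ball 0 M'" if "w \<in> ball z 1" for w
        using G_diff[of w s] that s \<open>M' > M\<close> by auto
    qed auto
    have "cmod ((F (z + of_real s))\<^sup>2 - (F z)\<^sup>2) \<le> M + M + 0"
    proof (rule field_le_epsilon)
      fix e :: real assume "e > 0"
      then show "cmod ((F (z + of_real s))\<^sup>2 - (F z)\<^sup>2) \<le> M + M + 0 + e"
        using *[of "M + e"] M0 DERIV_imp_deriv[OF D[of z]] by simp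
    qed
    then show ?thesis
      using norm_triangle_ineq2[of "(F z)\<^sup>2" "(F (z + of_real s))\<^sup>2"]
      by (simp add: norm_power norm_minus_commute)
  qed
  have "(cmod (F z))\<^sup>2 = integral {0..1::real} (\<lambda>s. (cmod (F z))\<^sup>2)" by simp
  also have "\<dots> \<le> integral {0..1} (\<lambda>s. (cmod (F (z + of_real s)))\<^sup>2 + 2 * M)"
    by (rule integral_le) (use osc int2 in \<open>auto intro!: integrable_add\<close>)
  also have "\<dots> = integral {0..1} (\<lambda>s. (cmod (F (z + of_real s)))\<^sup>2) + 2 * M"
    using int2 by (subst Henstock_Kurzweil_Integration.integral_add) auto
  also have "\<dots> \<le> 3 * M" using seg[of z] by simp
  finally show ?thesis .
qed

section \<open>De Branges spaces containing the constants\<close>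

lemma hardy_H2_iff:
  "f \<in> hardy_H2 \<longleftrightarrow> f holomorphic_on {z. Im z > 0} \<and>
     (\<exists>M\<ge>0. \<forall>y>0. (\<integral>\<^sup>+ x. ennreal ((cmod (f (Complex x y)))\<^sup>2) \<partial>lborel) \<le> ennreal M)"
proof -
  let ?N = "\<lambda>y. \<integral>\<^sup>+ x. ennreal ((cmod (f (Complex x y)))\<^sup>2) \<partial>lborel"
  have "(SUP y\<in>{0<..}. ?N y) < \<infinity> \<longleftrightarrow> (\<exists>M\<ge>0. \<forall>y>0. ?N y \<le> ennreal M)"
  proof
    assume fin: "(SUP y\<in>{0<..}. ?N y) < \<infinity>"
    then have "(SUP y\<in>{0<..}. ?N y) = ennreal (enn2real (SUP y\<in>{0<..}. ?N y))"
      by (metis ennreal_enn2real infinity_ennreal_def)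
    then show "\<exists>M\<ge>0. \<forall>y>0. ?N y \<le> ennreal M"
      by (intro exI[of _ "enn2real (SUP y\<in>{0<..}. ?N y)"]) (auto intro!: SUP_upper2)
  next
    assume "\<exists>M\<ge>0. \<forall>y>0. ?N y \<le> ennreal M"
    then obtain M where "\<And>y. y > 0 \<Longrightarrow> ?N y \<le> ennreal M" by blast
    then have "(SUP y\<in>{0<..}. ?N y) \<le> ennreal M" by (auto intro!: SUP_least)
    then show "(SUP y\<in>{0<..}. ?N y) < \<infinity>" by (rule order_le_less_trans) simp
  qed
  then show ?thesis by (simp add: hardy_H2_def)
qed

lemma borel_measurable_on_horizontal_line:
  assumes "f holomorphic_on {z. Im z > 0}" "y > 0"
  shows "(\<lambda>x. f (Complex x y)) \<in> borel_measurable borel"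
proof (rule borel_measurable_continuous_onI)
  have "continuous_on UNIV (\<lambda>x. Complex x y)"
    unfolding Complex_eq by (intro continuous_intros)
  then show "continuous_on UNIV (\<lambda>x. f (Complex x y))"
    by (rule continuous_on_compose2[OF holomorphic_on_imp_continuous_on[OF assms(1)]])
       (use assms(2) in auto)
qed

lemma cmod_square_add_le: "(cmod (x + y))\<^sup>2 \<le> 2 * (cmod x)\<^sup>2 + 2 * (cmod y)\<^sup>2"
proof -
  have "(cmod (x + y))\<^sup>2 \<le> (cmod x + cmod y)\<^sup>2"
    by (intro power_mono norm_triangle_ineq) simp
  then show ?thesis
    using sum_squares_bound[of "cmod x" "cmod y"] by (simp add: power2_sum)
qed

lemma hardy_H2_lincomb:
  assumes f: "f \<in> hardy_H2" and g: "g \<in> hardy_H2"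
  shows "(\<lambda>z. a * f z + b * g z) \<in> hardy_H2"
proof -
  obtain M where M: "M \<ge> 0"
      "\<And>y. y > 0 \<Longrightarrow> (\<integral>\<^sup>+ x. ennreal ((cmod (f (Complex x y)))\<^sup>2) \<partial>lborel) \<le> ennreal M"
    using f by (auto simp: hardy_H2_iff)
  obtain N where N: "N \<ge> 0"
      "\<And>y. y > 0 \<Longrightarrow> (\<integral>\<^sup>+ x. ennreal ((cmod (g (Complex x y)))\<^sup>2) \<partial>lborel) \<le> ennreal N"
    using g by (auto simp: hardy_H2_iff)
  have hf: "f holomorphic_on {z. Im z > 0}" and hg: "g holomorphic_on {z. Im z > 0}"
    using f g by (auto simp: hardy_H2_def)
  let ?A = "2 * (cmod a)\<^sup>2" and ?B = "2 * (cmod b)\<^sup>2"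
  have "(\<integral>\<^sup>+ x. ennreal ((cmod (a * f (Complex x y) + b * g (Complex x y)))\<^sup>2) \<partial>lborel)
        \<le> ennreal (?A * M + ?B * N)" if y: "y > 0" for y
  proof -
    have [measurable]: "(\<lambda>x. f (Complex x y)) \<in> borel_measurable borel"
        "(\<lambda>x. g (Complex x y)) \<in> borel_measurable borel"
      using borel_measurable_on_horizontal_line[OF hf y] borel_measurable_on_horizontal_line[OF hg y] .
    have "(\<integral>\<^sup>+ x. ennreal ((cmod (a * f (Complex x y) + b * g (Complex x y)))\<^sup>2) \<partial>lborel)
       \<le> (\<integral>\<^sup>+ x. ennreal ?A * ennreal ((cmod (f (Complex x y)))\<^sup>2)
              + ennreal ?B * ennreal ((cmod (g (Complex x y)))\<^sup>2) \<partial>lborel)"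
    proof (rule nn_integral_mono)
      fix x
      have "(cmod (a * f (Complex x y) + b * g (Complex x y)))\<^sup>2
          \<le> ?A * (cmod (f (Complex x y)))\<^sup>2 + ?B * (cmod (g (Complex x y)))\<^sup>2"
        using cmod_square_add_le[of "a * f (Complex x y)" "b * g (Complex x y)"]
        by (simp add: norm_mult power_mult_distrib algebra_simps)
      then show "ennreal ((cmod (a * f (Complex x y) + b * g (Complex x y)))\<^sup>2)
         \<le> ennreal ?A * ennreal ((cmod (f (Complex x y)))\<^sup>2)
              + ennreal ?B * ennreal ((cmod (g (Complex x y)))\<^sup>2)"
        by (simp add: ennreal_mult'[symmetric] ennreal_plus[symmetric] ennreal_leI del: ennreal_plus)
    qed
    also have "\<dots> = ennreal ?A * (\<integral>\<^sup>+ x. ennreal ((cmod (f (Complex x y)))\<^sup>2) \<partial>lborel)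
              + ennreal ?B * (\<integral>\<^sup>+ x. ennreal ((cmod (g (Complex x y)))\<^sup>2) \<partial>lborel)"
      by (simp add: nn_integral_add nn_integral_cmult)
    also have "\<dots> \<le> ennreal ?A * ennreal M + ennreal ?B * ennreal N"
      by (intro add_mono mult_left_mono M N y) auto
    also have "\<dots> = ennreal (?A * M + ?B * N)"
      using M(1) N(1) by (simp add: ennreal_mult' ennreal_plus)
    finally show ?thesis .
  qed
  then show ?thesis
    unfolding hardy_H2_iff using hf hg M(1) N(1)
    by (intro conjI exI[of _ "?A * M + ?B * N"]) (auto intro!: holomorphic_intros)
qed

lemma reflect_reflect [simp]: "reflect (reflect F) = F"
  by (simp add: reflect_def fun_eq_iff)

lemma cmod_reflect_of_real [simp]: "cmod (reflect F (of_real x)) = cmod (F (of_real x))"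
  by (simp add: reflect_def)

lemma reflect_holomorphic_UNIV:
  assumes "F holomorphic_on UNIV"
  shows "reflect F holomorphic_on UNIV"
proof -
  have "(cnj \<circ> F \<circ> cnj) holomorphic_on UNIV"
    by (rule holomorphic_on_compose_cnj_cnj) (use assms in auto)
  then show ?thesis by (simp add: reflect_def[abs_def] o_def)
qed

lemma reflect_de_branges: "F \<in> de_branges E \<Longrightarrow> reflect F \<in> de_branges E"
  by (auto simp: de_branges_def intro: reflect_holomorphic_UNIV)

lemma de_branges_norm_reflect [simp]: "de_branges_norm E (reflect F) = de_branges_norm E F"
  by (simp add: de_branges_norm_def norm_divide)

lemma de_branges_holomorphic: "F \<in> de_branges E \<Longrightarrow> F holomorphic_on S"
  by (auto simp: de_branges_def intro: holomorphic_on_subset)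

lemma de_branges_lincomb:
  assumes F: "F \<in> de_branges E" and G: "G \<in> de_branges E"
  shows "(\<lambda>z. a * F z + b * G z) \<in> de_branges E"
proof -
  have eq1: "(\<lambda>z. (a * F z + b * G z) / E z) = (\<lambda>z. a * (F z / E z) + b * (G z / E z))"
    by (simp add: add_divide_distrib)
  have eq2: "(\<lambda>z. reflect (\<lambda>z. a * F z + b * G z) z / E z)
      = (\<lambda>z. cnj a * (reflect F z / E z) + cnj b * (reflect G z / E z))"
    by (simp add: reflect_def add_divide_distrib)
  show ?thesis
    using F G unfolding de_branges_def mem_Collect_eq eq1 eq2
    by (intro conjI hardy_H2_lincomb) (auto intro!: holomorphic_intros)
qed

lemma de_branges_scale: "F \<in> de_branges E \<Longrightarrow> (\<lambda>z. a * F z) \<in> de_branges E"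
  using de_branges_lincomb[of F E F a 0] by simp

lemma de_branges_diff:
  "F \<in> de_branges E \<Longrightarrow> G \<in> de_branges E \<Longrightarrow> (\<lambda>z. F z - G z) \<in> de_branges E"
  using de_branges_lincomb[of F E G 1 "-1"] by simp

text \<open>
  When the constants lie in the space, \<open>E\<close> has no real zeros, so that \<open>F / E\<close> is continuous up to the
  real axis for all \<open>F\<close> in the space, and its square means on horizontal lines can be compared
  with its boundary values.
\<close>

locale de_branges_with_constants =
  fixes E :: "complex \<Rightarrow> complex"
  assumes hermite_biehler: "hermite_biehler E"
    and one_mem: "(\<lambda>_. 1) \<in> de_branges E"
begin

lemma E_holomorphic: "E holomorphic_on S"
  using hermite_biehler by (auto simp: hermite_biehler_def intro: holomorphic_on_subset)

lemma E_continuous: "continuous_on S E"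
  by (rule holomorphic_on_imp_continuous_on[OF E_holomorphic])

lemma E_nonzero_upper: "Im z > 0 \<Longrightarrow> E z \<noteq> 0"
  using hermite_biehler by (auto simp: hermite_biehler_def)

text \<open>
  Near a real zero \<open>a\<close> the modulus of \<open>E\<close> is at most \<open>L\<close> times the distance, so that the square mean
  of \<open>1 / E\<close> at height \<open>y\<close> would be at least \<open>1 / (L\<^sup>2 * y)\<close>, which is unbounded as \<open>y\<close> tends to \<open>0\<close>.
\<close>

lemma E_nonzero_real: "E (of_real a) \<noteq> 0"
proof
  assume Ea: "E (of_real a) = 0"
  obtain M where M: "M \<ge> 0"
      "\<And>y. y > 0 \<Longrightarrow> (\<integral>\<^sup>+ x. ennreal ((cmod (1 / E (Complex x y)))\<^sup>2) \<partial>lborel) \<le> ennreal M"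
    using one_mem by (auto simp: de_branges_def hardy_H2_iff)
  have "(E has_field_derivative deriv E (of_real a)) (at (of_real a))"
    using holomorphic_derivI[OF E_holomorphic[of UNIV]] by simp
  then have "((\<lambda>h. E (of_real a + h) / h) \<longlongrightarrow> deriv E (of_real a)) (at 0)"
    by (simp add: DERIV_def Ea)
  then have "\<forall>\<^sub>F h in at 0. norm (E (of_real a + h) / h) < norm (deriv E (of_real a)) + 1"
    by (intro order_tendstoD(2)[OF tendsto_norm]) auto
  then obtain d where d: "d > 0" "\<And>h. h \<noteq> 0 \<Longrightarrow> norm h < d \<Longrightarrow>
       norm (E (of_real a + h) / h) < norm (deriv E (of_real a)) + 1"
    by (auto simp: eventually_at)
  define L where "L = norm (deriv E (of_real a)) + 1"
  have L: "L > 0" by (simp add: L_def add_nonneg_pos)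
  have near: "norm (E (of_real a + h)) \<le> L * norm h" if "norm h < d" for h
    using d(2)[of h] that Ea by (cases "h = 0") (auto simp: L_def norm_divide field_simps)
  \<comment> \<open>At this height the square mean over \<open>[a - y, a + y]\<close> alone exceeds \<open>M\<close>.\<close>
  define y where "y = min (d / 4) (1 / (L\<^sup>2 * (M + 1)))"
  have y: "y > 0" "4 * y \<le> d" "y \<le> 1 / (L\<^sup>2 * (M + 1))"
    using d(1) L M(1) by (auto simp: y_def min_def)
  have low: "1 / (2 * L\<^sup>2 * y\<^sup>2) \<le> (cmod (1 / E (Complex x y)))\<^sup>2" if x: "x \<in> {a - y..a + y}" for x
  proof -
    have h2: "(norm (Complex (x - a) y))\<^sup>2 \<le> 2 * y\<^sup>2"
      using x abs_le_square_iff[of "x - a" y] y(1) by (auto simp: cmod_power2)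
    also have "\<dots> \<le> (2 * y)\<^sup>2" by (simp add: power_mult_distrib)
    finally have "norm (Complex (x - a) y) \<le> 2 * y"
      by (rule power2_le_imp_le) (use y in simp)
    then have "norm (Complex (x - a) y) < d" using y d(1) by linarith
    moreover have "of_real a + Complex (x - a) y = Complex x y" by (simp add: complex_eq_iff)
    ultimately have "norm (E (Complex x y)) \<le> L * norm (Complex (x - a) y)"
      using near[of "Complex (x - a) y"] by simp
    then have "(norm (E (Complex x y)))\<^sup>2 \<le> L\<^sup>2 * (norm (Complex (x - a) y))\<^sup>2"
      unfolding power_mult_distrib[symmetric] by (rule power_mono) simp
    also have "\<dots> \<le> L\<^sup>2 * (2 * y\<^sup>2)" by (rule mult_left_mono[OF h2]) simp
    finally have "(norm (E (Complex x y)))\<^sup>2 \<le> 2 * L\<^sup>2 * y\<^sup>2" by simp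
    moreover have "norm (E (Complex x y)) > 0" using E_nonzero_upper[of "Complex x y"] y by simp
    ultimately show ?thesis
      using y L by (simp add: norm_divide power_divide divide_left_mono)
  qed
  have "ennreal (1 / (L\<^sup>2 * y)) = (\<integral>\<^sup>+ x. ennreal (1 / (2 * L\<^sup>2 * y\<^sup>2)) * indicator {a - y..a + y} x \<partial>lborel)"
    using y L by (subst nn_integral_cmult_indicator)
       (auto simp: ennreal_mult'[symmetric] power2_eq_square field_simps)
  also have "\<dots> \<le> (\<integral>\<^sup>+ x. ennreal ((cmod (1 / E (Complex x y)))\<^sup>2) \<partial>lborel)"
    using low by (intro nn_integral_mono) (auto simp: indicator_def intro!: ennreal_leI)
  also have "\<dots> \<le> ennreal M" using M y by simp
  finally have "1 / (L\<^sup>2 * y) \<le> M" using M by (simp add: ennreal_le_iff)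
  moreover have "M + 1 \<le> 1 / (L\<^sup>2 * y)"
  proof -
    have "L\<^sup>2 * (M + 1) > 0" using L M(1) by simp
    from y(3)[unfolded pos_le_divide_eq[OF this]] show ?thesis
      using y(1) L by (simp add: pos_le_divide_eq algebra_simps)
  qed
  ultimately show False by simp
qed

lemma E_nonzero: "Im z \<ge> 0 \<Longrightarrow> E z \<noteq> 0"
proof (cases "Im z = 0")
  case True
  then have "z = of_real (Re z)" by (simp add: complex_eq_iff)
  then show ?thesis using E_nonzero_real[of "Re z"] by metis
qed (use E_nonzero_upper[of z] in auto)

lemma quotient_continuous:
  assumes "F \<in> de_branges E"
  shows "continuous_on {z. Im z \<ge> 0} (\<lambda>z. F z / E z)"
  by (intro continuous_intros E_continuous holomorphic_on_imp_continuous_on[OF de_branges_holomorphic[OF assms]])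
     (use E_nonzero in auto)

lemma quotient_real_continuous:
  assumes "F \<in> de_branges E"
  shows "continuous_on UNIV (\<lambda>t. F (of_real t) / E (of_real t))"
  by (rule continuous_on_compose2[OF quotient_continuous[OF assms]]) (auto intro!: continuous_intros)

lemma quotient_real_measurable [measurable]:
  assumes "F \<in> de_branges E"
  shows "(\<lambda>t. F (of_real t) / E (of_real t)) \<in> borel_measurable borel"
  by (rule borel_measurable_continuous_onI[OF quotient_real_continuous[OF assms]])

text \<open>
  Fatou's lemma along heights that tend to \<open>0\<close>.
\<close>

lemma boundary_integrable:
  assumes F: "F \<in> de_branges E"
  shows "integrable lborel (\<lambda>t. (cmod (F (of_real t) / E (of_real t)))\<^sup>2)"
proof -
  note [measurable] = quotient_real_measurable[OF F]
  define f where "f = (\<lambda>z. F z / E z)"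
  obtain M where M: "M \<ge> 0"
      "\<And>y. y > 0 \<Longrightarrow> (\<integral>\<^sup>+ x. ennreal ((cmod (f (Complex x y)))\<^sup>2) \<partial>lborel) \<le> ennreal M"
    and hol: "f holomorphic_on {z. Im z > 0}"
    using F by (auto simp: de_branges_def hardy_H2_iff f_def)
  define y where "y = (\<lambda>n. inverse (real (Suc n)))"
  have y: "y n > 0" for n by (simp add: y_def)
  have [measurable]: "(\<lambda>x. f (Complex x (y n))) \<in> borel_measurable borel" for n
    by (rule borel_measurable_on_horizontal_line[OF hol y])
  have lim: "(\<lambda>n. f (Complex x (y n))) \<longlonglongrightarrow> f (of_real x)" for x
  proof (rule continuous_on_tendsto_compose[OF quotient_continuous[OF F, folded f_def]])
    have "(\<lambda>n. of_real x + \<i> * of_real (y n)) \<longlonglongrightarrow> of_real x + \<i> * of_real 0"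
      unfolding y_def by (intro tendsto_intros LIMSEQ_inverse_real_of_nat)
    then show "(\<lambda>n. Complex x (y n)) \<longlonglongrightarrow> of_real x" by (simp add: Complex_eq)
  qed (use less_imp_le[OF y] in \<open>auto\<close>)
  have "(\<integral>\<^sup>+ x. ennreal ((cmod (f (of_real x)))\<^sup>2) \<partial>lborel)
     = (\<integral>\<^sup>+ x. liminf (\<lambda>n. ennreal ((cmod (f (Complex x (y n))))\<^sup>2)) \<partial>lborel)"
  proof (intro nn_integral_cong)
    fix x
    have "(\<lambda>n. ennreal ((cmod (f (Complex x (y n))))\<^sup>2)) \<longlonglongrightarrow> ennreal ((cmod (f (of_real x)))\<^sup>2)"
      by (intro tendsto_intros lim tendsto_ennrealI)
    then show "ennreal ((cmod (f (of_real x)))\<^sup>2) = liminf (\<lambda>n. ennreal ((cmod (f (Complex x (y n))))\<^sup>2))"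
      by (rule lim_imp_Liminf[symmetric, rotated]) simp
  qed
  also have "\<dots> \<le> liminf (\<lambda>n. \<integral>\<^sup>+ x. ennreal ((cmod (f (Complex x (y n))))\<^sup>2) \<partial>lborel)"
    by (rule nn_integral_liminf) measurable
  also have "\<dots> \<le> ennreal M"
    by (rule Liminf_le) (use M y in \<open>auto\<close>)
  finally have "(\<integral>\<^sup>+ x. ennreal ((cmod (f (of_real x)))\<^sup>2) \<partial>lborel) < \<infinity>"
    by (rule order_le_less_trans) simp
  then show ?thesis
    by (intro integrableI_nonneg) (auto simp: f_def)
qed

lemma de_branges_norm_nonneg [simp]: "de_branges_norm E F \<ge> 0"
  by (simp add: de_branges_norm_def)

lemma nn_integral_boundary:
  assumes F: "F \<in> de_branges E"
  shows "(\<integral>\<^sup>+ t. ennreal ((cmod (F (of_real t) / E (of_real t)))\<^sup>2) \<partial>lborel)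
          = ennreal ((de_branges_norm E F)\<^sup>2)"
  unfolding de_branges_norm_def
  by (subst nn_integral_eq_integral[OF boundary_integrable[OF F]]) auto

lemma nn_integral_line_le_norm:
  assumes F: "F \<in> de_branges E" and y: "y \<ge> 0"
  shows "(\<integral>\<^sup>+ x. ennreal ((cmod (F (Complex x y) / E (Complex x y)))\<^sup>2) \<partial>lborel)
          \<le> ennreal ((de_branges_norm E F)\<^sup>2)"
proof (cases "y = 0")
  case True
  have "Complex x 0 = of_real x" for x by (simp add: complex_eq_iff)
  then show ?thesis using nn_integral_boundary[OF F] True by simp
next
  case False
  obtain M where "M \<ge> 0"
      "\<And>y. y > 0 \<Longrightarrow> (\<integral>\<^sup>+ x. ennreal ((cmod (F (Complex x y) / E (Complex x y)))\<^sup>2) \<partial>lborel) \<le> ennreal M"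
    and "(\<lambda>z. F z / E z) holomorphic_on {z. Im z > 0}"
    using F by (auto simp: de_branges_def hardy_H2_iff)
  then show ?thesis
    using nn_integral_boundary[OF F] y False
    by (auto intro: hardy_line_le_boundary[OF quotient_continuous[OF F], of M])
qed

text \<open>
  Completeness in the form in which it is used: square means on each line pass to pointwise limits by
  Fatou's lemma, and they are bounded uniformly in the height by the norms.
\<close>

lemma de_branges_closed:
  assumes mem: "\<And>n::nat. G n \<in> de_branges E" and le: "\<And>n. de_branges_norm E (G n) \<le> M"
    and lim: "\<And>z. (\<lambda>n. G n z) \<longlonglongrightarrow> F z" and hol: "F holomorphic_on UNIV"
  shows "F \<in> de_branges E" and "de_branges_norm E F \<le> M"
proof -
  have M: "M \<ge> 0" using le[of 0] de_branges_norm_nonneg order_trans by blast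
  have fatou: "(\<integral>\<^sup>+ x. ennreal ((cmod (f (Complex x y) / E (Complex x y)))\<^sup>2) \<partial>lborel) \<le> ennreal (M\<^sup>2)"
    if mem: "\<And>n. g n \<in> de_branges E" and le: "\<And>n. de_branges_norm E (g n) \<le> M"
      and lim: "\<And>z. (\<lambda>n. g n z) \<longlonglongrightarrow> f z" and y: "y \<ge> 0" for g f y
  proof -
    have c: "continuous_on UNIV (\<lambda>x. Complex x y)" unfolding Complex_eq by (intro continuous_intros)
    have [measurable]: "(\<lambda>x. g n (Complex x y) / E (Complex x y)) \<in> borel_measurable borel" for n
      by (rule borel_measurable_continuous_onI,
          rule continuous_on_compose2[OF quotient_continuous[OF mem] c]) (use y in auto)
    have "(\<integral>\<^sup>+ x. ennreal ((cmod (f (Complex x y) / E (Complex x y)))\<^sup>2) \<partial>lborel)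
        = (\<integral>\<^sup>+ x. liminf (\<lambda>n. ennreal ((cmod (g n (Complex x y) / E (Complex x y)))\<^sup>2)) \<partial>lborel)"
    proof (intro nn_integral_cong)
      fix x
      have nz: "E (Complex x y) \<noteq> 0" by (rule E_nonzero) (use y in simp)
      have "(\<lambda>n. ennreal ((cmod (g n (Complex x y) / E (Complex x y)))\<^sup>2))
             \<longlonglongrightarrow> ennreal ((cmod (f (Complex x y) / E (Complex x y)))\<^sup>2)"
        by (intro tendsto_intros lim tendsto_ennrealI nz)
      then show "ennreal ((cmod (f (Complex x y) / E (Complex x y)))\<^sup>2)
          = liminf (\<lambda>n. ennreal ((cmod (g n (Complex x y) / E (Complex x y)))\<^sup>2))"
        by (rule lim_imp_Liminf[symmetric, rotated]) simp
    qed
    also have "\<dots> \<le> liminf (\<lambda>n. \<integral>\<^sup>+ x. ennreal ((cmod (g n (Complex x y) / E (Complex x y)))\<^sup>2) \<partial>lborel)"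
      by (rule nn_integral_liminf) measurable
    also have "\<dots> \<le> ennreal (M\<^sup>2)"
    proof (rule Liminf_le)
      show "\<forall>\<^sub>F n in sequentially. (\<integral>\<^sup>+ x. ennreal ((cmod (g n (Complex x y) / E (Complex x y)))\<^sup>2) \<partial>lborel)
             \<le> ennreal (M\<^sup>2)"
        by (intro always_eventually allI order_trans[OF nn_integral_line_le_norm[OF mem y]]
              ennreal_leI power_mono le de_branges_norm_nonneg)
    qed simp
    finally show ?thesis .
  qed
  have limr: "(\<lambda>n. reflect (G n) z) \<longlonglongrightarrow> reflect F z" for z
    unfolding reflect_def by (intro tendsto_intros lim)
  have "(\<lambda>z. F z / E z) \<in> hardy_H2" unfolding hardy_H2_iff
    by (intro conjI exI[of _ "M\<^sup>2"] allI impI fatou[OF mem le lim])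
       (auto intro!: holomorphic_intros E_holomorphic holomorphic_on_subset[OF hol] dest: E_nonzero_upper)
  moreover have "(\<lambda>z. reflect F z / E z) \<in> hardy_H2" unfolding hardy_H2_iff
    by (intro conjI exI[of _ "M\<^sup>2"] allI impI fatou[OF reflect_de_branges[OF mem] _ limr])
       (auto intro!: holomorphic_intros E_holomorphic holomorphic_on_subset[OF reflect_holomorphic_UNIV[OF hol]] le
             dest: E_nonzero_upper)
  ultimately show F: "F \<in> de_branges E" using hol by (simp add: de_branges_def)
  have "Complex x 0 = of_real x" for x by (simp add: complex_eq_iff)
  then have "ennreal ((de_branges_norm E F)\<^sup>2) \<le> ennreal (M\<^sup>2)"
    using fatou[OF mem le lim, of 0] nn_integral_boundary[OF F] by simp
  then have "(de_branges_norm E F)\<^sup>2 \<le> M\<^sup>2" by (simp add: ennreal_le_iff)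
  then show "de_branges_norm E F \<le> M" using M by (rule power2_le_imp_le)
qed

text \<open>
  On a horizontal segment in the closed upper half-plane, \<open>\<bar>F\<bar>\<close> is the product of the bounded
  function \<open>\<bar>E\<bar>\<close> and of \<open>\<bar>F / E\<bar>\<close>, whose square mean is at most \<open>\<parallel>F\<parallel>\<^sup>2\<close>; below the real axis the same
  holds for the reflected function.
\<close>

lemma evaluation_bounded:
  obtains C where "C > 0" "\<And>F z. F \<in> de_branges E \<Longrightarrow> norm z \<le> R \<Longrightarrow> norm (F z) \<le> C * de_branges_norm E F"
proof -
  have "compact (cball (0::complex) (R + 2))" by simp
  from compact_imp_bounded[OF compact_continuous_image[OF E_continuous this]]
  obtain K where K: "K > 0" "\<And>z. norm z \<le> R + 2 \<Longrightarrow> norm (E z) \<le> K"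
    unfolding bounded_pos by auto
  have upper: "integral {0..1} (\<lambda>s. (cmod (F (w + of_real s)))\<^sup>2) \<le> K\<^sup>2 * (de_branges_norm E F)\<^sup>2"
    if F: "F \<in> de_branges E" and w: "norm w \<le> R + 1" "Im w \<ge> 0" for F w
  proof -
    let ?q = "\<lambda>z. F z / E z"
    have shift: "w + of_real s = Complex (Re w + s) (Im w)" for s by (simp add: complex_eq_iff)
    have cont: "continuous_on S (\<lambda>s. ?q (w + of_real s))" for S :: "real set"
      by (rule continuous_on_compose2[OF quotient_continuous[OF F]])
         (use w in \<open>auto intro!: continuous_intros\<close>)
    have contF: "continuous_on S (\<lambda>s. F (w + of_real s))" for S :: "real set"
      by (rule continuous_on_compose2[OF holomorphic_on_imp_continuous_on[OF de_branges_holomorphic[OF F, of UNIV]]])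
         (auto intro!: continuous_intros)
    have "integral {0..1} (\<lambda>s. (cmod (?q (w + of_real s)))\<^sup>2) \<le> (de_branges_norm E F)\<^sup>2"
    proof (rule integral_segment_le_nn_integral)
      show "continuous_on {0..1} (\<lambda>s. (cmod (?q (w + of_real s)))\<^sup>2)"
        by (intro continuous_on_power continuous_on_norm cont)
      have c: "continuous_on UNIV (\<lambda>x. Complex x (Im w))" unfolding Complex_eq by (intro continuous_intros)
      have [measurable]: "(\<lambda>x. ?q (Complex x (Im w))) \<in> borel_measurable borel"
        by (rule borel_measurable_continuous_onI,
            rule continuous_on_compose2[OF quotient_continuous[OF F] c]) (use w in auto)
      have "(\<integral>\<^sup>+ s. ennreal ((cmod (?q (w + of_real s)))\<^sup>2) \<partial>lborel)
         = (\<integral>\<^sup>+ x. ennreal ((cmod (?q (Complex x (Im w))))\<^sup>2) \<partial>lborel)"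
        using nn_integral_real_affine[of "\<lambda>x. ennreal ((cmod (?q (Complex x (Im w))))\<^sup>2)" 1 "Re w"]
        by (simp add: shift)
      then show "(\<integral>\<^sup>+ s. ennreal ((cmod (?q (w + of_real s)))\<^sup>2) \<partial>lborel) \<le> ennreal ((de_branges_norm E F)\<^sup>2)"
        using nn_integral_line_le_norm[OF F w(2)] by simp
    qed auto
    moreover have "integral {0..1} (\<lambda>s. (cmod (F (w + of_real s)))\<^sup>2)
       \<le> integral {0..1} (\<lambda>s. K\<^sup>2 * (cmod (?q (w + of_real s)))\<^sup>2)"
    proof (rule integral_le)
      show "(\<lambda>s. (cmod (F (w + of_real s)))\<^sup>2) integrable_on {0..1}"
        by (intro integrable_continuous_interval continuous_intros contF)
      show "(\<lambda>s. K\<^sup>2 * (cmod (?q (w + of_real s)))\<^sup>2) integrable_on {0..1}"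
        by (intro integrable_continuous_interval continuous_on_mult continuous_on_power continuous_on_norm
              continuous_on_const cont)
      fix s :: real assume s: "s \<in> {0..1}"
      have "norm (w + of_real s) \<le> norm w + norm (complex_of_real s)" by (rule norm_triangle_ineq)
      then have "norm (w + of_real s) \<le> R + 2" using s w by simp
      then have "cmod (E (w + of_real s)) \<le> K" by (rule K)
      then have "cmod (F (w + of_real s)) \<le> K * cmod (?q (w + of_real s))"
        using E_nonzero[of "w + of_real s"] w by (simp add: norm_divide field_simps mult_right_mono)
      then show "(cmod (F (w + of_real s)))\<^sup>2 \<le> K\<^sup>2 * (cmod (?q (w + of_real s)))\<^sup>2"
        by (metis norm_ge_zero power_mono power_mult_distrib)
    qed
    moreover have "integral {0..1} (\<lambda>s. K\<^sup>2 * (cmod (?q (w + of_real s)))\<^sup>2)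
        = K\<^sup>2 * integral {0..1} (\<lambda>s. (cmod (?q (w + of_real s)))\<^sup>2)"
      by (rule integral_mult_right)
    ultimately show ?thesis
      using mult_left_mono[of "integral {0..1} (\<lambda>s. (cmod (?q (w + of_real s)))\<^sup>2)" "(de_branges_norm E F)\<^sup>2" "K\<^sup>2"]
      by simp
  qed
  have bound: "norm (F z) \<le> 2 * K * de_branges_norm E F" if F: "F \<in> de_branges E" and z: "norm z \<le> R" for F z
  proof -
    have "(cmod (F z))\<^sup>2 \<le> 3 * (K\<^sup>2 * (de_branges_norm E F)\<^sup>2)"
    proof (rule entire_bound_by_segments[OF de_branges_holomorphic[OF F]])
      fix w assume "w \<in> cball z 1"
      then have w: "norm w \<le> R + 1" using z norm_triangle_sub[of w z] by (simp add: dist_norm norm_minus_commute)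
      show "integral {0..1} (\<lambda>s. (cmod (F (w + of_real s)))\<^sup>2) \<le> K\<^sup>2 * (de_branges_norm E F)\<^sup>2"
      proof (cases "Im w \<ge> 0")
        case True then show ?thesis by (rule upper[OF F w])
      next
        case False
        have "cmod (reflect F (cnj w + of_real s)) = cmod (F (w + of_real s))" for s
          by (simp add: reflect_def)
        then show ?thesis using upper[OF reflect_de_branges[OF F], of "cnj w"] w False by simp
      qed
    qed
    also have "\<dots> \<le> (2 * K * de_branges_norm E F)\<^sup>2" by (simp add: power_mult_distrib)
    finally show ?thesis by (rule power2_le_imp_le) (use K in simp)
  qed
  show ?thesis by (rule that[of "2 * K"]) (use K bound in auto)
qed

lemma inner_integrable:
  assumes F: "F \<in> de_branges E" and G: "G \<in> de_branges E"
  shows "integrable lborel (\<lambda>t. (F (of_real t) / E (of_real t)) * cnj (G (of_real t) / E (of_real t)))"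
proof (rule Bochner_Integration.integrable_bound)
  show "integrable lborel (\<lambda>t. (cmod (F (of_real t) / E (of_real t)))\<^sup>2 + (cmod (G (of_real t) / E (of_real t)))\<^sup>2)"
    by (intro Bochner_Integration.integrable_add boundary_integrable F G)
  have "continuous_on UNIV (\<lambda>t. (F (of_real t) / E (of_real t)) * cnj (G (of_real t) / E (of_real t)))"
    by (intro continuous_on_mult continuous_on_cnj quotient_real_continuous F G)
  from borel_measurable_continuous_onI[OF this] show "(\<lambda>t. (F (of_real t) / E (of_real t)) * cnj (G (of_real t) / E (of_real t))) \<in> borel_measurable lborel"
    by simp
  have "cmod (x * cnj y) \<le> norm ((cmod x)\<^sup>2 + (cmod y)\<^sup>2)" for x y
  proof -
    have "0 \<le> cmod x * cmod y" by simp
    then have "cmod x * cmod y \<le> (cmod x)\<^sup>2 + (cmod y)\<^sup>2"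
      using sum_squares_bound[of "cmod x" "cmod y"] by linarith
    then show ?thesis by (simp add: norm_mult)
  qed
  then show "AE t in lborel. norm ((F (of_real t) / E (of_real t)) * cnj (G (of_real t) / E (of_real t)))
      \<le> norm ((cmod (F (of_real t) / E (of_real t)))\<^sup>2 + (cmod (G (of_real t) / E (of_real t)))\<^sup>2)"
    by blast
qed

lemma inner_lincomb_left:
  assumes F: "F \<in> de_branges E" and G: "G \<in> de_branges E" and H: "H \<in> de_branges E"
  shows "de_branges_inner E (\<lambda>z. a * F z + b * G z) H = a * de_branges_inner E F H + b * de_branges_inner E G H"
proof -
  have "(\<lambda>t. ((a * F (of_real t) + b * G (of_real t)) / E (of_real t)) * cnj (H (of_real t) / E (of_real t)))
     = (\<lambda>t. a * ((F (of_real t) / E (of_real t)) * cnj (H (of_real t) / E (of_real t)))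
          + b * ((G (of_real t) / E (of_real t)) * cnj (H (of_real t) / E (of_real t))))"
    by (simp add: add_divide_distrib algebra_simps)
  moreover have "(\<integral>t. a * u t + b * v t \<partial>lborel) = a * (\<integral>t. u t \<partial>lborel) + b * (\<integral>t. v t \<partial>lborel)"
    if "integrable lborel u" "integrable lborel v" for u v :: "real \<Rightarrow> complex"
    using that by simp
  ultimately show ?thesis unfolding de_branges_inner_def
    using inner_integrable[OF F H] inner_integrable[OF G H] by presburger
qed

lemma inner_commute: "de_branges_inner E F G = cnj (de_branges_inner E G F)"
  unfolding de_branges_inner_def
  by (subst Bochner_Integration.integral_cnj[symmetric]) (simp add: mult.commute)

lemma inner_self: "de_branges_inner E F F = of_real ((de_branges_norm E F)\<^sup>2)"
proof -
  have "de_branges_inner E F F = (\<integral>t. of_real ((cmod (F (of_real t) / E (of_real t)))\<^sup>2) \<partial>lborel)"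
    unfolding de_branges_inner_def by (simp only: complex_norm_square)
  then show ?thesis by (simp add: de_branges_norm_def del: of_real_power)
qed

end

section \<open>A discrete Hardy inequality for regular data\<close>

text \<open>
  The induction step of the next inequality. For a sequence ordered so that \<open>X + x \<le> c * x\<close> holds for
  the partial sum \<open>X\<close> before \<open>x\<close>, the potential \<open>Y\<^sup>2 / X\<close> (with \<open>Y\<close> the partial sum of \<open>b\<close>) contracts by
  \<open>1 - 1 / (2 * c)\<close> up to the new term \<open>b\<^sup>2 / x\<close>.
\<close>

lemma hardy_step:
  fixes c x b X Y :: real
  assumes c: "c \<ge> 1" and x: "x > 0" and X: "X > 0" and le: "X + x \<le> c * x"
  shows "2 * c * ((Y + b)\<^sup>2 / (X + x)) \<le> (2 * c - 1) * (Y\<^sup>2 / X) + 2 * c * (1 + 2 * c) * (b\<^sup>2 / x)"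
proof -
  \<comment> \<open>The weight \<open>1 / (2 * c)\<close> spends half of the contraction \<open>1 - 1 / c\<close> gained from \<open>X / (X + x)\<close>.\<close>
  have young: "(Y + b)\<^sup>2 \<le> (1 + 1 / (2 * c)) * Y\<^sup>2 + (1 + 2 * c) * b\<^sup>2"
  proof -
    have "0 \<le> (Y - 2 * c * b)\<^sup>2" by simp
    then have "4 * c * (Y * b) \<le> Y\<^sup>2 + 4 * c\<^sup>2 * b\<^sup>2" by (simp add: power2_eq_square algebra_simps)
    then have "2 * (Y * b) \<le> (Y\<^sup>2 + 4 * c\<^sup>2 * b\<^sup>2) / (2 * c)"
      using c by (simp add: pos_le_divide_eq algebra_simps)
    also have "\<dots> = 1 / (2 * c) * Y\<^sup>2 + 2 * c * b\<^sup>2"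
      using c by (simp add: field_simps power2_eq_square)
    finally show ?thesis by (simp add: power2_sum algebra_simps)
  qed
  have q: "X / (X + x) \<le> 1 - 1 / c"
  proof -
    have "1 / c \<le> x / (X + x)" using le x X c by (simp add: field_simps)
    moreover have "X / (X + x) = 1 - x / (X + x)" using X x by (simp add: field_simps)
    ultimately show ?thesis by simp
  qed
  have t1: "Y\<^sup>2 / (X + x) \<le> (1 - 1 / c) * (Y\<^sup>2 / X)"
  proof -
    have "Y\<^sup>2 / (X + x) = (X / (X + x)) * (Y\<^sup>2 / X)" using X by simp
    then show ?thesis using mult_right_mono[OF q, of "Y\<^sup>2 / X"] X by simp
  qed
  have t2: "b\<^sup>2 / (X + x) \<le> b\<^sup>2 / x" using X x by (intro divide_left_mono) auto
  have "(Y + b)\<^sup>2 / (X + x) \<le> ((1 + 1 / (2 * c)) * Y\<^sup>2 + (1 + 2 * c) * b\<^sup>2) / (X + x)"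
    by (rule divide_right_mono[OF young]) (use X x in simp)
  also have "\<dots> = (1 + 1 / (2 * c)) * (Y\<^sup>2 / (X + x)) + (1 + 2 * c) * (b\<^sup>2 / (X + x))"
    by (simp add: add_divide_distrib)
  also have "\<dots> \<le> (1 + 1 / (2 * c)) * ((1 - 1 / c) * (Y\<^sup>2 / X)) + (1 + 2 * c) * (b\<^sup>2 / x)"
    by (intro add_mono mult_left_mono t1 t2) (use c in auto)
  finally have "2 * c * ((Y + b)\<^sup>2 / (X + x))
      \<le> 2 * c * ((1 + 1 / (2 * c)) * ((1 - 1 / c) * (Y\<^sup>2 / X)) + (1 + 2 * c) * (b\<^sup>2 / x))"
    by (rule mult_left_mono) (use c in simp)
  also have "\<dots> = (2 * c * ((1 + 1 / (2 * c)) * (1 - 1 / c))) * (Y\<^sup>2 / X) + 2 * c * (1 + 2 * c) * (b\<^sup>2 / x)"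
  proof -
    have "2 * c * (p * (q * u) + s * v) = (2 * c * (p * q)) * u + 2 * c * s * v" for p q u s v
      by (simp add: algebra_simps)
    then show ?thesis .
  qed
  also have "2 * c * ((1 + 1 / (2 * c)) * (1 - 1 / c)) = 2 * c - 1 - 1 / c"
    using c by (simp add: field_simps)
  also have "(2 * c - 1 - 1 / c) * (Y\<^sup>2 / X) \<le> (2 * c - 1) * (Y\<^sup>2 / X)"
    by (rule mult_right_mono) (use c X in auto)
  finally show ?thesis by simp
qed

text \<open>
  If every partial sum of \<open>x\<close> is comparable to its last term, the partial sums grow geometrically, and
  summation is bounded on the weighted space. The injective function \<open>g\<close> orders the index set.
\<close>

lemma discrete_hardy_inequality:
  fixes g x b :: "'a \<Rightarrow> real"
  assumes J: "finite J" and inj: "inj_on g J" and x: "\<And>n. n \<in> J \<Longrightarrow> x n > 0" and c: "c \<ge> 1"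
    and le: "\<And>n. n \<in> J \<Longrightarrow> (\<Sum>k\<in>{k\<in>J. g k \<le> g n}. x k) \<le> c * x n"
  shows "(\<Sum>n\<in>J. (\<Sum>k\<in>{k\<in>J. g k \<le> g n}. b k)\<^sup>2 / x n) \<le> 2 * c\<^sup>2 * (1 + 2 * c) * (\<Sum>n\<in>J. (b n)\<^sup>2 / x n)"
proof -
  let ?B = "\<lambda>J n. \<Sum>k\<in>{k\<in>J. g k \<le> g n}. b k" and ?X = "\<lambda>J n. \<Sum>k\<in>{k\<in>J. g k \<le> g n}. x k"
  \<comment> \<open>The additional term is the potential of the whole set; it absorbs the next step.\<close>
  have main: "(\<Sum>n\<in>J. (?B J n)\<^sup>2 / ?X J n) + (2 * c - 1) * ((\<Sum>k\<in>J. b k)\<^sup>2 / (\<Sum>k\<in>J. x k))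
       \<le> 2 * c * (1 + 2 * c) * (\<Sum>n\<in>J. (b n)\<^sup>2 / x n)"
    using J inj x le
  proof (induction J rule: finite_ranking_induct[where f = g])
    case empty
    then show ?case by simp
  next
    case (insert m S)
    show ?case
    proof (cases "m \<in> S")
      case True
      then have "insert m S = S" by blast
      then show ?thesis using insert by simp
    next
      case False
      have lt: "g n < g m" if "n \<in> S" for n
        using insert.hyps(2)[OF that] insert.prems(1) that False
        by (metis inj_on_contraD insertI1 insertI2 less_eq_real_def)
      have old: "{k \<in> insert m S. g k \<le> g n} = {k \<in> S. g k \<le> g n}" if "n \<in> S" for n
        using lt[OF that] by auto
      have new: "{k \<in> insert m S. g k \<le> g m} = insert m S"
        using insert.hyps(2) by auto
      have IH: "(\<Sum>n\<in>S. (?B S n)\<^sup>2 / ?X S n) + (2 * c - 1) * ((\<Sum>k\<in>S. b k)\<^sup>2 / (\<Sum>k\<in>S. x k))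
         \<le> 2 * c * (1 + 2 * c) * (\<Sum>n\<in>S. (b n)\<^sup>2 / x n)"
      proof (rule insert.IH)
        show "inj_on g S" using insert.prems(1) by (rule inj_on_subset) auto
        show "x n > 0" if "n \<in> S" for n using insert.prems(2) that by auto
        show "?X S n \<le> c * x n" if "n \<in> S" for n
          using insert.prems(3)[of n] that unfolding old[OF that] by auto
      qed
      have xm: "x m > 0" using insert.prems(2) by auto
      have lem: "(\<Sum>k\<in>S. x k) + x m \<le> c * x m"
        using insert.prems(3)[of m] False insert.hyps(1) unfolding new by simp
      have step: "2 * c * (((\<Sum>k\<in>S. b k) + b m)\<^sup>2 / ((\<Sum>k\<in>S. x k) + x m))
          \<le> (2 * c - 1) * ((\<Sum>k\<in>S. b k)\<^sup>2 / (\<Sum>k\<in>S. x k)) + 2 * c * (1 + 2 * c) * ((b m)\<^sup>2 / x m)"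
      proof (cases "S = {}")
        case True
        have "1 * ((b m)\<^sup>2 / x m) \<le> (1 + 2 * c) * ((b m)\<^sup>2 / x m)"
          using c xm by (intro mult_right_mono) auto
        from mult_left_mono[OF this, of "2 * c"] show ?thesis using True c by simp
      next
        case False
        have "(\<Sum>k\<in>S. x k) > 0" using False insert.hyps(1) insert.prems(2) by (intro sum_pos) auto
        then show ?thesis by (rule hardy_step[OF c xm _ lem])
      qed
      have "(\<Sum>n\<in>S. (?B (insert m S) n)\<^sup>2 / ?X (insert m S) n) = (\<Sum>n\<in>S. (?B S n)\<^sup>2 / ?X S n)"
        by (intro sum.cong refl) (simp only: old)
      then have "(\<Sum>n\<in>insert m S. (?B (insert m S) n)\<^sup>2 / ?X (insert m S) n)
          = (\<Sum>n\<in>S. (?B S n)\<^sup>2 / ?X S n) + ((\<Sum>k\<in>S. b k) + b m)\<^sup>2 / ((\<Sum>k\<in>S. x k) + x m)"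
        unfolding sum.insert[OF insert.hyps(1) False] new by (simp add: add.commute)
      moreover have "(\<Sum>k\<in>insert m S. b k)\<^sup>2 / (\<Sum>k\<in>insert m S. x k)
          = ((\<Sum>k\<in>S. b k) + b m)\<^sup>2 / ((\<Sum>k\<in>S. x k) + x m)"
        using False insert.hyps(1) by (simp add: add.commute)
      moreover have "(\<Sum>n\<in>insert m S. (b n)\<^sup>2 / x n) = (\<Sum>n\<in>S. (b n)\<^sup>2 / x n) + (b m)\<^sup>2 / x m"
        using False insert.hyps(1) by (simp add: add.commute)
      moreover have "(A + D) + (2 * c - 1) * D \<le> K * (T + s)"
        if "A + (2 * c - 1) * B \<le> K * T" "2 * c * D \<le> (2 * c - 1) * B + K * s" for A B D K T s :: real
        using that by (simp add: algebra_simps)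
      ultimately show ?thesis using IH step by presburger
    qed
  qed
  have comp: "(?B J n)\<^sup>2 / x n \<le> c * ((?B J n)\<^sup>2 / ?X J n)" if n: "n \<in> J" for n
  proof -
    have "x n \<le> ?X J n" using n J x by (intro member_le_sum) (auto intro: less_imp_le)
    then have X: "?X J n > 0" using x[OF n] by linarith
    have "(?B J n)\<^sup>2 * ?X J n \<le> (?B J n)\<^sup>2 * (c * x n)"
      by (rule mult_left_mono[OF le[OF n]]) simp
    then show ?thesis using X x[OF n] by (simp add: field_simps)
  qed
  have "(\<Sum>n\<in>J. (?B J n)\<^sup>2 / x n) \<le> c * (\<Sum>n\<in>J. (?B J n)\<^sup>2 / ?X J n)"
    unfolding sum_distrib_left by (rule sum_mono) (rule comp)
  also have "\<dots> \<le> c * (2 * c * (1 + 2 * c) * (\<Sum>n\<in>J. (b n)\<^sup>2 / x n))"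
  proof (rule mult_left_mono)
    have "(2 * c - 1) * ((\<Sum>k\<in>J. b k)\<^sup>2 / (\<Sum>k\<in>J. x k)) \<ge> 0"
      using c x by (intro mult_nonneg_nonneg divide_nonneg_nonneg sum_nonneg) (auto intro: less_imp_le)
    then show "(\<Sum>n\<in>J. (?B J n)\<^sup>2 / ?X J n) \<le> 2 * c * (1 + 2 * c) * (\<Sum>n\<in>J. (b n)\<^sup>2 / x n)"
      using main by linarith
  qed (use c in simp)
  finally show ?thesis by (simp add: power2_eq_square algebra_simps)
qed

text \<open>
  Both \<open>s\<close> and \<open>- s\<close> may occur among the points \<open>t n\<close>. An injective ranking breaks such ties between
  equal moduli.
\<close>

lemma ex_injective_ranking:
  fixes f :: "'a \<Rightarrow> real"
  assumes "finite J"
  shows "\<exists>g :: 'a \<Rightarrow> real. inj_on g J \<and> (\<forall>x\<in>J. \<forall>y\<in>J. g x \<le> g y \<longrightarrow> f x \<le> f y)"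
  using assms
proof (induction J rule: finite_ranking_induct[where f = f])
  case empty
  then show ?case by simp
next
  case (insert m S)
  from insert.IH obtain g :: "'a \<Rightarrow> real"
    where g: "inj_on g S" "\<forall>x\<in>S. \<forall>y\<in>S. g x \<le> g y \<longrightarrow> f x \<le> f y" by (elim exE conjE)
  show ?case
  proof (cases "m \<in> S")
    case True
    then show ?thesis using g by (auto simp: insert_absorb)
  next
    case False
    define h where "h = g(m := 1 + (\<Sum>k\<in>S. \<bar>g k\<bar>))"
    have lt: "g k < h m" if "k \<in> S" for k
      using member_le_sum[of k S "\<lambda>k. \<bar>g k\<bar>"] that insert.hyps(1) by (simp add: h_def)
    have eq: "h k = g k" if "k \<in> S" for k using that False by (auto simp: h_def)
    have "inj_on h S" using g(1) eq by (simp cong: inj_on_cong)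
    then have "inj_on h (insert m S)"
      using lt eq False by (auto simp: inj_on_insert) (metis less_irrefl)
    moreover have "\<forall>x\<in>insert m S. \<forall>y\<in>insert m S. h x \<le> h y \<longrightarrow> f x \<le> f y"
      using g(2) lt eq insert.hyps(2) by (auto simp: not_le[symmetric])
    ultimately show ?thesis by blast
  qed
qed

text \<open>
  The ratio of the majorants of the \<open>k\<close>-th and the \<open>n\<close>-th divided zero at radius \<open>\<bar>t n\<bar>\<close>. The diagonal
  value is stated separately because the quotient would be \<open>0 / 0\<close> when \<open>t n = 0\<close>.
\<close>

definition overlap :: "(int \<Rightarrow> real) \<Rightarrow> int \<Rightarrow> int \<Rightarrow> real" where
  "overlap t n k = (if k = n then 1 else 2 * \<bar>t n\<bar> / (\<bar>t n\<bar> + \<bar>t k\<bar>))"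

lemma overlap_nonneg: "overlap t n k \<ge> 0"
  by (simp add: overlap_def)

lemma overlap_le_2: "overlap t n k \<le> 2"
proof -
  have "2 * \<bar>t n\<bar> / (\<bar>t n\<bar> + \<bar>t k\<bar>) \<le> 2 * (\<bar>t n\<bar> + \<bar>t k\<bar>) / (\<bar>t n\<bar> + \<bar>t k\<bar>)"
    by (intro divide_right_mono) auto
  also have "\<dots> \<le> 2"
  proof -
    have "2 * s / s \<le> 2" for s :: real by (cases "s = 0") auto
    then show ?thesis .
  qed
  finally show ?thesis by (simp add: overlap_def)
qed

text \<open>
  Up to a factor \<open>2\<close> the overlap is at most \<open>1\<close> for indices \<open>k\<close> ranked below \<open>n\<close> and \<open>\<bar>t n\<bar> / \<bar>t k\<bar>\<close> for those
  ranked above. The two halves are Hardy inequalities with weights \<open>\<nu> k\<close> in increasing order and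
  \<open>\<nu> k / (t k)\<^sup>2\<close> in decreasing order. In the second one the terms with \<open>\<bar>t k\<bar> = \<bar>t n\<bar>\<close>, which the tail
  omits, are controlled by the partial sum; this doubles the constant.
\<close>

lemma regular_data_l2_bound:
  fixes t \<nu> b :: "int \<Rightarrow> real"
  assumes J: "finite J" and inj: "inj_on t J" and pos: "\<And>n. n \<in> J \<Longrightarrow> \<nu> n > 0" and c: "c \<ge> 1"
    and A: "\<And>n. n \<in> J \<Longrightarrow> (\<Sum>k\<in>{k\<in>J. \<bar>t k\<bar> \<le> \<bar>t n\<bar>}. \<nu> k) \<le> c * \<nu> n"
    and B: "\<And>n. n \<in> J \<Longrightarrow> (t n)\<^sup>2 * (\<Sum>k\<in>{k\<in>J. \<bar>t k\<bar> > \<bar>t n\<bar>}. \<nu> k / (t k)\<^sup>2) \<le> c * \<nu> n"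
    and b: "\<And>k. k \<in> J \<Longrightarrow> b k \<ge> 0"
  shows "(\<Sum>n\<in>J. (\<Sum>k\<in>J. b k * overlap t n k)\<^sup>2 / \<nu> n) \<le> 368 * c ^ 3 * (\<Sum>k\<in>J. (b k)\<^sup>2 / \<nu> k)"
proof -
  from ex_injective_ranking[OF J, of "\<lambda>k. \<bar>t k\<bar>"] obtain g :: "int \<Rightarrow> real"
    where g_inj: "inj_on g J" and g_rank: "\<forall>x\<in>J. \<forall>y\<in>J. g x \<le> g y \<longrightarrow> \<bar>t x\<bar> \<le> \<bar>t y\<bar>"
    by (elim exE conjE)
  have g: "inj_on g J" "\<And>x y. x \<in> J \<Longrightarrow> y \<in> J \<Longrightarrow> g x \<le> g y \<Longrightarrow> \<bar>t x\<bar> \<le> \<bar>t y\<bar>"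
    using g_inj g_rank by auto
  define J' where "J' = {k\<in>J. t k \<noteq> 0}"
  have J': "finite J'" "J' \<subseteq> J" "\<And>k. k \<in> J' \<Longrightarrow> t k \<noteq> 0" using J by (auto simp: J'_def)
  define P where "P = (\<lambda>n. \<Sum>k\<in>{k\<in>J. g k \<le> g n}. b k)"
  define Q where "Q = (\<lambda>n. \<Sum>k\<in>{k\<in>J'. - g k \<le> - g n}. b k / \<bar>t k\<bar>)"
  let ?R = "\<Sum>k\<in>J. (b k)\<^sup>2 / \<nu> k"
  have R0: "?R \<ge> 0" using pos by (intro sum_nonneg divide_nonneg_pos) auto
  have 1: "(\<Sum>n\<in>J. (P n)\<^sup>2 / \<nu> n) \<le> 2 * c\<^sup>2 * (1 + 2 * c) * ?R"
    unfolding P_def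
  proof (rule discrete_hardy_inequality[OF J g(1) pos c])
    fix n assume n: "n \<in> J"
    have "(\<Sum>k\<in>{k\<in>J. g k \<le> g n}. \<nu> k) \<le> (\<Sum>k\<in>{k\<in>J. \<bar>t k\<bar> \<le> \<bar>t n\<bar>}. \<nu> k)"
      by (rule sum_mono2) (use J g(2) n pos in \<open>auto intro: less_imp_le\<close>)
    also note A[OF n]
    finally show "(\<Sum>k\<in>{k\<in>J. g k \<le> g n}. \<nu> k) \<le> c * \<nu> n" .
  qed
  have 2: "(\<Sum>n\<in>J'. (Q n)\<^sup>2 / (\<nu> n / (t n)\<^sup>2))
      \<le> 2 * (2 * c)\<^sup>2 * (1 + 2 * (2 * c)) * (\<Sum>k\<in>J'. (b k / \<bar>t k\<bar>)\<^sup>2 / (\<nu> k / (t k)\<^sup>2))"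
    unfolding Q_def
  proof (rule discrete_hardy_inequality[OF J'(1)])
    show "inj_on (\<lambda>k. - g k) J'" using inj_on_subset[OF g(1) J'(2)] by (auto simp: inj_on_def)
    show "\<nu> n / (t n)\<^sup>2 > 0" if "n \<in> J'" for n using pos[of n] J' that by auto
    show "2 * c \<ge> 1" using c by simp
    fix n assume n': "n \<in> J'"
    then have n: "n \<in> J" "t n \<noteq> 0" using J' by auto
    let ?E = "{k\<in>J. \<bar>t k\<bar> = \<bar>t n\<bar>}" and ?G = "{k\<in>J. \<bar>t k\<bar> > \<bar>t n\<bar>}"
    have "(\<Sum>k\<in>{k\<in>J'. - g k \<le> - g n}. \<nu> k / (t k)\<^sup>2) \<le> (\<Sum>k\<in>?E \<union> ?G. \<nu> k / (t k)\<^sup>2)"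
    proof (rule sum_mono2)
      show "{k\<in>J'. - g k \<le> - g n} \<subseteq> ?E \<union> ?G" using g(2)[OF n(1)] J'(2) by force
    qed (use J pos in \<open>auto intro!: divide_nonneg_nonneg intro: less_imp_le\<close>)
    also have "\<dots> = (\<Sum>k\<in>?E. \<nu> k / (t k)\<^sup>2) + (\<Sum>k\<in>?G. \<nu> k / (t k)\<^sup>2)"
      using J by (intro sum.union_disjoint) auto
    also have "(\<Sum>k\<in>?E. \<nu> k / (t k)\<^sup>2) = (\<Sum>k\<in>?E. \<nu> k) / (t n)\<^sup>2"
      unfolding sum_divide_distrib by (rule sum.cong) (auto, metis power2_abs)
    also have "(\<Sum>k\<in>?E. \<nu> k) \<le> (\<Sum>k\<in>{k\<in>J. \<bar>t k\<bar> \<le> \<bar>t n\<bar>}. \<nu> k)"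
      using J pos by (intro sum_mono2) (auto intro: less_imp_le)
    also have "\<dots> \<le> c * \<nu> n" by (rule A[OF n(1)])
    also have "(\<Sum>k\<in>?G. \<nu> k / (t k)\<^sup>2) \<le> c * \<nu> n / (t n)\<^sup>2"
      using B[OF n(1)] n(2) by (simp add: pos_le_divide_eq mult.commute)
    finally show "(\<Sum>k\<in>{k\<in>J'. - g k \<le> - g n}. \<nu> k / (t k)\<^sup>2) \<le> 2 * c * (\<nu> n / (t n)\<^sup>2)"
      by (simp add: divide_right_mono)
  qed
  have 3: "(\<Sum>k\<in>J'. (b k / \<bar>t k\<bar>)\<^sup>2 / (\<nu> k / (t k)\<^sup>2)) \<le> ?R"
  proof -
    have "(\<Sum>k\<in>J'. (b k / \<bar>t k\<bar>)\<^sup>2 / (\<nu> k / (t k)\<^sup>2)) = (\<Sum>k\<in>J'. (b k)\<^sup>2 / \<nu> k)"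
      using J'(3) by (intro sum.cong) (auto simp: power_divide)
    also have "\<dots> \<le> ?R" using J J' pos by (intro sum_mono2) (auto intro!: divide_nonneg_nonneg intro: less_imp_le)
    finally show ?thesis .
  qed
  have row: "(\<Sum>k\<in>J. b k * overlap t n k) \<le> 2 * P n + 2 * \<bar>t n\<bar> * Q n" if n: "n \<in> J" for n
  proof -
    let ?D = "{k\<in>J. g k \<le> g n}" and ?U = "{k\<in>J. g n < g k}"
    have split: "J = ?D \<union> ?U" by auto
    have U': "?U \<subseteq> {k\<in>J'. - g k \<le> - g n}"
    proof
      fix k assume k: "k \<in> ?U"
      then have "\<bar>t n\<bar> \<le> \<bar>t k\<bar>" "k \<noteq> n" using g(2)[OF n, of k] by auto
      then have "t k \<noteq> 0" using inj_onD[OF inj, of k n] k n by auto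
      then show "k \<in> {k\<in>J'. - g k \<le> - g n}" using k by (auto simp: J'_def)
    qed
    have "(\<Sum>k\<in>J. b k * overlap t n k) = (\<Sum>k\<in>?D. b k * overlap t n k) + (\<Sum>k\<in>?U. b k * overlap t n k)"
      using J by (subst split, intro sum.union_disjoint) auto
    also have "(\<Sum>k\<in>?D. b k * overlap t n k) \<le> (\<Sum>k\<in>?D. b k * 2)"
    proof (intro sum_mono mult_left_mono)
      show "overlap t n k \<le> 2" for k by (rule overlap_le_2)
    qed (use b in auto)
    also have "\<dots> = 2 * P n" by (simp add: P_def sum_distrib_left mult.commute)
    also have "(\<Sum>k\<in>?U. b k * overlap t n k) \<le> (\<Sum>k\<in>?U. 2 * \<bar>t n\<bar> * (b k / \<bar>t k\<bar>))"
    proof (rule sum_mono)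
      fix k assume k: "k \<in> ?U"
      then have tk: "t k \<noteq> 0" "k \<noteq> n" using U' J'(3) by auto
      have "overlap t n k \<le> 2 * \<bar>t n\<bar> / \<bar>t k\<bar>"
        using tk by (auto simp: overlap_def intro!: divide_left_mono)
      then have "b k * overlap t n k \<le> b k * (2 * \<bar>t n\<bar> / \<bar>t k\<bar>)"
        using b k by (intro mult_left_mono) auto
      then show "b k * overlap t n k \<le> 2 * \<bar>t n\<bar> * (b k / \<bar>t k\<bar>)" by (simp add: field_simps)
    qed
    also have "\<dots> \<le> 2 * \<bar>t n\<bar> * Q n"
      unfolding Q_def sum_distrib_left[symmetric]
      using U' J' b by (intro mult_left_mono sum_mono2) auto
    finally show ?thesis by simp
  qed
  have "(\<Sum>n\<in>J. (\<Sum>k\<in>J. b k * overlap t n k)\<^sup>2 / \<nu> n) \<le> (\<Sum>n\<in>J. 8 * ((P n)\<^sup>2 / \<nu> n) + 8 * ((\<bar>t n\<bar> * Q n)\<^sup>2 / \<nu> n))"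
  proof (rule sum_mono)
    fix n assume n: "n \<in> J"
    have "(\<Sum>k\<in>J. b k * overlap t n k)\<^sup>2 \<le> (2 * P n + 2 * (\<bar>t n\<bar> * Q n))\<^sup>2"
      using row[OF n] b by (intro power_mono sum_nonneg mult_nonneg_nonneg overlap_nonneg) auto
    also have "\<dots> \<le> 8 * (P n)\<^sup>2 + 8 * (\<bar>t n\<bar> * Q n)\<^sup>2"
    proof -
      have "(2 * p + 2 * q)\<^sup>2 \<le> 8 * p\<^sup>2 + 8 * q\<^sup>2" for p q :: real
        using sum_squares_bound[of p q] by (simp add: power2_sum power_mult_distrib)
      then show ?thesis .
    qed
    finally have "(\<Sum>k\<in>J. b k * overlap t n k)\<^sup>2 / \<nu> n \<le> (8 * (P n)\<^sup>2 + 8 * (\<bar>t n\<bar> * Q n)\<^sup>2) / \<nu> n"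
      using pos[OF n] by (intro divide_right_mono) auto
    then show "(\<Sum>k\<in>J. b k * overlap t n k)\<^sup>2 / \<nu> n \<le> 8 * ((P n)\<^sup>2 / \<nu> n) + 8 * ((\<bar>t n\<bar> * Q n)\<^sup>2 / \<nu> n)"
      by (simp add: add_divide_distrib)
  qed
  also have "\<dots> = 8 * (\<Sum>n\<in>J. (P n)\<^sup>2 / \<nu> n) + 8 * (\<Sum>n\<in>J. (\<bar>t n\<bar> * Q n)\<^sup>2 / \<nu> n)"
    by (simp add: sum.distrib sum_distrib_left)
  also have "(\<Sum>n\<in>J. (\<bar>t n\<bar> * Q n)\<^sup>2 / \<nu> n) = (\<Sum>n\<in>J'. (Q n)\<^sup>2 / (\<nu> n / (t n)\<^sup>2))"
  proof -
    have "(\<Sum>n\<in>J. (\<bar>t n\<bar> * Q n)\<^sup>2 / \<nu> n) = (\<Sum>n\<in>J'. (\<bar>t n\<bar> * Q n)\<^sup>2 / \<nu> n)"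
      by (rule sum.mono_neutral_right[OF J J'(2)]) (auto simp: J'_def)
    also have "\<dots> = (\<Sum>n\<in>J'. (Q n)\<^sup>2 / (\<nu> n / (t n)\<^sup>2))"
      by (intro sum.cong refl) (simp add: power_mult_distrib mult.commute)
    finally show ?thesis .
  qed
  also have "8 * (\<Sum>n\<in>J. (P n)\<^sup>2 / \<nu> n) + 8 * \<dots>
     \<le> 8 * (2 * c\<^sup>2 * (1 + 2 * c) * ?R) + 8 * (2 * (2 * c)\<^sup>2 * (1 + 2 * (2 * c)) * ?R)"
  proof (intro add_mono mult_left_mono 1)
    have "2 * (2 * c)\<^sup>2 * (1 + 2 * (2 * c)) * (\<Sum>k\<in>J'. (b k / \<bar>t k\<bar>)\<^sup>2 / (\<nu> k / (t k)\<^sup>2))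
       \<le> 2 * (2 * c)\<^sup>2 * (1 + 2 * (2 * c)) * ?R"
      by (rule mult_left_mono[OF 3]) (use c in auto)
    with 2 show "(\<Sum>n\<in>J'. (Q n)\<^sup>2 / (\<nu> n / (t n)\<^sup>2)) \<le> 2 * (2 * c)\<^sup>2 * (1 + 2 * (2 * c)) * ?R"
      by linarith
  qed auto
  also have "\<dots> = (80 * c\<^sup>2 + 288 * c ^ 3) * ?R"
    by (simp add: power2_eq_square power3_eq_cube algebra_simps)
  also have "\<dots> \<le> (368 * c ^ 3) * ?R"
  proof (rule mult_right_mono[OF _ R0])
    have "c\<^sup>2 * 1 \<le> c\<^sup>2 * c" by (rule mult_left_mono) (use c in auto)
    then show "80 * c\<^sup>2 + 288 * c ^ 3 \<le> 368 * c ^ 3" by (simp add: power2_eq_square power3_eq_cube)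
  qed
  finally show ?thesis .
qed

section \<open>Lacunary sequences\<close>

lemma sum_power_abs_diff_le:
  fixes q :: real and J :: "int set"
  assumes J: "finite J" and q: "0 < q" "q < 1"
  shows "(\<Sum>j\<in>J. q ^ nat \<bar>j - n\<bar>) \<le> 2 / (1 - q)"
proof -
  have half: "(\<Sum>j\<in>S. q ^ nat \<bar>j - n\<bar>) \<le> 1 / (1 - q)"
    if S: "finite S" and inj: "inj_on (\<lambda>j. nat \<bar>j - n\<bar>) S" for S
  proof -
    have "(\<Sum>j\<in>S. q ^ nat \<bar>j - n\<bar>) = (\<Sum>m\<in>(\<lambda>j. nat \<bar>j - n\<bar>) ` S. q ^ m)"
      by (simp add: sum.reindex[OF inj])
    also have "\<dots> \<le> (\<Sum>m. q ^ m)"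
      by (rule sum_le_suminf) (use S q in \<open>auto intro: summable_geometric\<close>)
    also have "\<dots> = 1 / (1 - q)" using q by (simp add: suminf_geometric)
    finally show ?thesis .
  qed
  have "(\<Sum>j\<in>J. q ^ nat \<bar>j - n\<bar>)
     = (\<Sum>j\<in>{j\<in>J. j \<ge> n}. q ^ nat \<bar>j - n\<bar>) + (\<Sum>j\<in>{j\<in>J. j < n}. q ^ nat \<bar>j - n\<bar>)"
    by (subst sum.union_disjoint[symmetric]) (use J in \<open>auto intro: sum.cong\<close>)
  also have "\<dots> \<le> 1 / (1 - q) + 1 / (1 - q)"
    by (intro add_mono half) (use J in \<open>auto simp: inj_on_def\<close>)
  finally show ?thesis by (simp add: add_divide_distrib[symmetric])
qed

locale lacunary_sequence =
  fixes I :: "int set" and t :: "int \<Rightarrow> real"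
  assumes consecutive: "consecutive I"
    and strict_mono: "strict_mono_on I t"
    and not_islimpt: "\<And>x. \<not> x islimpt (t ` I)"
    and lacunary: "lacunary I t"
begin

lemma t_inj: "inj_on t I"
  using strict_mono by (rule strict_mono_on_imp_inj_on)

lemma t_eq_iff: "i \<in> I \<Longrightarrow> j \<in> I \<Longrightarrow> t i = t j \<longleftrightarrow> i = j"
  using t_inj by (auto simp: inj_on_def)

lemma finite_abs_le: "finite {k\<in>I. \<bar>t k\<bar> \<le> R}"
proof (rule finite_imageD)
  have "finite ({-R..R} \<inter> t ` I)"
    by (rule finite_not_islimpt_in_compact) (use not_islimpt in auto)
  then show "finite (t ` {k\<in>I. \<bar>t k\<bar> \<le> R})" by (rule finite_subset[rotated]) auto
  show "inj_on t {k\<in>I. \<bar>t k\<bar> \<le> R}" by (rule inj_on_subset[OF t_inj]) auto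
qed

text \<open>
  On the positive side the gap condition says that the sequence grows by the factor \<open>1 + \<kappa>\<close> at each
  step. On the negative side moduli decrease by the factor \<open>1 - \<kappa>\<close>, which is at most \<open>1 / (1 + \<kappa>)\<close>.
\<close>

lemma same_sign_geometric:
  obtains q where "0 < q" "q < 1"
    "\<And>i j. i \<in> I \<Longrightarrow> j \<in> I \<Longrightarrow> t i * t j > 0 \<Longrightarrow>
       min \<bar>t i\<bar> \<bar>t j\<bar> \<le> q ^ nat \<bar>j - i\<bar> * max \<bar>t i\<bar> \<bar>t j\<bar>"
proof -
  obtain \<kappa> where \<kappa>: "\<kappa> > 0" and gap: "\<And>n. n \<in> I \<Longrightarrow> n + 1 \<in> I \<Longrightarrow> t (n + 1) - t n \<ge> \<kappa> * \<bar>t n\<bar>"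
    using lacunary by (auto simp: lacunary_def)
  define q where "q = 1 / (1 + \<kappa>)"
  have q: "0 < q" "q < 1" using \<kappa> by (auto simp: q_def)
  have pos: "t i \<le> q ^ m * t (i + int m)" if "i \<in> I" "i + int m \<in> I" "t i > 0" for i m
    using that(2)
  proof (induction m)
    case 0
    then show ?case by simp
  next
    case (Suc m)
    have mem: "i + int m \<in> I" using consecutive \<open>i \<in> I\<close> Suc.prems
      unfolding consecutive_def by fastforce
    have ge: "t i \<le> t (i + int m)"
      using strict_mono \<open>i \<in> I\<close> mem by (cases "m = 0") (auto intro: less_imp_le dest: strict_mono_onD)
    have "(1 + \<kappa>) * t (i + int m) \<le> t (i + int m + 1)"
      using gap[of "i + int m"] mem Suc.prems ge \<open>t i > 0\<close> by (simp add: algebra_simps)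
    then have "t (i + int m) \<le> q * t (i + int (Suc m))"
      using \<kappa> by (simp add: q_def field_simps add.assoc)
    then have "q ^ m * t (i + int m) \<le> q ^ m * (q * t (i + int (Suc m)))"
      by (rule mult_left_mono) (use q in simp)
    then show ?case using Suc.IH[OF mem] by (simp add: mult_ac)
  qed
  have neg: "\<bar>t j\<bar> \<le> q ^ m * \<bar>t (j - int m)\<bar>" if "j \<in> I" "j - int m \<in> I" "t j < 0" for j m
    using that(2)
  proof (induction m)
    case 0
    then show ?case by simp
  next
    case (Suc m)
    have mem: "j - int m \<in> I" using consecutive \<open>j \<in> I\<close> Suc.prems
      unfolding consecutive_def by fastforce
    have le: "t (j - int m) \<le> t j"
      using strict_mono \<open>j \<in> I\<close> mem by (cases "m = 0") (auto intro: less_imp_le dest: strict_mono_onD)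
    define s where "s = t (j - int (Suc m))"
    have "t (j - int m) - s \<ge> \<kappa> * \<bar>s\<bar>"
      using gap[of "j - int (Suc m)"] mem Suc.prems by (simp add: s_def)
    moreover have "s < t (j - int m)"
      unfolding s_def by (rule strict_mono_onD[OF strict_mono Suc.prems mem]) simp
    ultimately have "(1 + \<kappa>) * \<bar>t (j - int m)\<bar> \<le> \<bar>s\<bar>"
    proof -
      assume a: "\<kappa> * \<bar>s\<bar> \<le> t (j - int m) - s" and "s < t (j - int m)"
      then have neg: "t (j - int m) < 0" "s < 0" using le \<open>t j < 0\<close> by auto
      have "\<kappa> * \<bar>t (j - int m)\<bar> \<le> \<kappa> * \<bar>s\<bar>"
        using neg \<open>s < t (j - int m)\<close> \<kappa> by (intro mult_left_mono) auto
      then show ?thesis using a neg by (simp add: algebra_simps)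
    qed
    then have "\<bar>t (j - int m)\<bar> \<le> q * \<bar>s\<bar>"
      using \<kappa> by (simp add: q_def field_simps)
    then have "q ^ m * \<bar>t (j - int m)\<bar> \<le> q ^ m * (q * \<bar>s\<bar>)"
      by (rule mult_left_mono) (use q in simp)
    then show ?case using Suc.IH[OF mem] by (simp add: s_def mult_ac)
  qed
  have ordered: "min \<bar>t i\<bar> \<bar>t j\<bar> \<le> q ^ nat \<bar>j - i\<bar> * max \<bar>t i\<bar> \<bar>t j\<bar>"
    if ij: "i \<in> I" "j \<in> I" "t i * t j > 0" "i \<le> j" for i j
  proof -
    define m where "m = nat (j - i)"
    have m: "j = i + int m" "nat \<bar>j - i\<bar> = m" using ij by (auto simp: m_def)
    have le: "t i \<le> t j"
      using strict_mono ij by (cases "i = j") (auto intro: less_imp_le dest: strict_mono_onD)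
    consider "t i > 0" "t j > 0" | "t i < 0" "t j < 0"
      using ij(3) by (auto simp: zero_less_mult_iff)
    then show ?thesis
    proof cases
      case 1
      then have "min \<bar>t i\<bar> \<bar>t j\<bar> = \<bar>t i\<bar>" "max \<bar>t i\<bar> \<bar>t j\<bar> = \<bar>t j\<bar>" using le by auto
      then show ?thesis using pos[of i m] ij m 1 by simp
    next
      case 2
      then have "min \<bar>t i\<bar> \<bar>t j\<bar> = \<bar>t j\<bar>" "max \<bar>t i\<bar> \<bar>t j\<bar> = \<bar>t i\<bar>" using le by auto
      then show ?thesis using neg[of j m] ij m 2 by simp
    qed
  qed
  show ?thesis
  proof (rule that[OF q])
    fix i j assume "i \<in> I" "j \<in> I" "t i * t j > 0"
    then show "min \<bar>t i\<bar> \<bar>t j\<bar> \<le> q ^ nat \<bar>j - i\<bar> * max \<bar>t i\<bar> \<bar>t j\<bar>"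
      using ordered[of i j] ordered[of j i]
      by (cases "i \<le> j") (auto simp: min.commute max.commute mult.commute abs_minus_commute)
  qed
qed

text \<open>
  The factors on both sides agree when \<open>t n * t j \<le> 0\<close>. For equal signs the quotient of the factors is
  \<open>1 + 2 * m / (M - m)\<close>, where \<open>m / M\<close> decays geometrically in \<open>\<bar>j - n\<bar>\<close>, so that the product of the
  quotients is at most the exponential of a geometric series.
\<close>

lemma separation_product_bounded:
  obtains C where "C > 0"
    "\<And>n J. n \<in> I \<Longrightarrow> finite J \<Longrightarrow> J \<subseteq> I - {n} \<Longrightarrow>
       (\<Prod>j\<in>J. \<bar>t n\<bar> + \<bar>t j\<bar>) \<le> C * (\<Prod>j\<in>J. \<bar>t n - t j\<bar>)"
proof -
  obtain q where q: "0 < q" "q < 1" and geo: "\<And>i j. i \<in> I \<Longrightarrow> j \<in> I \<Longrightarrow> t i * t j > 0 \<Longrightarrow>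
       min \<bar>t i\<bar> \<bar>t j\<bar> \<le> q ^ nat \<bar>j - i\<bar> * max \<bar>t i\<bar> \<bar>t j\<bar>"
    using same_sign_geometric by blast
  define C where "C = exp (2 / (1 - q) * (2 / (1 - q)))"
  have factor: "\<bar>t n\<bar> + \<bar>t j\<bar> \<le> exp (2 / (1 - q) * q ^ nat \<bar>j - n\<bar>) * \<bar>t n - t j\<bar>"
    if nj: "n \<in> I" "j \<in> I" "j \<noteq> n" for n j
  proof (cases "t n * t j > 0")
    case False
    then have "\<bar>t n - t j\<bar> = \<bar>t n\<bar> + \<bar>t j\<bar>" by (auto simp: zero_less_mult_iff abs_if split: if_splits)
    moreover have "exp (2 / (1 - q) * q ^ nat \<bar>j - n\<bar>) \<ge> 1" using q by simp
    ultimately show ?thesis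
      using mult_right_mono[of 1 "exp (2 / (1 - q) * q ^ nat \<bar>j - n\<bar>)" "\<bar>t n\<bar> + \<bar>t j\<bar>"] by simp
  next
    case True
    define M where "M = max \<bar>t n\<bar> \<bar>t j\<bar>"
    define m where "m = min \<bar>t n\<bar> \<bar>t j\<bar>"
    define Q where "Q = q ^ nat \<bar>j - n\<bar>"
    have M: "M > 0" "\<bar>t n\<bar> + \<bar>t j\<bar> = M + m" "\<bar>t n - t j\<bar> = M - m"
      using True by (auto simp: M_def m_def zero_less_mult_iff)
    have mQ: "m \<le> Q * M" using geo[OF nj(1,2) True] by (simp add: m_def M_def Q_def)
    have "Q \<le> q ^ 1" unfolding Q_def using q nj by (intro power_decreasing) auto
    then have Q: "Q \<le> q" "Q \<ge> 0" using q by (auto simp: Q_def)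
    have "m \<le> q * M" using mQ Q M by (meson mult_right_mono less_imp_le order_trans)
    then have gap: "(1 - q) * M \<le> M - m" by (simp add: algebra_simps)
    have "2 * m \<le> 2 * (Q * M)" using mQ by simp
    also have "\<dots> = 2 / (1 - q) * Q * ((1 - q) * M)" using q by simp
    also have "\<dots> \<le> 2 / (1 - q) * Q * (M - m)" using gap q Q by (intro mult_left_mono) auto
    finally have "M + m \<le> (1 + 2 / (1 - q) * Q) * (M - m)" by (simp add: algebra_simps)
    also have "\<dots> \<le> exp (2 / (1 - q) * Q) * (M - m)"
      unfolding M(3)[symmetric] by (intro mult_right_mono exp_ge_add_one_self) auto
    finally show ?thesis unfolding M(2,3) Q_def .
  qed
  have "(\<Prod>j\<in>J. \<bar>t n\<bar> + \<bar>t j\<bar>) \<le> C * (\<Prod>j\<in>J. \<bar>t n - t j\<bar>)"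
    if n: "n \<in> I" and J: "finite J" "J \<subseteq> I - {n}" for n J
  proof -
    have "(\<Prod>j\<in>J. \<bar>t n\<bar> + \<bar>t j\<bar>) \<le> (\<Prod>j\<in>J. exp (2 / (1 - q) * q ^ nat \<bar>j - n\<bar>) * \<bar>t n - t j\<bar>)"
      using n J(2) factor by (intro prod_mono) auto
    also have "\<dots> = exp (2 / (1 - q) * (\<Sum>j\<in>J. q ^ nat \<bar>j - n\<bar>)) * (\<Prod>j\<in>J. \<bar>t n - t j\<bar>)"
      using J(1) by (simp add: prod.distrib exp_sum sum_distrib_left)
    also have "\<dots> \<le> C * (\<Prod>j\<in>J. \<bar>t n - t j\<bar>)"
    proof (intro mult_right_mono prod_nonneg ballI abs_ge_zero)
      have "2 / (1 - q) * (\<Sum>j\<in>J. q ^ nat \<bar>j - n\<bar>) \<le> 2 / (1 - q) * (2 / (1 - q))"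
        by (intro mult_left_mono sum_power_abs_diff_le J q) (use q in simp)
      then show "exp (2 / (1 - q) * (\<Sum>j\<in>J. q ^ nat \<bar>j - n\<bar>)) \<le> C"
        by (simp only: C_def exp_le_cancel_iff)
    qed
    finally show ?thesis .
  qed
  then show ?thesis by (intro that[of C]) (auto simp: C_def)
qed

lemma summable_inverse_abs: "(\<lambda>j. 1 / \<bar>t j\<bar>) summable_on I"
proof -
  obtain q where q: "0 < q" "q < 1" and geo: "\<And>i j. i \<in> I \<Longrightarrow> j \<in> I \<Longrightarrow> t i * t j > 0 \<Longrightarrow>
       min \<bar>t i\<bar> \<bar>t j\<bar> \<le> q ^ nat \<bar>j - i\<bar> * max \<bar>t i\<bar> \<bar>t j\<bar>"
    using same_sign_geometric by blast
  have part: "(\<lambda>j. 1 / \<bar>t j\<bar>) summable_on S"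
    if S: "S \<subseteq> I" and sign: "\<And>i j. i \<in> S \<Longrightarrow> j \<in> S \<Longrightarrow> t i * t j > 0" for S
  proof (cases "S = {}")
    case False
    then obtain n where n: "n \<in> S" by blast
    then have tn: "\<bar>t n\<bar> > 0" using sign[of n n] by auto
    let ?F = "{k\<in>S. \<bar>t k\<bar> \<le> \<bar>t n\<bar>}" and ?G = "{k\<in>S. \<bar>t k\<bar> > \<bar>t n\<bar>}"
    have "finite ?F" by (rule finite_subset[OF _ finite_abs_le[of "\<bar>t n\<bar>"]]) (use S in auto)
    then have 1: "(\<lambda>j. 1 / \<bar>t j\<bar>) summable_on ?F" by (rule summable_on_finite)
    have 2: "(\<lambda>j. 1 / \<bar>t j\<bar>) summable_on ?G"
    proof (rule nonneg_bdd_above_summable_on)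
      show "bdd_above (sum (\<lambda>j. 1 / \<bar>t j\<bar>) ` {F. F \<subseteq> ?G \<and> finite F})"
      proof (rule bdd_aboveI2)
        fix F assume F: "F \<in> {F. F \<subseteq> ?G \<and> finite F}"
        have "(\<Sum>j\<in>F. 1 / \<bar>t j\<bar>) \<le> (\<Sum>j\<in>F. q ^ nat \<bar>j - n\<bar> / \<bar>t n\<bar>)"
        proof (rule sum_mono)
          fix j assume "j \<in> F"
          then have j: "j \<in> S" "\<bar>t j\<bar> > \<bar>t n\<bar>" using F by auto
          have "min \<bar>t n\<bar> \<bar>t j\<bar> \<le> q ^ nat \<bar>j - n\<bar> * max \<bar>t n\<bar> \<bar>t j\<bar>"
            by (rule geo) (use S j n sign in auto)
          then have "\<bar>t n\<bar> \<le> q ^ nat \<bar>j - n\<bar> * \<bar>t j\<bar>" using j by simp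
          then show "1 / \<bar>t j\<bar> \<le> q ^ nat \<bar>j - n\<bar> / \<bar>t n\<bar>"
            using tn j by (simp add: divide_le_eq pos_le_divide_eq mult.commute)
        qed
        also have "\<dots> = (\<Sum>j\<in>F. q ^ nat \<bar>j - n\<bar>) / \<bar>t n\<bar>" by (simp add: sum_divide_distrib)
        also have "\<dots> \<le> (2 / (1 - q)) / \<bar>t n\<bar>"
          by (intro divide_right_mono sum_power_abs_diff_le) (use F q in auto)
        finally show "(\<Sum>j\<in>F. 1 / \<bar>t j\<bar>) \<le> (2 / (1 - q)) / \<bar>t n\<bar>" .
      qed
    qed auto
    have "S = ?F \<union> ?G" by auto
    then show ?thesis using summable_on_Un_disjoint[OF 1 2] by fastforce
  qed simp
  let ?P = "{j\<in>I. t j > 0}" and ?N = "{j\<in>I. t j < 0}" and ?Z = "{j\<in>I. t j = 0}"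
  have "finite ?Z" by (rule finite_subset[OF _ finite_abs_le[of 0]]) auto
  then have "(\<lambda>j. 1 / \<bar>t j\<bar>) summable_on ?Z" by (rule summable_on_finite)
  moreover have "(\<lambda>j. 1 / \<bar>t j\<bar>) summable_on ?P" by (rule part) auto
  moreover have "(\<lambda>j. 1 / \<bar>t j\<bar>) summable_on ?N" by (rule part) (auto simp: mult_neg_neg)
  ultimately have "(\<lambda>j. 1 / \<bar>t j\<bar>) summable_on (?P \<union> ?N \<union> ?Z)"
    by (intro summable_on_Un_disjoint) auto
  moreover have "?P \<union> ?N \<union> ?Z = I" by auto
  ultimately show ?thesis by simp
qed

end

section \<open>Products of linear factors\<close>

text \<open>
  Infinite products of factors \<open>a j + c j * z\<close> over the integers, enumerated by \<open>int_decode\<close>. Indices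
  outside a given index set carry the trivial factor with \<open>a j = 1\<close> and \<open>c j = 0\<close>, so finite, one-sided
  and two-sided index sets are treated alike.
\<close>

definition linear_factors :: "(int \<Rightarrow> 'a::real_normed_field) \<Rightarrow> (int \<Rightarrow> 'a) \<Rightarrow> bool" where
  "linear_factors a c \<longleftrightarrow>
     summable (\<lambda>n. norm (a (int_decode n) - 1)) \<and> summable (\<lambda>n. norm (c (int_decode n)))"

definition linear_product :: "(int \<Rightarrow> 'a) \<Rightarrow> (int \<Rightarrow> 'a) \<Rightarrow> 'a \<Rightarrow> 'a::real_normed_field" where
  "linear_product a c z = (\<Prod>n. a (int_decode n) + c (int_decode n) * z)"

definition partial_product :: "(int \<Rightarrow> 'a) \<Rightarrow> (int \<Rightarrow> 'a) \<Rightarrow> nat \<Rightarrow> 'a \<Rightarrow> 'a::real_normed_field" where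
  "partial_product a c N z = (\<Prod>n<N. a (int_decode n) + c (int_decode n) * z)"

lemma linear_factors_norm: "linear_factors a c \<Longrightarrow> linear_factors (\<lambda>j. norm (a j)) (\<lambda>j. norm (c j))"
  unfolding linear_factors_def
proof (elim conjE, intro conjI)
  assume "summable (\<lambda>n. norm (a (int_decode n) - 1))"
  then show "summable (\<lambda>n. norm (norm (a (int_decode n)) - 1))"
    by (rule summable_comparison_test') (metis norm_ge_zero norm_one norm_triangle_ineq3 real_norm_def abs_of_nonneg)
qed simp

lemma linear_factors_remove:
  assumes "linear_factors a c"
  shows "linear_factors (a(k := 1)) (c(k := 0))"
proof -
  have "summable (\<lambda>n. norm ((a(k := 1)) (int_decode n) - 1))"
    by (rule summable_comparison_test'[where g = "\<lambda>n. norm (a (int_decode n) - 1)" and N = 0])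
       (use assms in \<open>auto simp: linear_factors_def\<close>)
  moreover have "summable (\<lambda>n. norm ((c(k := 0)) (int_decode n)))"
    by (rule summable_comparison_test'[where g = "\<lambda>n. norm (c (int_decode n))" and N = 0])
       (use assms in \<open>auto simp: linear_factors_def\<close>)
  ultimately show ?thesis by (simp add: linear_factors_def)
qed

context
  fixes a c :: "int \<Rightarrow> 'a :: {real_normed_field, banach}"
  assumes lf: "linear_factors a c"
begin

lemma linear_product_summable: "summable (\<lambda>n. norm (a (int_decode n) + c (int_decode n) * z - 1))"
proof (rule summable_comparison_test'[where N = 0])
  show "summable (\<lambda>n. norm (a (int_decode n) - 1) + norm (c (int_decode n)) * norm z)"
    using lf by (intro summable_add summable_mult2) (auto simp: linear_factors_def)
  show "norm (norm (a (int_decode n) + c (int_decode n) * z - 1))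
      \<le> norm (a (int_decode n) - 1) + norm (c (int_decode n)) * norm z" for n
    using norm_triangle_ineq[of "a (int_decode n) - 1" "c (int_decode n) * z"]
    by (simp add: norm_mult algebra_simps)
qed

lemma linear_product_convergent: "convergent_prod (\<lambda>n. a (int_decode n) + c (int_decode n) * z)"
  by (rule abs_convergent_prod_imp_convergent_prod[OF summable_imp_abs_convergent_prod[OF linear_product_summable]])

lemma partial_product_LIMSEQ: "(\<lambda>N. partial_product a c N z) \<longlonglongrightarrow> linear_product a c z"
  unfolding partial_product_def linear_product_def
  using convergent_prod_LIMSEQ[OF linear_product_convergent[of z]]
  by (subst LIMSEQ_lessThan_iff_atMost)

lemma linear_product_nonzero:
  assumes "\<And>j. a j + c j * z \<noteq> 0"
  shows "linear_product a c z \<noteq> 0"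
  unfolding linear_product_def
  by (rule prodinf_nonzero[OF linear_product_convergent]) (rule assms)

end

lemma partial_product_remove:
  assumes "int_encode k < N"
  shows "partial_product a c N z = (a k + c k * z) * partial_product (a(k := 1)) (c(k := 0)) N z"
proof -
  let ?f = "\<lambda>n. a (int_decode n) + c (int_decode n) * z"
  let ?g = "\<lambda>n. (a(k := 1)) (int_decode n) + (c(k := 0)) (int_decode n) * z"
  have k: "int_encode k \<in> {..<N}" using assms by simp
  have "(\<Prod>n<N. ?f n) = ?f (int_encode k) * (\<Prod>n\<in>{..<N} - {int_encode k}. ?f n)"
    by (rule prod.remove[OF _ k]) simp
  also have "(\<Prod>n\<in>{..<N} - {int_encode k}. ?f n) = (\<Prod>n\<in>{..<N} - {int_encode k}. ?g n)"
    by (rule prod.cong) auto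
  also have "\<dots> = (\<Prod>n<N. ?g n)"
    using prod.remove[OF _ k, of ?g] by simp
  finally show ?thesis by (simp add: partial_product_def)
qed

lemma linear_product_remove:
  fixes a c :: "int \<Rightarrow> 'a :: {real_normed_field, banach}"
  assumes lf: "linear_factors a c"
  shows "linear_product a c z = (a k + c k * z) * linear_product (a(k := 1)) (c(k := 0)) z"
proof (rule LIMSEQ_unique[OF partial_product_LIMSEQ[OF lf]])
  have "(\<lambda>N. (a k + c k * z) * partial_product (a(k := 1)) (c(k := 0)) N z)
     \<longlonglongrightarrow> (a k + c k * z) * linear_product (a(k := 1)) (c(k := 0)) z"
    by (intro tendsto_mult_left partial_product_LIMSEQ linear_factors_remove lf)
  moreover have "\<forall>\<^sub>F N in sequentially. (a k + c k * z) * partial_product (a(k := 1)) (c(k := 0)) N z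
      = partial_product a c N z"
    using eventually_gt_at_top[of "int_encode k"] by eventually_elim (rule partial_product_remove[symmetric])
  ultimately show "(\<lambda>N. partial_product a c N z) \<longlonglongrightarrow> (a k + c k * z) * linear_product (a(k := 1)) (c(k := 0)) z"
    by (rule Lim_transform_eventually)
qed

lemma linear_product_holomorphic:
  fixes a c :: "int \<Rightarrow> complex"
  assumes lf: "linear_factors a c"
  shows "linear_product a c holomorphic_on UNIV"
proof (rule holomorphic_uniform_sequence[where f = "partial_product a c"])
  show "partial_product a c N holomorphic_on UNIV" for N
    unfolding partial_product_def[abs_def] by (intro holomorphic_intros)
  fix z :: complex
  let ?K = "cball z 1"
  have "uniformly_convergent_on ?K (\<lambda>N w. \<Prod>n<N. a (int_decode n) + c (int_decode n) * w)"
  proof (rule uniformly_convergent_on_prod')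
    show "uniformly_convergent_on ?K (\<lambda>N w. \<Sum>n<N. norm (a (int_decode n) + c (int_decode n) * w - 1))"
    proof (rule Weierstrass_m_test')
      show "summable (\<lambda>n. norm (a (int_decode n) - 1) + norm (c (int_decode n)) * (norm z + 1))"
        using lf by (intro summable_add summable_mult2) (auto simp: linear_factors_def)
      fix n w assume "w \<in> ?K"
      then have w: "norm w \<le> norm z + 1" using norm_triangle_sub[of w z] by (simp add: dist_norm norm_minus_commute)
      have "norm (a (int_decode n) + c (int_decode n) * w - 1) \<le> norm (a (int_decode n) - 1) + norm (c (int_decode n) * w)"
        using norm_triangle_ineq[of "a (int_decode n) - 1" "c (int_decode n) * w"] by (simp add: algebra_simps)
      also have "\<dots> \<le> norm (a (int_decode n) - 1) + norm (c (int_decode n)) * (norm z + 1)"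
        using w by (auto simp: norm_mult intro: mult_left_mono)
      finally show "norm (norm (a (int_decode n) + c (int_decode n) * w - 1))
          \<le> norm (a (int_decode n) - 1) + norm (c (int_decode n)) * (norm z + 1)" by simp
    qed
  qed (auto intro!: continuous_intros)
  then have "uniformly_convergent_on ?K (partial_product a c)"
    by (simp add: partial_product_def[abs_def])
  then obtain l where l: "uniform_limit ?K (partial_product a c) l sequentially"
    by (auto simp: uniformly_convergent_on_def)
  have "l w = linear_product a c w" if "w \<in> ?K" for w
    using tendsto_uniform_limitI[OF l that] partial_product_LIMSEQ[OF lf] LIMSEQ_unique by blast
  then have "uniform_limit ?K (partial_product a c) (linear_product a c) sequentially"
    using l uniform_limit_cong'[of ?K "partial_product a c" "partial_product a c" l "linear_product a c"] by blast
  then show "\<exists>d>0. cball z d \<subseteq> UNIV \<and> uniform_limit (cball z d) (partial_product a c) (linear_product a c) sequentially"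
    by (intro exI[of _ 1]) auto
qed auto

lemma norm_partial_product_le:
  "norm (partial_product a c N z) \<le> partial_product (\<lambda>j. norm (a j)) (\<lambda>j. norm (c j)) N (norm z)"
  unfolding partial_product_def prod_norm[symmetric]
  by (intro prod_mono conjI norm_ge_zero order_trans[OF norm_triangle_ineq]) (simp add: norm_mult)

lemma norm_linear_product_le:
  fixes a c :: "int \<Rightarrow> 'a :: {real_normed_field, banach}"
  assumes lf: "linear_factors a c"
  shows "norm (linear_product a c z) \<le> linear_product (\<lambda>j. norm (a j)) (\<lambda>j. norm (c j)) (norm z)"
  by (rule LIMSEQ_le[OF tendsto_norm[OF partial_product_LIMSEQ[OF lf]]
        partial_product_LIMSEQ[OF linear_factors_norm[OF lf]]])
     (use norm_partial_product_le in blast)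

lemma linear_product_mono:
  fixes a c :: "int \<Rightarrow> real"
  assumes lf: "linear_factors a c" and nn: "\<And>j. a j \<ge> 0" "\<And>j. c j \<ge> 0" and r: "0 \<le> r" "r \<le> s"
  shows "linear_product a c r \<le> linear_product a c s"
proof (rule LIMSEQ_le[OF partial_product_LIMSEQ[OF lf] partial_product_LIMSEQ[OF lf]])
  have "partial_product a c N r \<le> partial_product a c N s" for N
    unfolding partial_product_def using nn r
    by (intro prod_mono conjI add_mono mult_left_mono add_nonneg_nonneg mult_nonneg_nonneg) auto
  then show "\<exists>N0. \<forall>N\<ge>N0. partial_product a c N r \<le> partial_product a c N s" by blast
qed

lemma linear_product_nonneg:
  fixes a c :: "int \<Rightarrow> real"
  assumes lf: "linear_factors a c" and nn: "\<And>j. a j \<ge> 0" "\<And>j. c j \<ge> 0" and r: "0 \<le> r"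
  shows "linear_product a c r \<ge> 0"
proof (rule LIMSEQ_le_const[OF partial_product_LIMSEQ[OF lf]])
  show "\<exists>N0. \<forall>N\<ge>N0. 0 \<le> partial_product a c N r"
    unfolding partial_product_def using nn r
    by (intro exI allI impI prod_nonneg ballI add_nonneg_nonneg mult_nonneg_nonneg) auto
qed

text \<open>
  The product has exponential type zero: finitely many factors contribute a power of \<open>r\<close>, and the
  remaining ones at most the exponential of \<open>r\<close> times a small tail of the sum of the \<open>c j\<close>.
\<close>

lemma linear_product_growth:
  fixes a c :: "int \<Rightarrow> real"
  assumes lf: "linear_factors a c" and nn: "\<And>j. a j \<ge> 0" "\<And>j. c j \<ge> 0" and e: "e > 0"
  obtains K where "\<And>r. r \<ge> 0 \<Longrightarrow> linear_product a c r \<le> K * exp (e * r)"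
proof -
  define C where "C = (\<lambda>n. c (int_decode n))"
  define A where "A = (\<lambda>n. a (int_decode n))"
  have sC: "summable C" and sA: "summable (\<lambda>n. \<bar>A n - 1\<bar>)"
    using lf nn by (auto simp: linear_factors_def C_def A_def)
  have nnC: "C n \<ge> 0" and nnA: "A n \<ge> 0" for n using nn by (auto simp: C_def A_def)
  have "(\<lambda>n. \<Sum>k. C (k + n)) \<longlonglongrightarrow> 0" by (rule suminf_exist_split2[OF sC])
  then have "\<forall>\<^sub>F n in sequentially. (\<Sum>k. C (k + n)) < e / 2"
    by (rule order_tendstoD) (use e in simp)
  then obtain N where N: "(\<Sum>k. C (k + N)) < e / 2" by (auto simp: eventually_sequentially)
  \<comment> \<open>Each of the first \<open>N\<close> factors is at most a constant times \<open>exp (d * r)\<close>.\<close>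
  define d where "d = e / (2 * (real N + 1))"
  have d: "d > 0" using e by (simp add: d_def)
  define L where "L = (\<Prod>n<N. A n + C n / d)"
  define T where "T = (\<Sum>n. \<bar>A n - 1\<bar>)"
  have L0: "L \<ge> 0" unfolding L_def using nnA nnC d by (intro prod_nonneg) auto
  have bound: "partial_product a c M r \<le> (L * exp T) * exp (e * r)" if r: "r \<ge> 0" and M: "M \<ge> N" for r M
  proof -
    have split: "partial_product a c M r = (\<Prod>n<N. A n + C n * r) * (\<Prod>n\<in>{N..<M}. A n + C n * r)"
      unfolding partial_product_def A_def[symmetric] C_def[symmetric]
      using M by (subst prod.union_disjoint[symmetric]) (auto intro!: prod.cong simp: A_def C_def)
    have head: "(\<Prod>n<N. A n + C n * r) \<le> L * exp (e / 2 * r)"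
    proof -
      have "(\<Prod>n<N. A n + C n * r) \<le> (\<Prod>n<N. (A n + C n / d) * exp (d * r))"
      proof (intro prod_mono conjI)
        fix n
        show "0 \<le> A n + C n * r" using nnA nnC r by simp
        have "A n + C n * r \<le> (A n + C n / d) * (1 + d * r)"
          using nnA[of n] nnC[of n] d r by (simp add: algebra_simps)
        also have "\<dots> \<le> (A n + C n / d) * exp (d * r)"
          using nnA[of n] nnC[of n] d by (intro mult_left_mono exp_ge_add_one_self) auto
        finally show "A n + C n * r \<le> (A n + C n / d) * exp (d * r)" .
      qed
      also have "\<dots> = L * exp (d * r) ^ N" by (simp add: prod.distrib L_def)
      also have "exp (d * r) ^ N = exp (real N * (d * r))" by (rule exp_of_nat_mult[symmetric])
      also have "L * \<dots> \<le> L * exp (e / 2 * r)"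
      proof -
        have "real N * d \<le> e / 2" using e by (simp add: d_def field_simps)
        then have "real N * (d * r) \<le> e / 2 * r" using mult_right_mono[of "real N * d" "e / 2" r] r by (simp only: mult.assoc)
        then show ?thesis using L0 by (intro mult_left_mono) auto
      qed
      finally show ?thesis .
    qed
    have tail: "(\<Prod>n\<in>{N..<M}. A n + C n * r) \<le> exp T * exp (e / 2 * r)"
    proof -
      have "(\<Prod>n\<in>{N..<M}. A n + C n * r) \<le> (\<Prod>n\<in>{N..<M}. exp (\<bar>A n - 1\<bar> + C n * r))"
      proof (intro prod_mono conjI)
        fix n
        show "0 \<le> A n + C n * r" using nnA nnC r by simp
        show "A n + C n * r \<le> exp (\<bar>A n - 1\<bar> + C n * r)"
          using exp_ge_add_one_self[of "\<bar>A n - 1\<bar> + C n * r"] by linarith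
      qed
      also have "\<dots> = exp ((\<Sum>n\<in>{N..<M}. \<bar>A n - 1\<bar>) + (\<Sum>n\<in>{N..<M}. C n) * r)"
        by (simp add: exp_sum[symmetric] sum.distrib sum_distrib_right)
      also have "\<dots> \<le> exp (T + e / 2 * r)"
      proof -
        have "(\<Sum>n\<in>{N..<M}. \<bar>A n - 1\<bar>) \<le> T"
          unfolding T_def by (rule sum_le_suminf[OF sA]) auto
        moreover have "(\<Sum>n\<in>{N..<M}. C n) = (\<Sum>k<M - N. C (k + N))"
        proof -
          have "{N..<M} = {0 + N..<(M - N) + N}" using M by auto
          then show ?thesis by (simp only: sum.shift_bounds_nat_ivl lessThan_atLeast0)
        qed
        moreover have "(\<Sum>k<M - N. C (k + N)) \<le> (\<Sum>k. C (k + N))"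
          by (rule sum_le_suminf) (use sC nnC in \<open>auto simp: summable_iff_shift\<close>)
        ultimately have "(\<Sum>n\<in>{N..<M}. C n) * r \<le> e / 2 * r"
          using N r by (intro mult_right_mono) auto
        with \<open>(\<Sum>n\<in>{N..<M}. \<bar>A n - 1\<bar>) \<le> T\<close> show ?thesis by simp
      qed
      finally show ?thesis by (simp add: exp_add)
    qed
    have "partial_product a c M r \<le> (L * exp (e / 2 * r)) * (exp T * exp (e / 2 * r))"
      unfolding split using L0 nnA nnC r
      by (intro mult_mono head tail prod_nonneg) auto
    also have "\<dots> = (L * exp T) * (exp (e / 2 * r) * exp (e / 2 * r))" by (simp add: mult_ac)
    also have "exp (e / 2 * r) * exp (e / 2 * r) = exp (e * r)"
      by (simp add: exp_add[symmetric])
    finally show ?thesis .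
  qed
  show ?thesis
  proof (rule that)
    fix r :: real assume r: "r \<ge> 0"
    show "linear_product a c r \<le> (L * exp T) * exp (e * r)"
      by (rule LIMSEQ_le_const2[OF partial_product_LIMSEQ[OF lf]]) (use bound[OF r] in blast)
  qed
qed

section \<open>Orthonormal bases of divided zeros\<close>

locale de_branges_orthonormal = de_branges_with_constants +
  fixes I :: "int set" and e :: "int \<Rightarrow> complex \<Rightarrow> complex"
  assumes basis: "de_branges_orthonormal_basis E I e"
begin

abbreviation coeff :: "(complex \<Rightarrow> complex) \<Rightarrow> int \<Rightarrow> complex" where
  "coeff F n \<equiv> de_branges_inner E F (e n)"

lemma e_mem: "n \<in> I \<Longrightarrow> e n \<in> de_branges E"
  using basis by (simp add: de_branges_orthonormal_basis_def)

lemma inner_e: "m \<in> I \<Longrightarrow> n \<in> I \<Longrightarrow> de_branges_inner E (e m) (e n) = (if m = n then 1 else 0)"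
  using basis by (simp add: de_branges_orthonormal_basis_def)

lemma e_combination_mem:
  assumes "finite J" "J \<subseteq> I"
  shows "(\<lambda>z. \<Sum>n\<in>J. c n * e n z) \<in> de_branges E"
  using assms
proof (induction J rule: finite_induct)
  case empty
  then show ?case using de_branges_scale[OF one_mem, of 0] by simp
next
  case (insert n J)
  then show ?case
    using de_branges_lincomb[OF e_mem[of n], of "\<lambda>z. \<Sum>n\<in>J. c n * e n z" "c n" 1] by simp
qed

lemma inner_e_combination:
  assumes "finite J" "J \<subseteq> I" and G: "G \<in> de_branges E"
  shows "de_branges_inner E (\<lambda>z. \<Sum>n\<in>J. c n * e n z) G = (\<Sum>n\<in>J. c n * de_branges_inner E (e n) G)"
  using assms(1,2)
proof (induction J rule: finite_induct)
  case empty
  then show ?case by (simp add: de_branges_inner_def)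
next
  case (insert n J)
  have "de_branges_inner E (\<lambda>z. c n * e n z + 1 * (\<Sum>n\<in>J. c n * e n z)) G
      = c n * de_branges_inner E (e n) G + 1 * de_branges_inner E (\<lambda>z. \<Sum>n\<in>J. c n * e n z) G"
    by (rule inner_lincomb_left) (use insert G in \<open>auto intro: e_mem e_combination_mem\<close>)
  then show ?case using insert by simp
qed

text \<open>
  Bessel's identity; it shows that the Fourier coefficients give the best approximation.
\<close>

lemma norm_diff_e_combination:
  assumes J: "finite J" "J \<subseteq> I" and F: "F \<in> de_branges E"
  shows "(de_branges_norm E (\<lambda>z. F z - (\<Sum>n\<in>J. c n * e n z)))\<^sup>2
     = (de_branges_norm E F)\<^sup>2 - (\<Sum>n\<in>J. (cmod (coeff F n))\<^sup>2) + (\<Sum>n\<in>J. (cmod (c n - coeff F n))\<^sup>2)"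
proof -
  define S where "S = (\<lambda>z. \<Sum>n\<in>J. c n * e n z)"
  have S: "S \<in> de_branges E" unfolding S_def by (rule e_combination_mem[OF J])
  have inner_left: "de_branges_inner E (\<lambda>z. F z - S z) G = de_branges_inner E F G - de_branges_inner E S G"
    if "G \<in> de_branges E" for G
    using inner_lincomb_left[OF F S that, of 1 "-1"] by simp
  have D: "(\<lambda>z. F z - S z) \<in> de_branges E" by (rule de_branges_diff[OF F S])
  have e_F: "de_branges_inner E (e n) F = cnj (coeff F n)" for n by (rule inner_commute)
  have SF: "de_branges_inner E S F = (\<Sum>n\<in>J. c n * cnj (coeff F n))"
    unfolding S_def by (simp add: inner_e_combination[OF J F] e_F)
  have S_e: "de_branges_inner E S (e n) = c n" if "n \<in> J" for n
  proof -
    have "de_branges_inner E S (e n) = (\<Sum>m\<in>J. if m = n then c m else 0)"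
    proof -
      have n: "n \<in> I" using that J by blast
      show ?thesis unfolding S_def inner_e_combination[OF J e_mem[OF n]]
        using n J by (intro sum.cong refl) (auto simp: inner_e subset_iff)
    qed
    then show ?thesis using that J(1) by simp
  qed
  have SS: "de_branges_inner E S S = (\<Sum>n\<in>J. c n * cnj (c n))"
  proof -
    have "de_branges_inner E S S = (\<Sum>n\<in>J. c n * de_branges_inner E (e n) S)"
      unfolding S_def by (rule inner_e_combination[OF J e_combination_mem[OF J]])
    also have "\<dots> = (\<Sum>n\<in>J. c n * cnj (c n))"
      by (intro sum.cong refl) (simp add: inner_commute[of "e _" S] S_e)
    finally show ?thesis .
  qed
  have "of_real ((de_branges_norm E (\<lambda>z. F z - S z))\<^sup>2) = de_branges_inner E (\<lambda>z. F z - S z) (\<lambda>z. F z - S z)"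
    by (rule inner_self[symmetric])
  also have "\<dots> = de_branges_inner E F (\<lambda>z. F z - S z) - de_branges_inner E S (\<lambda>z. F z - S z)"
    by (rule inner_left[OF D])
  also have "de_branges_inner E F (\<lambda>z. F z - S z) = cnj (de_branges_inner E F F - de_branges_inner E S F)"
    by (subst inner_commute) (simp only: inner_left[OF F])
  also have "de_branges_inner E S (\<lambda>z. F z - S z) = cnj (de_branges_inner E F S - de_branges_inner E S S)"
    by (subst inner_commute) (simp only: inner_left[OF S])
  finally have "of_real ((de_branges_norm E (\<lambda>z. F z - S z))\<^sup>2)
      = of_real ((de_branges_norm E F)\<^sup>2) + (\<Sum>n\<in>J. cnj (c n) * c n - cnj (c n) * coeff F n - c n * cnj (coeff F n))"
    by (simp add: SF SS inner_self[of F] inner_commute[of F S] sum_subtractf sum.distrib algebra_simps del: of_real_power)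
  also have "\<dots> = of_real ((de_branges_norm E F)\<^sup>2 + (\<Sum>n\<in>J. (cmod (c n - coeff F n))\<^sup>2 - (cmod (coeff F n))\<^sup>2))"
  proof -
    have "cnj (c n) * c n - cnj (c n) * coeff F n - c n * cnj (coeff F n)
        = of_real ((cmod (c n - coeff F n))\<^sup>2 - (cmod (coeff F n))\<^sup>2)" for n
      unfolding of_real_diff complex_norm_square by (simp add: algebra_simps)
    then show ?thesis by (simp only: of_real_add of_real_sum)
  qed
  finally have "(de_branges_norm E (\<lambda>z. F z - S z))\<^sup>2
      = (de_branges_norm E F)\<^sup>2 + (\<Sum>n\<in>J. (cmod (c n - coeff F n))\<^sup>2 - (cmod (coeff F n))\<^sup>2)"
    by (rule of_real_eq_iff[THEN iffD1])
  then show ?thesis by (simp add: S_def sum_subtractf)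
qed

lemma bessel:
  assumes "finite J" "J \<subseteq> I" "F \<in> de_branges E"
  shows "(\<Sum>n\<in>J. (cmod (coeff F n))\<^sup>2) \<le> (de_branges_norm E F)\<^sup>2"
  using norm_diff_e_combination[OF assms, of "coeff F"]
    zero_le_power2[of "de_branges_norm E (\<lambda>z. F z - (\<Sum>n\<in>J. coeff F n * e n z))"] by simp

lemma partial_expansion_close:
  assumes F: "F \<in> de_branges E" and \<epsilon>: "\<epsilon> > 0"
  shows "\<forall>\<^sub>F J in finite_subsets_at_top I. de_branges_norm E (\<lambda>z. F z - (\<Sum>n\<in>J. coeff F n * e n z)) < \<epsilon>"
proof -
  obtain J0 c where J0: "finite J0" "J0 \<subseteq> I" and close: "de_branges_norm E (\<lambda>z. F z - (\<Sum>n\<in>J0. c n * e n z)) < \<epsilon>"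
    using basis F \<epsilon> unfolding de_branges_orthonormal_basis_def by blast
  have "de_branges_norm E (\<lambda>z. F z - (\<Sum>n\<in>J. coeff F n * e n z)) < \<epsilon>" if J: "finite J" "J0 \<subseteq> J" "J \<subseteq> I" for J
  proof -
    have "(\<Sum>n\<in>J0. (cmod (coeff F n))\<^sup>2) \<le> (\<Sum>n\<in>J. (cmod (coeff F n))\<^sup>2)"
      by (rule sum_mono2) (use J in auto)
    moreover have "0 \<le> (\<Sum>n\<in>J0. (cmod (c n - coeff F n))\<^sup>2)" by (rule sum_nonneg) simp
    ultimately have "(de_branges_norm E (\<lambda>z. F z - (\<Sum>n\<in>J. coeff F n * e n z)))\<^sup>2
       \<le> (de_branges_norm E (\<lambda>z. F z - (\<Sum>n\<in>J0. c n * e n z)))\<^sup>2"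
      using norm_diff_e_combination[OF J(1,3) F, of "coeff F"] norm_diff_e_combination[OF J0 F, of c] by simp
    then have "de_branges_norm E (\<lambda>z. F z - (\<Sum>n\<in>J. coeff F n * e n z))
       \<le> de_branges_norm E (\<lambda>z. F z - (\<Sum>n\<in>J0. c n * e n z))"
      by (rule power2_le_imp_le) simp
    then show ?thesis using close by linarith
  qed
  then show ?thesis unfolding eventually_finite_subsets_at_top using J0 by blast
qed

lemma norm_le_if_coeff_sums_le:
  assumes F: "F \<in> de_branges E" and le: "\<And>J. finite J \<Longrightarrow> J \<subseteq> I \<Longrightarrow> (\<Sum>n\<in>J. (cmod (coeff F n))\<^sup>2) \<le> M\<^sup>2"
    and M: "M \<ge> 0"
  shows "de_branges_norm E F \<le> M"
proof (rule power2_le_imp_le[OF _ M], rule field_le_epsilon)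
  fix \<epsilon> :: real assume \<epsilon>: "\<epsilon> > 0"
  have close: "\<forall>\<^sub>F J in finite_subsets_at_top I.
      de_branges_norm E (\<lambda>z. F z - (\<Sum>n\<in>J. coeff F n * e n z)) < sqrt \<epsilon>"
    by (rule partial_expansion_close[OF F]) (use \<epsilon> in simp)
  have fin: "\<forall>\<^sub>F J in finite_subsets_at_top I. finite J \<and> J \<subseteq> I"
    by (rule eventually_finite_subsets_at_top_weakI) auto
  have "\<forall>\<^sub>F J in finite_subsets_at_top I. (de_branges_norm E F)\<^sup>2 \<le> M\<^sup>2 + \<epsilon>"
    using close fin
  proof eventually_elim
    case (elim J)
    have "(de_branges_norm E (\<lambda>z. F z - (\<Sum>n\<in>J. coeff F n * e n z)))\<^sup>2 \<le> (sqrt \<epsilon>)\<^sup>2"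
      using elim(1) by (intro power_mono) auto
    then show ?case using norm_diff_e_combination[of J F "coeff F"] elim(2) F le[of J] \<epsilon> by simp
  qed
  then show "(de_branges_norm E F)\<^sup>2 \<le> M\<^sup>2 + \<epsilon>" by (simp add: eventually_const)
qed

text \<open>
  Norm convergence of the Fourier expansion implies pointwise convergence because evaluations are
  bounded.
\<close>

lemma expansion_pointwise:
  assumes F: "F \<in> de_branges E"
  shows "((\<lambda>J. \<Sum>n\<in>J. coeff F n * e n z) \<longlongrightarrow> F z) (finite_subsets_at_top I)"
proof (rule tendstoI)
  fix \<epsilon> :: real assume \<epsilon>: "\<epsilon> > 0"
  obtain C where C: "C > 0" "\<And>F w. F \<in> de_branges E \<Longrightarrow> norm w \<le> norm z \<Longrightarrow> norm (F w) \<le> C * de_branges_norm E F"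
    using evaluation_bounded[of "norm z"] by blast
  have "\<forall>\<^sub>F J in finite_subsets_at_top I. de_branges_norm E (\<lambda>z. F z - (\<Sum>n\<in>J. coeff F n * e n z)) < \<epsilon> / C"
    by (rule partial_expansion_close[OF F]) (use \<epsilon> C in simp)
  moreover have "\<forall>\<^sub>F J in finite_subsets_at_top I. finite J \<and> J \<subseteq> I"
    by (rule eventually_finite_subsets_at_top_weakI) auto
  ultimately show "\<forall>\<^sub>F J in finite_subsets_at_top I. dist (\<Sum>n\<in>J. coeff F n * e n z) (F z) < \<epsilon>"
  proof eventually_elim
    case (elim J)
    have "norm (F z - (\<Sum>n\<in>J. coeff F n * e n z)) \<le> C * de_branges_norm E (\<lambda>z. F z - (\<Sum>n\<in>J. coeff F n * e n z))"
      by (rule C(2)[OF de_branges_diff[OF F e_combination_mem]]) (use elim in auto)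
    also have "\<dots> < \<epsilon>" using elim(1) C by (simp add: pos_less_divide_eq mult.commute)
    finally show ?case by (simp add: dist_norm norm_minus_commute)
  qed
qed

end

text \<open>
  The functions \<open>A(z) / (z - t n)\<close> diagonalise evaluation at the points \<open>t n\<close>, so that the
  Fourier coefficients of \<open>F\<close> are, up to normalisation, the values \<open>F (t n)\<close>.
\<close>

locale de_branges_spectral = de_branges_with_constants +
  fixes I :: "int set" and t \<nu> :: "int \<Rightarrow> real" and A :: "complex \<Rightarrow> complex"
  assumes t_inj_on: "inj_on t I"
    and \<nu>_pos: "\<And>n. n \<in> I \<Longrightarrow> \<nu> n > 0"
    and A_holomorphic: "A holomorphic_on UNIV"
    and A_zeros: "{z. A z = 0} = (\<lambda>n. of_real (t n)) ` I"
    and deriv_A_nonzero: "\<And>n. n \<in> I \<Longrightarrow> deriv A (of_real (t n)) \<noteq> 0"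
    and basis: "de_branges_orthonormal_basis E I
          (\<lambda>n z. of_real (sqrt (\<nu> n)) * divided_zero A (of_real (t n)) z)"
begin

sublocale de_branges_orthonormal E I "\<lambda>n z. of_real (sqrt (\<nu> n)) * divided_zero A (of_real (t n)) z"
  by unfold_locales (rule basis)

lemma A_t [simp]: "n \<in> I \<Longrightarrow> A (of_real (t n)) = 0"
  using A_zeros by blast

lemma divided_zero_t:
  assumes "m \<in> I" "n \<in> I"
  shows "divided_zero A (of_real (t n)) (of_real (t m)) = (if m = n then deriv A (of_real (t n)) else 0)"
  using assms t_inj_on by (auto simp: divided_zero_def inj_on_def)

lemma mult_divided_zero: "n \<in> I \<Longrightarrow> (z - of_real (t n)) * divided_zero A (of_real (t n)) z = A z"
  by (auto simp: divided_zero_def)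

lemma value_at_t:
  assumes F: "F \<in> de_branges E" and n: "n \<in> I"
  shows "F (of_real (t n)) = coeff F n * of_real (sqrt (\<nu> n)) * deriv A (of_real (t n))"
proof (rule tendsto_unique[OF _ expansion_pointwise[OF F]])
  show "((\<lambda>J. \<Sum>k\<in>J. coeff F k * (of_real (sqrt (\<nu> k)) * divided_zero A (of_real (t k)) (of_real (t n))))
      \<longlongrightarrow> coeff F n * of_real (sqrt (\<nu> n)) * deriv A (of_real (t n))) (finite_subsets_at_top I)"
  proof (rule tendsto_eventually)
    have "(\<Sum>k\<in>J. coeff F k * (of_real (sqrt (\<nu> k)) * divided_zero A (of_real (t k)) (of_real (t n))))
       = coeff F n * of_real (sqrt (\<nu> n)) * deriv A (of_real (t n))"
      if J: "finite J" "{n} \<subseteq> J" "J \<subseteq> I" for J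
    proof -
      have "(\<Sum>k\<in>J. coeff F k * (of_real (sqrt (\<nu> k)) * divided_zero A (of_real (t k)) (of_real (t n))))
         = (\<Sum>k\<in>J. if k = n then coeff F n * of_real (sqrt (\<nu> n)) * deriv A (of_real (t n)) else 0)"
        using J n by (intro sum.cong refl) (auto simp: divided_zero_t)
      then show ?thesis using J by simp
    qed
    then show "\<forall>\<^sub>F J in finite_subsets_at_top I.
       (\<Sum>k\<in>J. coeff F k * (of_real (sqrt (\<nu> k)) * divided_zero A (of_real (t k)) (of_real (t n))))
       = coeff F n * of_real (sqrt (\<nu> n)) * deriv A (of_real (t n))"
      unfolding eventually_finite_subsets_at_top using n by (intro exI[of _ "{n}"]) auto
  qed
qed (simp add: finite_subsets_at_top_neq_bot)

lemma cmod_coeff: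
  assumes F: "F \<in> de_branges E" and n: "n \<in> I"
  shows "cmod (coeff F n) = cmod (F (of_real (t n))) / (sqrt (\<nu> n) * cmod (deriv A (of_real (t n))))"
  using value_at_t[OF assms] deriv_A_nonzero[OF n] \<nu>_pos[OF n] by (simp add: norm_mult)

end

section \<open>The canonical product of a lacunary sequence\<close>

lemma summable_int_decode:
  fixes f :: "int \<Rightarrow> real"
  assumes "f summable_on UNIV" "\<And>j. f j \<ge> 0"
  shows "summable (\<lambda>n. f (int_decode n))"
proof (rule summableI_nonneg_bounded)
  fix N
  have "(\<Sum>n<N. f (int_decode n)) = (\<Sum>j\<in>int_decode ` {..<N}. f j)"
    by (subst sum.reindex) (auto intro: inj_on_subset[OF inj_int_decode])
  also have "\<dots> \<le> infsum f UNIV"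
    by (rule finite_sum_le_infsum) (use assms in auto)
  finally show "(\<Sum>n<N. f (int_decode n)) \<le> infsum f UNIV" .
qed (use assms in auto)

text \<open>
  The Borel--Caratheodory argument: when \<open>Re H < M\<close> on a disc and \<open>H 0 = 0\<close>, the map
  \<open>H / (2 * M - H)\<close> sends the disc into the unit disc, and the Schwarz lemma bounds \<open>H' 0\<close> by \<open>2 * M / R\<close>.
\<close>

lemma entire_sublinear_Re_constant:
  fixes h :: "complex \<Rightarrow> complex"
  assumes hol: "h holomorphic_on UNIV"
    and growth: "\<And>\<epsilon>. \<epsilon> > 0 \<Longrightarrow> \<exists>K. \<forall>z. Re (h z) \<le> K + \<epsilon> * norm z"
  shows "h z = h 0"
proof -
  have hd: "(h has_field_derivative deriv h w) (at w)" for w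
    using holomorphic_derivI[OF hol] by simp
  have bound: "norm (deriv h w) \<le> 2 * (K + \<epsilon> * norm w + norm (h w) + 1) / R + 2 * \<epsilon>"
    if \<epsilon>: "\<epsilon> > 0" and K: "\<And>z. Re (h z) \<le> K + \<epsilon> * norm z" and R: "R > 0" for w \<epsilon> K R
  proof -
    define M where "M = (K + \<epsilon> * norm w + norm (h w) + 1) + \<epsilon> * R"
    define H where "H = (\<lambda>\<zeta>. h (w + of_real R * \<zeta>) - h w)"
    have Re_lt: "Re (H \<zeta>) < M" if "norm \<zeta> < 1" for \<zeta>
    proof -
      have "norm (w + of_real R * \<zeta>) \<le> norm w + R * norm \<zeta>"
        using norm_triangle_ineq[of w "of_real R * \<zeta>"] R by (simp add: norm_mult)
      also have "\<dots> \<le> norm w + R" using that R by (simp add: mult_left_le)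
      finally have "\<epsilon> * norm (w + of_real R * \<zeta>) \<le> \<epsilon> * (norm w + R)"
        using \<epsilon> by (intro mult_left_mono) auto
      moreover have "- Re (h w) \<le> norm (h w)" using abs_Re_le_cmod[of "h w"] by linarith
      ultimately show ?thesis
        using K[of "w + of_real R * \<zeta>"] by (simp add: H_def M_def algebra_simps)
    qed
    have H0: "H 0 = 0" by (simp add: H_def)
    have M: "M > 0" using Re_lt[of 0] H0 by simp
    have lt: "norm (H \<zeta>) < norm (2 * of_real M - H \<zeta>)" if "norm \<zeta> < 1" for \<zeta>
    proof (rule power2_less_imp_less)
      have "M * Re (H \<zeta>) < M * M" using Re_lt[OF that] M by (intro mult_strict_left_mono) auto
      then show "(norm (H \<zeta>))\<^sup>2 < (norm (2 * of_real M - H \<zeta>))\<^sup>2"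
        unfolding cmod_power2 by (simp add: power2_eq_square algebra_simps)
    qed simp
    define \<phi> where "\<phi> = (\<lambda>\<zeta>. H \<zeta> / (2 * of_real M - H \<zeta>))"
    have dH: "(H has_field_derivative of_real R * deriv h (w + of_real R * \<zeta>)) (at \<zeta>)" for \<zeta>
      unfolding H_def
      by (rule derivative_eq_intros DERIV_chain2[OF hd] refl | simp)+
    have "norm (deriv \<phi> 0) \<le> 1"
    proof (rule Schwarz_Lemma(2))
      have "H holomorphic_on ball 0 1"
        using dH by (meson field_differentiable_at_within field_differentiable_def holomorphic_onI)
      moreover have "2 * of_real M - H \<zeta> \<noteq> 0" if "norm \<zeta> < 1" for \<zeta>
        using lt[OF that] by force
      ultimately show "\<phi> holomorphic_on ball 0 1" unfolding \<phi>_def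
        by (intro holomorphic_intros) auto
      show "\<phi> 0 = 0" by (simp add: \<phi>_def H0)
      show "norm (\<phi> \<zeta>) < 1" if "norm \<zeta> < 1" for \<zeta>
        using lt[OF that] by (simp add: \<phi>_def norm_divide divide_less_eq)
      show "norm (0::complex) < 1" by simp
    qed
    moreover have "deriv \<phi> 0 = of_real R * deriv h w / (2 * of_real M)"
    proof (rule DERIV_imp_deriv)
      have "(\<phi> has_field_derivative
         (of_real R * deriv h (w + of_real R * 0) * (2 * of_real M - H 0)
            - H 0 * (0 - of_real R * deriv h (w + of_real R * 0)))
         / ((2 * of_real M - H 0) * (2 * of_real M - H 0))) (at 0)"
        unfolding \<phi>_def using M by (intro DERIV_divide DERIV_diff DERIV_const dH) (simp add: H0)
      then show "(\<phi> has_field_derivative of_real R * deriv h w / (2 * of_real M)) (at 0)"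
        using M by (simp add: H0 field_simps)
    qed
    ultimately have "R * norm (deriv h w) / (2 * M) \<le> 1"
      using R M by (simp add: norm_mult norm_divide)
    then have "norm (deriv h w) \<le> 2 * M / R" using R M by (simp add: field_simps)
    then show ?thesis using R by (simp add: M_def add_divide_distrib algebra_simps)
  qed
  have "deriv h w = 0" for w
  proof -
    have small: "norm (deriv h w) \<le> 2 * \<epsilon>" if \<epsilon>: "\<epsilon> > 0" for \<epsilon>
    proof -
      obtain K where K: "\<And>z. Re (h z) \<le> K + \<epsilon> * norm z" using growth[OF \<epsilon>] by blast
      have "((\<lambda>R. 2 * (K + \<epsilon> * norm w + norm (h w) + 1) / R + 2 * \<epsilon>) \<longlongrightarrow> 0 + 2 * \<epsilon>) at_top"
        by (intro tendsto_add tendsto_const tendsto_divide_0[OF tendsto_const])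
           (simp add: filterlim_at_top_imp_at_infinity filterlim_ident)
      moreover have "\<forall>\<^sub>F R in at_top. norm (deriv h w) \<le> 2 * (K + \<epsilon> * norm w + norm (h w) + 1) / R + 2 * \<epsilon>"
        using eventually_gt_at_top[of 0] by eventually_elim (rule bound[OF \<epsilon> K])
      ultimately have "norm (deriv h w) \<le> 0 + 2 * \<epsilon>"
        by (rule tendsto_lowerbound) simp
      then show ?thesis by simp
    qed
    have "norm (deriv h w) \<le> 0"
    proof (rule field_le_epsilon)
      show "norm (deriv h w) \<le> 0 + e" if "e > 0" for e using small[of "e / 2"] that by simp
    qed
    then show ?thesis by simp
  qed
  then have "(h has_field_derivative 0) (at w)" for w using hd[of w] by simp
  then obtain c where "\<And>w. h w = c"
    using has_field_derivative_zero_constant[of UNIV h] by auto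
  then show ?thesis by simp
qed

text \<open>
  Only factors with \<open>a j < 1\<close> can be smaller than \<open>1\<close>; once all of them have entered, the partial
  products increase to their limit.
\<close>

lemma partial_product_le_linear_product:
  fixes a c :: "int \<Rightarrow> real"
  assumes lf: "linear_factors a c" and nn: "\<And>j. a j \<ge> 0" "\<And>j. c j \<ge> 0"
    and ge1: "\<And>n. n \<ge> N0 \<Longrightarrow> a (int_decode n) \<ge> 1" and N: "N \<ge> N0" and r: "r \<ge> 0"
  shows "partial_product a c N r \<le> linear_product a c r"
proof (rule LIMSEQ_le_const[OF partial_product_LIMSEQ[OF lf]])
  have "partial_product a c N r \<le> partial_product a c M r" if "M \<ge> N" for M
    using that
  proof (induction M rule: dec_induct)
    case (step M)
    have "a (int_decode M) + c (int_decode M) * r \<ge> 1"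
      using ge1[of M] step N nn r by (smt (verit) mult_nonneg_nonneg order_trans)
    moreover have "partial_product a c M r \<ge> 0"
      unfolding partial_product_def using nn r by (intro prod_nonneg) auto
    ultimately have "partial_product a c M r * 1 \<le> partial_product a c M r * (a (int_decode M) + c (int_decode M) * r)"
      by (intro mult_left_mono) auto
    then show ?case using step by (simp add: partial_product_def)
  qed simp
  then show "\<exists>M0. \<forall>M\<ge>M0. partial_product a c N r \<le> partial_product a c M r" by blast
qed

context lacunary_sequence
begin

text \<open>
  The factor attached to a point \<open>t j\<close> is \<open>1 - z / t j\<close>, or \<open>z\<close> when \<open>t j = 0\<close>. In both
  cases it is \<open>slope j * (z - t j)\<close>.
\<close>

definition slope :: "int \<Rightarrow> real" where
  "slope j = (if t j = 0 then 1 else - 1 / t j)"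

definition const_coeff :: "int set \<Rightarrow> int \<Rightarrow> real" where
  "const_coeff S j = (if j \<in> S \<and> t j = 0 then 0 else 1)"

definition lin_coeff :: "int set \<Rightarrow> int \<Rightarrow> real" where
  "lin_coeff S j = (if j \<in> S then slope j else 0)"

definition zero_product :: "int set \<Rightarrow> complex \<Rightarrow> complex" where
  "zero_product S = linear_product (\<lambda>j. of_real (const_coeff S j)) (\<lambda>j. of_real (lin_coeff S j))"

definition zero_majorant :: "int set \<Rightarrow> real \<Rightarrow> real" where
  "zero_majorant S = linear_product (const_coeff S) (\<lambda>j. \<bar>lin_coeff S j\<bar>)"

lemma slope_nonzero [simp]: "slope j \<noteq> 0"
  by (simp add: slope_def)

lemma factor_eq:
  "of_real (const_coeff S j) + of_real (lin_coeff S j) * z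
     = (if j \<in> S then of_real (slope j) * (z - of_real (t j)) else (1::complex))"
  by (auto simp: const_coeff_def lin_coeff_def slope_def field_simps)

lemma majorant_factor_eq:
  "const_coeff S j + \<bar>lin_coeff S j\<bar> * r = (if j \<in> S then \<bar>slope j\<bar> * (r + \<bar>t j\<bar>) else 1)"
  by (auto simp: const_coeff_def lin_coeff_def slope_def field_simps)

lemma const_coeff_nonneg: "const_coeff S j \<ge> 0"
  by (simp add: const_coeff_def)

lemma real_linear_factors:
  assumes S: "S \<subseteq> I"
  shows "linear_factors (const_coeff S) (lin_coeff S)"
proof -
  have fin: "finite {j\<in>S. t j = 0}"
    by (rule finite_subset[OF _ finite_abs_le[of 0]]) (use S in auto)
  have zeros: "(\<lambda>j. if j \<in> S \<and> t j = 0 then 1 else 0 :: real) summable_on UNIV"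
    by (subst summable_on_cong_neutral[where T = "{j\<in>S. t j = 0}" and g = "\<lambda>j. 1"])
       (use fin in auto)
  have slopes: "(\<lambda>j. if j \<in> S then 1 / \<bar>t j\<bar> else 0) summable_on UNIV"
    by (subst summable_on_cong_neutral[where T = S and g = "\<lambda>j. 1 / \<bar>t j\<bar>"])
       (use summable_on_subset_banach[OF summable_inverse_abs S] in auto)
  have "(\<lambda>j. (if j \<in> S then 1 / \<bar>t j\<bar> else 0) + (if j \<in> S \<and> t j = 0 then 1 else 0)) summable_on UNIV"
    by (rule summable_on_add[OF slopes zeros])
  then have "(\<lambda>j. norm (lin_coeff S j)) summable_on UNIV"
    by (rule summable_on_cong[THEN iffD1, rotated]) (auto simp: lin_coeff_def slope_def)
  moreover have "(\<lambda>j. norm (const_coeff S j - 1)) summable_on UNIV"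
    using zeros by (rule summable_on_cong[THEN iffD1, rotated]) (auto simp: const_coeff_def)
  ultimately show ?thesis
    unfolding linear_factors_def by (auto intro!: summable_int_decode)
qed

lemma majorant_linear_factors: "S \<subseteq> I \<Longrightarrow> linear_factors (const_coeff S) (\<lambda>j. \<bar>lin_coeff S j\<bar>)"
  using real_linear_factors by (simp add: linear_factors_def)

lemma complex_linear_factors:
  assumes "S \<subseteq> I"
  shows "linear_factors (\<lambda>j. complex_of_real (const_coeff S j)) (\<lambda>j. complex_of_real (lin_coeff S j))"
proof -
  have "norm (complex_of_real x - 1) = norm (x - 1)" for x
    by (metis norm_of_real of_real_1 of_real_diff real_norm_def)
  then show ?thesis using real_linear_factors[OF assms] by (simp add: linear_factors_def)
qed

lemma zero_product_holomorphic: "S \<subseteq> I \<Longrightarrow> zero_product S holomorphic_on UNIV"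
  unfolding zero_product_def by (intro linear_product_holomorphic complex_linear_factors)

lemma norm_zero_product_le:
  assumes "S \<subseteq> I"
  shows "norm (zero_product S z) \<le> zero_majorant S (norm z)"
  using norm_linear_product_le[OF complex_linear_factors[OF assms], of z]
  by (simp add: zero_product_def zero_majorant_def abs_of_nonneg[OF const_coeff_nonneg])

lemma zero_majorant_mono: "S \<subseteq> I \<Longrightarrow> 0 \<le> r \<Longrightarrow> r \<le> s \<Longrightarrow> zero_majorant S r \<le> zero_majorant S s"
  unfolding zero_majorant_def
  by (intro linear_product_mono majorant_linear_factors const_coeff_nonneg) auto

lemma zero_majorant_nonneg: "S \<subseteq> I \<Longrightarrow> 0 \<le> r \<Longrightarrow> zero_majorant S r \<ge> 0"
  unfolding zero_majorant_def
  by (intro linear_product_nonneg majorant_linear_factors const_coeff_nonneg) auto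

lemma zero_product_nonzero:
  assumes "S \<subseteq> I" "\<And>j. j \<in> S \<Longrightarrow> z \<noteq> of_real (t j)"
  shows "zero_product S z \<noteq> 0"
  unfolding zero_product_def
  by (rule linear_product_nonzero[OF complex_linear_factors[OF assms(1)]])
     (use assms(2) in \<open>auto simp: factor_eq\<close>)

lemma zero_product_remove:
  assumes S: "S \<subseteq> I" and k: "k \<in> S"
  shows "zero_product S z = of_real (slope k) * (z - of_real (t k)) * zero_product (S - {k}) z"
proof -
  have "(\<lambda>j. complex_of_real (const_coeff S j))(k := 1) = (\<lambda>j. of_real (const_coeff (S - {k}) j))"
       "(\<lambda>j. complex_of_real (lin_coeff S j))(k := 0) = (\<lambda>j. of_real (lin_coeff (S - {k}) j))"
    by (auto simp: const_coeff_def lin_coeff_def fun_eq_iff)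
  then show ?thesis
    using linear_product_remove[OF complex_linear_factors[OF S], of z k] k
    by (simp add: zero_product_def factor_eq)
qed

lemma zero_majorant_remove:
  assumes S: "S \<subseteq> I" and k: "k \<in> S"
  shows "zero_majorant S r = \<bar>slope k\<bar> * (r + \<bar>t k\<bar>) * zero_majorant (S - {k}) r"
proof -
  have "(const_coeff S)(k := 1) = const_coeff (S - {k})"
       "(\<lambda>j. \<bar>lin_coeff S j\<bar>)(k := 0) = (\<lambda>j. \<bar>lin_coeff (S - {k}) j\<bar>)"
    by (auto simp: const_coeff_def lin_coeff_def fun_eq_iff)
  then show ?thesis
    using linear_product_remove[OF majorant_linear_factors[OF S], of r k] k
    by (simp add: zero_majorant_def majorant_factor_eq)
qed

lemma zero_product_at_zero: "S \<subseteq> I \<Longrightarrow> n \<in> S \<Longrightarrow> zero_product S (of_real (t n)) = 0"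
  by (simp add: zero_product_remove)

text \<open>
  Both sides, multiplied by \<open>\<bar>t n\<bar> + \<bar>t k\<bar>\<close>, are the majorant over all of \<open>I\<close>.
\<close>

lemma zero_majorant_overlap:
  assumes n: "n \<in> I" and k: "k \<in> I"
  shows "\<bar>slope k\<bar> * zero_majorant (I - {k}) \<bar>t n\<bar>
       = overlap t n k * (\<bar>slope n\<bar> * zero_majorant (I - {n}) \<bar>t n\<bar>)"
proof (cases "k = n")
  case False
  then have "t k \<noteq> t n" using t_eq_iff n k by blast
  then have pos: "\<bar>t n\<bar> + \<bar>t k\<bar> > 0" by linarith
  have "(\<bar>t n\<bar> + \<bar>t k\<bar>) * (\<bar>slope k\<bar> * zero_majorant (I - {k}) \<bar>t n\<bar>)
      = 2 * \<bar>t n\<bar> * (\<bar>slope n\<bar> * zero_majorant (I - {n}) \<bar>t n\<bar>)"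
    using zero_majorant_remove[OF order_refl n, of "\<bar>t n\<bar>"] zero_majorant_remove[OF order_refl k, of "\<bar>t n\<bar>"]
    by (simp add: mult_ac)
  then show ?thesis using pos False by (simp add: overlap_def field_simps)
qed (simp add: overlap_def)

text \<open>
  The separation estimate for partial products, passed to the limit.
\<close>

lemma zero_majorant_le_zero_product:
  obtains C where "C > 0"
    "\<And>n. n \<in> I \<Longrightarrow> zero_majorant (I - {n}) \<bar>t n\<bar> \<le> C * norm (zero_product (I - {n}) (of_real (t n)))"
proof -
  obtain C where C: "C > 0" and sep: "\<And>n J. n \<in> I \<Longrightarrow> finite J \<Longrightarrow> J \<subseteq> I - {n} \<Longrightarrow>
       (\<Prod>j\<in>J. \<bar>t n\<bar> + \<bar>t j\<bar>) \<le> C * (\<Prod>j\<in>J. \<bar>t n - t j\<bar>)"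
    using separation_product_bounded by blast
  have "zero_majorant (I - {n}) \<bar>t n\<bar> \<le> C * norm (zero_product (I - {n}) (of_real (t n)))" if n: "n \<in> I" for n
  proof -
    let ?S = "I - {n}"
    let ?m = "\<lambda>N. partial_product (const_coeff ?S) (\<lambda>j. \<bar>lin_coeff ?S j\<bar>) N \<bar>t n\<bar>"
    let ?p = "\<lambda>N. partial_product (\<lambda>j. complex_of_real (const_coeff ?S j)) (\<lambda>j. of_real (lin_coeff ?S j)) N (of_real (t n))"
    have le: "?m N \<le> C * norm (?p N)" for N
    proof -
      let ?J = "{j \<in> int_decode ` {..<N}. j \<in> ?S}"
      have reindex: "(\<Prod>i<N. f (int_decode i)) = (\<Prod>j\<in>int_decode ` {..<N}. f j)" for f :: "int \<Rightarrow> real"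
        by (subst prod.reindex) (auto intro: inj_on_subset[OF inj_int_decode])
      have drop: "(\<Prod>j\<in>int_decode ` {..<N}. if j \<in> ?S then f j else 1) = (\<Prod>j\<in>?J. f j)" for f :: "int \<Rightarrow> real"
        by (rule prod.inter_filter[symmetric]) simp
      have m: "?m N = (\<Prod>j\<in>?J. \<bar>slope j\<bar> * (\<bar>t n\<bar> + \<bar>t j\<bar>))"
        unfolding partial_product_def majorant_factor_eq
          reindex[of "\<lambda>j. if j \<in> ?S then \<bar>slope j\<bar> * (\<bar>t n\<bar> + \<bar>t j\<bar>) else 1"] drop ..
      have "norm (?p N) = (\<Prod>i<N. if int_decode i \<in> ?S then \<bar>slope (int_decode i)\<bar> * \<bar>t n - t (int_decode i)\<bar> else 1)"
        unfolding partial_product_def prod_norm[symmetric] factor_eq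
        by (intro prod.cong refl) (auto simp: norm_mult simp flip: of_real_diff)
      then have p: "norm (?p N) = (\<Prod>j\<in>?J. \<bar>slope j\<bar> * \<bar>t n - t j\<bar>)"
        unfolding reindex[of "\<lambda>j. if j \<in> ?S then \<bar>slope j\<bar> * \<bar>t n - t j\<bar> else 1"] drop .
      have "(\<Prod>j\<in>?J. \<bar>slope j\<bar>) * (\<Prod>j\<in>?J. \<bar>t n\<bar> + \<bar>t j\<bar>)
          \<le> (\<Prod>j\<in>?J. \<bar>slope j\<bar>) * (C * (\<Prod>j\<in>?J. \<bar>t n - t j\<bar>))"
        by (intro mult_left_mono sep n prod_nonneg) auto
      then show ?thesis unfolding m p prod.distrib by (simp add: mult_ac)
    qed
    show ?thesis unfolding zero_majorant_def zero_product_def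
      by (rule LIMSEQ_le[OF partial_product_LIMSEQ[OF majorant_linear_factors]
            tendsto_mult_left[OF tendsto_norm[OF partial_product_LIMSEQ[OF complex_linear_factors]]]])
         (use le in auto)
  qed
  with C show ?thesis by (rule that)
qed

lemma zero_product_polynomial_approx:
  assumes S: "S \<subseteq> I"
  obtains p :: "nat \<Rightarrow> complex poly" where "\<And>z. (\<lambda>N. poly (p N) z) \<longlonglongrightarrow> zero_product S z"
    "\<And>N z. norm (poly (p N) z) \<le> zero_majorant S (norm z)"
proof -
  let ?a = "\<lambda>j. complex_of_real (const_coeff S j)" and ?c = "\<lambda>j. complex_of_real (lin_coeff S j)"
  define p where "p = (\<lambda>N. \<Prod>n<N. [:?a (int_decode n), ?c (int_decode n):])"
  have p: "poly (p N) z = partial_product ?a ?c N z" for N z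
    by (simp add: p_def poly_prod partial_product_def mult.commute)
  have "finite (int_encode ` {j\<in>S. t j = 0})"
    by (intro finite_imageI finite_subset[OF _ finite_abs_le[of 0]]) (use S in auto)
  then obtain N0 where N0: "\<And>j. j \<in> S \<Longrightarrow> t j = 0 \<Longrightarrow> int_encode j < N0"
    unfolding finite_nat_set_iff_bounded by blast
  have "norm (poly (p N) z) \<le> zero_majorant S (norm z)" if "N \<ge> N0" for N z
  proof -
    have "norm (poly (p N) z) \<le> partial_product (const_coeff S) (\<lambda>j. \<bar>lin_coeff S j\<bar>) N (norm z)"
      using norm_partial_product_le[of ?a ?c N z] by (simp add: p abs_of_nonneg[OF const_coeff_nonneg])
    also have "\<dots> \<le> zero_majorant S (norm z)" unfolding zero_majorant_def
    proof (rule partial_product_le_linear_product[OF majorant_linear_factors[OF S]])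
      show "const_coeff S (int_decode n) \<ge> 1" if "n \<ge> N0" for n
        using N0[of "int_decode n"] that by (auto simp: const_coeff_def)
    qed (use that const_coeff_nonneg in auto)
    finally show ?thesis .
  qed
  moreover have "(\<lambda>N. poly (p (N + N0)) z) \<longlonglongrightarrow> zero_product S z" for z
    unfolding p zero_product_def
    by (rule LIMSEQ_ignore_initial_segment[OF partial_product_LIMSEQ[OF complex_linear_factors[OF S]]])
  ultimately show ?thesis by (intro that[of "\<lambda>N. p (N + N0)"]) auto
qed

end

section \<open>Representation of A by the canonical product\<close>

locale regular_lacunary_de_branges =
  de_branges_spectral E I t \<nu> A + lacunary_sequence I t
  for E :: "complex \<Rightarrow> complex" and I :: "int set" and t \<nu> :: "int \<Rightarrow> real" and A :: "complex \<Rightarrow> complex" +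
  assumes \<nu>_summable: "(\<lambda>n. \<nu> n / (1 + (t n)\<^sup>2)) summable_on I"
    and regular: "regular_data I t \<nu>"
    and poly_mem: "\<And>p :: complex poly. poly p \<in> de_branges E"
begin

definition node_product :: "int \<Rightarrow> complex \<Rightarrow> complex" where
  "node_product k z = of_real (slope k) * zero_product (I - {k}) z"

lemma mult_node_product: "k \<in> I \<Longrightarrow> (z - of_real (t k)) * node_product k z = zero_product I z"
  by (simp add: zero_product_remove[OF order_refl] node_product_def mult_ac)

lemma node_product_holomorphic: "node_product k holomorphic_on UNIV"
  unfolding node_product_def[abs_def] by (intro holomorphic_intros zero_product_holomorphic) auto

lemma zero_product_times_divided_zero:
  assumes k: "k \<in> I"
  shows "node_product k z * A z = zero_product I z * divided_zero A (of_real (t k)) z"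
proof (cases "z = of_real (t k)")
  case True
  then show ?thesis using k by (simp add: zero_product_at_zero)
next
  case False
  have "(z - of_real (t k)) * (node_product k z * A z) = (z - of_real (t k)) * (zero_product I z * divided_zero A (of_real (t k)) z)"
    using mult_node_product[OF k, of z] mult_divided_zero[OF k, of z] by (metis mult.assoc mult.left_commute)
  then show ?thesis using False by simp
qed

text \<open>
  The product of two square summable families: the Fourier coefficients, by Bessel's inequality, and
  \<open>sqrt (\<nu> k) / (1 + \<bar>t k\<bar>)\<close>.
\<close>

lemma coeff_\<nu>_summable:
  assumes F: "F \<in> de_branges E"
  shows "(\<lambda>k. cmod (coeff F k) * sqrt (\<nu> k) / (1 + \<bar>t k\<bar>)) summable_on I"
proof (rule summable_on_comparison_test)
  have "(\<lambda>k. (cmod (coeff F k))\<^sup>2) summable_on I"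
    by (rule nonneg_bdd_above_summable_on) (auto intro!: bdd_aboveI2 bessel F)
  then show "(\<lambda>k. (cmod (coeff F k))\<^sup>2 + \<nu> k / (1 + (t k)\<^sup>2)) summable_on I"
    by (rule summable_on_add[OF _ \<nu>_summable])
  fix k assume k: "k \<in> I"
  have "(1 + (t k)\<^sup>2) \<le> (1 + \<bar>t k\<bar>)\<^sup>2" by (simp add: power2_sum)
  then have "\<nu> k / (1 + \<bar>t k\<bar>)\<^sup>2 \<le> \<nu> k / (1 + (t k)\<^sup>2)"
    using \<nu>_pos[OF k] by (intro divide_left_mono mult_pos_pos) (auto intro: add_pos_nonneg)
  moreover have "cmod (coeff F k) * (sqrt (\<nu> k) / (1 + \<bar>t k\<bar>))
       \<le> (cmod (coeff F k))\<^sup>2 + (sqrt (\<nu> k) / (1 + \<bar>t k\<bar>))\<^sup>2"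
  proof -
    have "x * y \<le> x\<^sup>2 + y\<^sup>2" for x y :: real
      using sum_squares_bound[of x y] zero_le_power2[of x] zero_le_power2[of y] by linarith
    then show ?thesis .
  qed
  moreover have "(sqrt (\<nu> k) / (1 + \<bar>t k\<bar>))\<^sup>2 = \<nu> k / (1 + \<bar>t k\<bar>)\<^sup>2"
    using \<nu>_pos[OF k] by (simp add: power_divide)
  ultimately show "cmod (coeff F k) * sqrt (\<nu> k) / (1 + \<bar>t k\<bar>) \<le> (cmod (coeff F k))\<^sup>2 + \<nu> k / (1 + (t k)\<^sup>2)"
    by simp
  show "0 \<le> cmod (coeff F k) * sqrt (\<nu> k) / (1 + \<bar>t k\<bar>)" using \<nu>_pos[OF k] by simp
qed

lemma norm_node_product_le:
  assumes k: "k \<in> I" and z: "norm z \<le> R" and R: "R \<ge> 1"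
  shows "norm (node_product k z) \<le> zero_majorant I R / (1 + \<bar>t k\<bar>)"
proof -
  have sub: "I - {k} \<subseteq> I" by blast
  have "norm (node_product k z) \<le> \<bar>slope k\<bar> * zero_majorant (I - {k}) (norm z)"
    unfolding node_product_def norm_mult norm_of_real
    by (intro mult_left_mono norm_zero_product_le sub) simp
  also have "\<dots> \<le> \<bar>slope k\<bar> * zero_majorant (I - {k}) R"
    by (intro mult_left_mono zero_majorant_mono sub z) simp_all
  also have "\<dots> = zero_majorant I R / (R + \<bar>t k\<bar>)"
    using zero_majorant_remove[OF order_refl k, of R] R by (simp add: field_simps)
  also have "\<dots> \<le> zero_majorant I R / (1 + \<bar>t k\<bar>)"
    using R by (intro divide_left_mono zero_majorant_nonneg mult_pos_pos) auto
  finally show ?thesis .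
qed

text \<open>
  Dividing the expansion of the constant function \<open>1\<close> by \<open>A\<close> gives a partial fraction
  expansion of \<open>1 / A\<close>; multiplied by the canonical product it defines a zero-free entire
  function of exponential type zero, which therefore is constant.
\<close>

lemma A_canonical_product:
  obtains \<gamma> where "\<And>z. A z = \<gamma> * zero_product I z"
proof -
  define b where "b = (\<lambda>k. coeff (\<lambda>_. 1) k * of_real (sqrt (\<nu> k)))"
  define Q where "Q = (\<lambda>z. \<Sum>\<^sub>\<infinity>k\<in>I. b k * node_product k z)"
  define S where "S = (\<Sum>\<^sub>\<infinity>k\<in>I. norm (b k) / (1 + \<bar>t k\<bar>))"
  have norm_b: "norm (b k) = cmod (coeff (\<lambda>_. 1) k) * sqrt (\<nu> k)" if "k \<in> I" for k
    using \<nu>_pos[OF that] by (simp add: b_def norm_mult)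
  have summ: "(\<lambda>k. norm (b k) / (1 + \<bar>t k\<bar>)) summable_on I"
    using coeff_\<nu>_summable[OF one_mem] by (rule summable_on_cong[THEN iffD1, rotated]) (simp add: norm_b)
  have term_le: "norm (b k * node_product k z) \<le> zero_majorant I R * (norm (b k) / (1 + \<bar>t k\<bar>))"
    if "k \<in> I" "norm z \<le> R" "R \<ge> 1" for k z R
    using mult_left_mono[OF norm_node_product_le[OF that], of "norm (b k)"]
    by (simp add: norm_mult mult_ac)
  have unif: "uniform_limit (cball 0 R) (\<lambda>J z. \<Sum>k\<in>J. b k * node_product k z) Q (finite_subsets_at_top I)"
    if R: "R \<ge> 1" for R
    unfolding Q_def
    by (rule Weierstrass_m_test_general[OF _ summable_on_cmult_right[OF summ]])
       (rule term_le, use R in auto)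
  have lim: "((\<lambda>J. \<Sum>k\<in>J. b k * node_product k z) \<longlongrightarrow> Q z) (finite_subsets_at_top I)" for z
    by (rule tendsto_uniform_limitI[OF unif[of "max 1 (norm z)"]]) auto
  have bot: "finite_subsets_at_top I \<noteq> bot" by (rule finite_subsets_at_top_neq_bot)
  have Q_hol: "Q holomorphic_on UNIV"
  proof -
    have "Q holomorphic_on ball 0 R" if R: "R \<ge> 1" for R
    proof (rule holomorphic_uniform_limit[OF _ unif[OF R] bot])
      have "(\<lambda>z. \<Sum>k\<in>J. b k * node_product k z) holomorphic_on UNIV" for J
        by (intro holomorphic_intros node_product_holomorphic)
      then show "\<forall>\<^sub>F J in finite_subsets_at_top I. continuous_on (cball 0 R) (\<lambda>z. \<Sum>k\<in>J. b k * node_product k z) \<and>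
          (\<lambda>z. \<Sum>k\<in>J. b k * node_product k z) holomorphic_on ball 0 R"
        by (intro always_eventually allI conjI)
           (meson holomorphic_on_imp_continuous_on holomorphic_on_subset subset_UNIV)+
    qed
    then have "Q field_differentiable at z" for z
      by (rule holomorphic_on_imp_differentiable_at[of _ "ball 0 (norm z + 1)"]) auto
    then show ?thesis
      by (simp add: field_differentiable_at_within holomorphic_onI)
  qed
  have Q_bound: "norm (Q z) \<le> S * zero_majorant I R" if R: "R \<ge> 1" "norm z \<le> R" for z R
  proof -
    have "norm (\<Sum>k\<in>J. b k * node_product k z) \<le> S * zero_majorant I R" if J: "finite J" "J \<subseteq> I" for J
    proof -
      have "norm (\<Sum>k\<in>J. b k * node_product k z) \<le> (\<Sum>k\<in>J. zero_majorant I R * (norm (b k) / (1 + \<bar>t k\<bar>)))"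
        by (rule sum_norm_le) (rule term_le, use J R in auto)
      also have "\<dots> = zero_majorant I R * (\<Sum>k\<in>J. norm (b k) / (1 + \<bar>t k\<bar>))"
        by (simp add: sum_distrib_left)
      also have "\<dots> \<le> zero_majorant I R * S" unfolding S_def
        by (intro mult_left_mono finite_sum_le_infsum summ J zero_majorant_nonneg) (use R in auto)
      finally show ?thesis by (simp add: mult.commute)
    qed
    then have "\<forall>\<^sub>F J in finite_subsets_at_top I. norm (\<Sum>k\<in>J. b k * node_product k z) \<le> S * zero_majorant I R"
      by (intro eventually_finite_subsets_at_top_weakI)
    then show ?thesis by (rule tendsto_upperbound[OF tendsto_norm[OF lim] _ bot])
  qed
  \<comment> \<open>Termwise, \<open>A\<close> times a node product is the canonical product times a divided zero; the divided
    zeros sum to the constant \<open>1\<close>.\<close>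
  have QA: "Q z * A z = zero_product I z" for z
  proof (rule tendsto_unique[OF bot])
    show "((\<lambda>J. (\<Sum>k\<in>J. b k * node_product k z) * A z) \<longlongrightarrow> Q z * A z) (finite_subsets_at_top I)"
      by (intro tendsto_intros lim)
    have "((\<lambda>J. zero_product I z * (\<Sum>k\<in>J. coeff (\<lambda>_. 1) k * (of_real (sqrt (\<nu> k)) * divided_zero A (of_real (t k)) z)))
        \<longlongrightarrow> zero_product I z * 1) (finite_subsets_at_top I)"
      by (intro tendsto_mult_left expansion_pointwise[OF one_mem])
    moreover have "\<forall>\<^sub>F J in finite_subsets_at_top I.
        zero_product I z * (\<Sum>k\<in>J. coeff (\<lambda>_. 1) k * (of_real (sqrt (\<nu> k)) * divided_zero A (of_real (t k)) z))
        = (\<Sum>k\<in>J. b k * node_product k z) * A z"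
    proof (rule eventually_finite_subsets_at_top_weakI)
      fix J assume "J \<subseteq> I"
      then show "zero_product I z * (\<Sum>k\<in>J. coeff (\<lambda>_. 1) k * (of_real (sqrt (\<nu> k)) * divided_zero A (of_real (t k)) z))
        = (\<Sum>k\<in>J. b k * node_product k z) * A z"
        unfolding sum_distrib_left sum_distrib_right b_def
        using zero_product_times_divided_zero
        by (intro sum.cong refl) (simp add: subset_iff mult_ac)
    qed
    ultimately show "((\<lambda>J. (\<Sum>k\<in>J. b k * node_product k z) * A z) \<longlongrightarrow> zero_product I z) (finite_subsets_at_top I)"
      by (simp add: Lim_transform_eventually)
  qed
  have Q_nonzero: "Q z \<noteq> 0" for z
  proof (cases "z \<in> (\<lambda>n. of_real (t n)) ` I")
    case False
    then have "zero_product I z \<noteq> 0" by (intro zero_product_nonzero) auto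
    then show ?thesis using QA[of z] by auto
  next
    case True
    then obtain n where n: "n \<in> I" and z: "z = of_real (t n)" by blast
    \<comment> \<open>At \<open>t n\<close> only the \<open>n\<close>-th term survives; its coefficient is nonzero as \<open>1\<close> does not vanish at \<open>t n\<close>.\<close>
    have other: "node_product k z = 0" if "k \<noteq> n" for k
      unfolding node_product_def z using that n by (simp add: zero_product_at_zero)
    have "Q z = b n * node_product n z"
    proof (rule tendsto_unique[OF bot lim], rule tendsto_eventually)
      have "(\<Sum>k\<in>J. b k * node_product k z) = b n * node_product n z" if "finite J" "{n} \<subseteq> J" for J
      proof -
        have "(\<Sum>k\<in>J. b k * node_product k z) = (\<Sum>k\<in>{n}. b k * node_product k z)"
          using that other by (intro sum.mono_neutral_right) auto
        then show ?thesis by simp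
      qed
      then show "\<forall>\<^sub>F J in finite_subsets_at_top I. (\<Sum>k\<in>J. b k * node_product k z) = b n * node_product n z"
        unfolding eventually_finite_subsets_at_top using n by (intro exI[of _ "{n}"]) auto
    qed
    moreover have "b n \<noteq> 0" using value_at_t[OF one_mem n] by (auto simp: b_def)
    moreover have "zero_product (I - {n}) z \<noteq> 0"
      unfolding z by (rule zero_product_nonzero) (use n t_eq_iff in auto)
    then have "node_product n z \<noteq> 0" by (simp add: node_product_def)
    ultimately show ?thesis by simp
  qed
  obtain h where h: "h holomorphic_on UNIV" "\<And>z. Q z = exp (h z)"
    using contractible_imp_holomorphic_log[OF Q_hol] Q_nonzero contractible_UNIV by (metis UNIV_I)
  have "h z = h 0" for z
  proof (rule entire_sublinear_Re_constant[OF h(1)])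
    fix \<epsilon> :: real assume \<epsilon>: "\<epsilon> > 0"
    obtain K where K: "\<And>r. r \<ge> 0 \<Longrightarrow> zero_majorant I r \<le> K * exp (\<epsilon> * r)"
      unfolding zero_majorant_def
      using linear_product_growth[OF majorant_linear_factors[OF order_refl] const_coeff_nonneg _ \<epsilon>]
      by (metis abs_ge_zero)
    have "Re (h z) \<le> ln (max 1 (S * K)) + \<epsilon> + \<epsilon> * norm z" for z
    proof -
      let ?R = "max 1 (norm z)"
      have S0: "S \<ge> 0" unfolding S_def by (rule infsum_nonneg) auto
      have "exp (Re (h z)) = norm (Q z)" by (simp add: h(2))
      also have "\<dots> \<le> S * zero_majorant I ?R" by (rule Q_bound) auto
      also have "\<dots> \<le> S * (K * exp (\<epsilon> * ?R))" by (intro mult_left_mono K S0) auto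
      also have "\<dots> = (S * K) * exp (\<epsilon> * ?R)" by simp
      also have "\<dots> \<le> max 1 (S * K) * exp (\<epsilon> * (1 + norm z))"
        using \<epsilon> by (intro mult_mono) auto
      also have "\<dots> = exp (ln (max 1 (S * K)) + \<epsilon> * (1 + norm z))"
        by (simp add: exp_add)
      finally show ?thesis by (simp add: algebra_simps)
    qed
    then show "\<exists>K. \<forall>z. Re (h z) \<le> K + \<epsilon> * norm z" by blast
  qed
  then have "Q z = Q 0" for z using h(2) by metis
  then have "A z = 1 / Q 0 * zero_product I z" for z
    using QA[of z] Q_nonzero[of 0] by (metis nonzero_mult_div_cancel_left times_divide_eq_left mult_1)
  then show ?thesis by (rule that)
qed

text \<open>
  At \<open>z = t k\<close> the divided zero is \<open>deriv A (t k)\<close>, which the product rule evaluates.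
\<close>

lemma divided_zero_node_product:
  obtains \<gamma> where "\<And>k z. k \<in> I \<Longrightarrow> divided_zero A (of_real (t k)) z = \<gamma> * node_product k z"
proof -
  obtain \<gamma> where \<gamma>: "\<And>z. A z = \<gamma> * zero_product I z" using A_canonical_product by blast
  have "divided_zero A (of_real (t k)) z = \<gamma> * node_product k z" if k: "k \<in> I" for k z
  proof (cases "z = of_real (t k)")
    case False
    then show ?thesis using \<gamma>[of z] mult_node_product[OF k, of z]
      by (simp add: divided_zero_def field_simps)
  next
    case True
    have A_eq: "A = (\<lambda>w. (w - of_real (t k)) * (\<gamma> * node_product k w))"
      using \<gamma> mult_node_product[OF k] by (auto simp: fun_eq_iff mult_ac)
    have "(node_product k has_field_derivative deriv (node_product k) z) (at z)"
      using holomorphic_derivI[OF node_product_holomorphic] by simp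
    then have "(A has_field_derivative (1 - 0) * (\<gamma> * node_product k z)
        + \<gamma> * deriv (node_product k) z * (z - of_real (t k))) (at z)"
      unfolding A_eq by (intro DERIV_mult DERIV_cmult DERIV_diff DERIV_ident DERIV_const)
    then have "deriv A z = \<gamma> * node_product k z" using True by (intro DERIV_imp_deriv) simp
    then show ?thesis using True by (simp add: divided_zero_def)
  qed
  then show ?thesis by (rule that)
qed

end

section \<open>The maximal estimate\<close>

lemma (in de_branges_with_constants) de_branges_norm_scale:
  "de_branges_norm E (\<lambda>z. a * F z) = cmod a * de_branges_norm E F"
proof -
  have "(\<lambda>x. (cmod (a * F (of_real x) / E (of_real x)))\<^sup>2)
      = (\<lambda>x. (cmod a)\<^sup>2 * (cmod (F (of_real x) / E (of_real x)))\<^sup>2)"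
    by (simp add: norm_mult norm_divide power_mult_distrib power_divide)
  then show ?thesis by (simp add: de_branges_norm_def real_sqrt_mult)
qed

lemma (in de_branges_with_constants) de_branges_norm_add_square_le:
  assumes F: "F \<in> de_branges E" and G: "G \<in> de_branges E"
  shows "(de_branges_norm E (\<lambda>z. F z + G z))\<^sup>2 \<le> 2 * (de_branges_norm E F)\<^sup>2 + 2 * (de_branges_norm E G)\<^sup>2"
proof -
  have sq: "(de_branges_norm E F)\<^sup>2 = (\<integral>t. (cmod (F (of_real t) / E (of_real t)))\<^sup>2 \<partial>lborel)" for F
    by (simp add: de_branges_norm_def)
  have FG: "(\<lambda>z. F z + G z) \<in> de_branges E"
    using de_branges_lincomb[OF F G, of 1 1] by simp
  have "(\<integral>t. (cmod ((F (of_real t) + G (of_real t)) / E (of_real t)))\<^sup>2 \<partial>lborel)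
      \<le> (\<integral>t. 2 * (cmod (F (of_real t) / E (of_real t)))\<^sup>2 + 2 * (cmod (G (of_real t) / E (of_real t)))\<^sup>2 \<partial>lborel)"
  proof (rule integral_mono)
    show "integrable lborel (\<lambda>t. 2 * (cmod (F (of_real t) / E (of_real t)))\<^sup>2 + 2 * (cmod (G (of_real t) / E (of_real t)))\<^sup>2)"
      by (intro Bochner_Integration.integrable_add integrable_mult_right boundary_integrable F G)
    show "integrable lborel (\<lambda>t. (cmod ((F (of_real t) + G (of_real t)) / E (of_real t)))\<^sup>2)"
      by (rule boundary_integrable[OF FG])
    show "(cmod ((F (of_real t) + G (of_real t)) / E (of_real t)))\<^sup>2
        \<le> 2 * (cmod (F (of_real t) / E (of_real t)))\<^sup>2 + 2 * (cmod (G (of_real t) / E (of_real t)))\<^sup>2" for t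
      unfolding add_divide_distrib by (rule cmod_square_add_le)
  qed
  also have "\<dots> = 2 * (\<integral>t. (cmod (F (of_real t) / E (of_real t)))\<^sup>2 \<partial>lborel)
      + 2 * (\<integral>t. (cmod (G (of_real t) / E (of_real t)))\<^sup>2 \<partial>lborel)"
    using boundary_integrable[OF F] boundary_integrable[OF G] by simp
  finally show ?thesis unfolding sq .
qed

lemma summable_on_small_tails:
  fixes h :: "'a \<Rightarrow> real"
  assumes summ: "h summable_on I" and \<epsilon>: "\<epsilon> > 0"
  obtains J0 where "finite J0" "J0 \<subseteq> I"
    "\<And>J. finite J \<Longrightarrow> J \<subseteq> I - J0 \<Longrightarrow> sum h J \<le> \<epsilon>"
proof -
  have "(sum h \<longlongrightarrow> infsum h I) (finite_subsets_at_top I)"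
    by (rule infsum_tendsto[OF summ])
  then have "\<forall>\<^sub>F J in finite_subsets_at_top I. dist (sum h J) (infsum h I) < \<epsilon> / 2"
    by (rule tendstoD) (use \<epsilon> in simp)
  then obtain J0 where J0: "finite J0" "J0 \<subseteq> I"
    and close': "\<forall>J. finite J \<and> J0 \<subseteq> J \<and> J \<subseteq> I \<longrightarrow> dist (sum h J) (infsum h I) < \<epsilon> / 2"
    unfolding eventually_finite_subsets_at_top by (elim exE conjE)
  have close: "dist (sum h J) (infsum h I) < \<epsilon> / 2" if "finite J" "J0 \<subseteq> J" "J \<subseteq> I" for J
    using close' that by simp
  have "sum h J \<le> \<epsilon>" if J: "finite J" "J \<subseteq> I - J0" for J
  proof -
    have "sum h (J \<union> J0) = sum h J + sum h J0"
      using J J0 by (intro sum.union_disjoint) auto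
    moreover have "dist (sum h (J \<union> J0)) (infsum h I) < \<epsilon> / 2" by (rule close) (use J J0 in auto)
    moreover have "dist (sum h J0) (infsum h I) < \<epsilon> / 2" by (rule close) (use J0 in auto)
    ultimately show ?thesis unfolding dist_real_def by linarith
  qed
  with J0 show ?thesis by (rule that)
qed

context regular_lacunary_de_branges
begin

text \<open>
  The majorants of the divided zeros increase with the radius, so one value at \<open>\<bar>t n\<bar>\<close> controls a
  whole disc, and they also dominate the polynomial partial products. At the radii \<open>\<bar>t n\<bar>\<close> they are
  comparable to \<open>deriv A (t n)\<close> up to the overlap.
\<close>

lemma basis_majorant:
  obtains \<beta> :: "int \<Rightarrow> real \<Rightarrow> real" and C where "C > 0"
    "\<And>k z. k \<in> I \<Longrightarrow> norm (divided_zero A (of_real (t k)) z) \<le> \<beta> k (norm z)"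
    "\<And>k r s. k \<in> I \<Longrightarrow> 0 \<le> r \<Longrightarrow> r \<le> s \<Longrightarrow> \<beta> k r \<le> \<beta> k s"
    "\<And>n k. n \<in> I \<Longrightarrow> k \<in> I \<Longrightarrow> \<beta> k \<bar>t n\<bar> \<le> C * overlap t n k * norm (deriv A (of_real (t n)))"
    "\<And>k. k \<in> I \<Longrightarrow> \<exists>p :: nat \<Rightarrow> complex poly.
        (\<forall>z. (\<lambda>N. poly (p N) z) \<longlonglongrightarrow> divided_zero A (of_real (t k)) z) \<and>
        (\<forall>N z. norm (poly (p N) z) \<le> \<beta> k (norm z))"
proof -
  obtain \<gamma> where \<gamma>: "\<And>k z. k \<in> I \<Longrightarrow> divided_zero A (of_real (t k)) z = \<gamma> * node_product k z"
    using divided_zero_node_product by blast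
  obtain C where C: "C > 0" and sep:
    "\<And>n. n \<in> I \<Longrightarrow> zero_majorant (I - {n}) \<bar>t n\<bar> \<le> C * norm (zero_product (I - {n}) (of_real (t n)))"
    using zero_majorant_le_zero_product by blast
  define \<beta> where "\<beta> = (\<lambda>k r. norm \<gamma> * (\<bar>slope k\<bar> * zero_majorant (I - {k}) r))"
  have sub: "I - {k} \<subseteq> I" for k by blast
  show ?thesis
  proof (rule that[OF C])
    show "norm (divided_zero A (of_real (t k)) z) \<le> \<beta> k (norm z)" if "k \<in> I" for k z
      unfolding \<gamma>[OF that] \<beta>_def node_product_def norm_mult norm_of_real
      by (intro mult_left_mono norm_zero_product_le sub) simp_all
    show "\<beta> k r \<le> \<beta> k s" if "k \<in> I" "0 \<le> r" "r \<le> s" for k r s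
      unfolding \<beta>_def by (intro mult_left_mono zero_majorant_mono sub that) simp_all
    show "\<beta> k \<bar>t n\<bar> \<le> C * overlap t n k * norm (deriv A (of_real (t n)))" if n: "n \<in> I" and k: "k \<in> I" for n k
    proof -
      have d: "deriv A (of_real (t n)) = \<gamma> * node_product n (of_real (t n))"
        using \<gamma>[OF n, of "of_real (t n)"] by (simp add: divided_zero_def)
      have "\<beta> k \<bar>t n\<bar> = norm \<gamma> * overlap t n k * \<bar>slope n\<bar> * zero_majorant (I - {n}) \<bar>t n\<bar>"
        unfolding \<beta>_def zero_majorant_overlap[OF n k] by simp
      also have "\<dots> \<le> norm \<gamma> * overlap t n k * \<bar>slope n\<bar> * (C * norm (zero_product (I - {n}) (of_real (t n))))"
        by (intro mult_left_mono sep n mult_nonneg_nonneg overlap_nonneg) auto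
      also have "\<dots> = C * overlap t n k * norm (deriv A (of_real (t n)))"
        unfolding d node_product_def by (simp add: norm_mult)
      finally show ?thesis .
    qed
    show "\<exists>p :: nat \<Rightarrow> complex poly.
        (\<forall>z. (\<lambda>N. poly (p N) z) \<longlonglongrightarrow> divided_zero A (of_real (t k)) z) \<and>
        (\<forall>N z. norm (poly (p N) z) \<le> \<beta> k (norm z))" if k: "k \<in> I" for k
    proof -
      obtain p :: "nat \<Rightarrow> complex poly" where p: "\<And>z. (\<lambda>N. poly (p N) z) \<longlonglongrightarrow> zero_product (I - {k}) z"
          "\<And>N z. norm (poly (p N) z) \<le> zero_majorant (I - {k}) (norm z)"
        using zero_product_polynomial_approx[OF sub] by blast
      let ?q = "\<lambda>N. smult (\<gamma> * of_real (slope k)) (p N)"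
      have "(\<lambda>N. poly (?q N) z) \<longlonglongrightarrow> divided_zero A (of_real (t k)) z" for z
        unfolding \<gamma>[OF k] node_product_def poly_smult mult.assoc[symmetric]
        by (intro tendsto_mult_left p)
      moreover have "norm (poly (?q N) z) \<le> \<beta> k (norm z)" for N z
        unfolding \<beta>_def poly_smult norm_mult norm_of_real mult.assoc
        by (intro mult_left_mono p) simp_all
      ultimately show ?thesis by (intro exI[of _ ?q]) simp
    qed
  qed
qed

text \<open>
  The finite sections are bounded by the infinite sum in the regularity condition because that sum
  converges; a divergent one would have the value \<open>0\<close>.
\<close>

lemma regular_finite_sections:
  obtains c where "c \<ge> 1"
    "\<And>n J. n \<in> I \<Longrightarrow> finite J \<Longrightarrow> J \<subseteq> I \<Longrightarrow> (\<Sum>k\<in>{k\<in>J. \<bar>t k\<bar> \<le> \<bar>t n\<bar>}. \<nu> k) \<le> c * \<nu> n"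
    "\<And>n J. n \<in> I \<Longrightarrow> finite J \<Longrightarrow> J \<subseteq> I \<Longrightarrow>
       (t n)\<^sup>2 * (\<Sum>k\<in>{k\<in>J. \<bar>t k\<bar> > \<bar>t n\<bar>}. \<nu> k / (t k)\<^sup>2) \<le> c * \<nu> n"
proof -
  obtain c where c: "c > 0" and reg: "\<And>n. n \<in> I \<Longrightarrow>
        (\<Sum>k\<in>{k\<in>I. \<bar>t k\<bar> \<le> \<bar>t n\<bar>}. \<nu> k) +
        (t n)\<^sup>2 * (\<Sum>\<^sub>\<infinity>k\<in>{k\<in>I. \<bar>t k\<bar> > \<bar>t n\<bar>}. \<nu> k / (t k)\<^sup>2) \<le> c * \<nu> n"
    using regular unfolding regular_data_def by blast
  have le_max: "c * \<nu> n \<le> max 1 c * \<nu> n" if "n \<in> I" for n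
    using \<nu>_pos[OF that] by (intro mult_right_mono) auto
  have nn1: "(\<Sum>k\<in>{k\<in>I. \<bar>t k\<bar> \<le> \<bar>t n\<bar>}. \<nu> k) \<ge> 0" for n
    by (rule sum_nonneg) (auto intro: less_imp_le \<nu>_pos)
  have nn2: "(t n)\<^sup>2 * (\<Sum>\<^sub>\<infinity>k\<in>{k\<in>I. \<bar>t k\<bar> > \<bar>t n\<bar>}. \<nu> k / (t k)\<^sup>2) \<ge> 0" for n
    by (intro mult_nonneg_nonneg infsum_nonneg divide_nonneg_nonneg) (auto intro: less_imp_le \<nu>_pos)
  show ?thesis
  proof (rule that[of "max 1 c"])
    fix n J assume n: "n \<in> I" and J: "finite J" "J \<subseteq> I"
    have "(\<Sum>k\<in>{k\<in>J. \<bar>t k\<bar> \<le> \<bar>t n\<bar>}. \<nu> k) \<le> (\<Sum>k\<in>{k\<in>I. \<bar>t k\<bar> \<le> \<bar>t n\<bar>}. \<nu> k)"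
      by (rule sum_mono2[OF finite_abs_le]) (use J \<nu>_pos in \<open>auto intro: less_imp_le\<close>)
    then show "(\<Sum>k\<in>{k\<in>J. \<bar>t k\<bar> \<le> \<bar>t n\<bar>}. \<nu> k) \<le> max 1 c * \<nu> n"
      using reg[OF n] nn2[of n] le_max[OF n] by linarith
    show "(t n)\<^sup>2 * (\<Sum>k\<in>{k\<in>J. \<bar>t k\<bar> > \<bar>t n\<bar>}. \<nu> k / (t k)\<^sup>2) \<le> max 1 c * \<nu> n"
    proof (cases "t n = 0")
      case True
      then show ?thesis using \<nu>_pos[OF n] by simp
    next
      case False
      have summ: "(\<lambda>k. \<nu> k / (t k)\<^sup>2) summable_on {k\<in>I. \<bar>t k\<bar> > \<bar>t n\<bar>}"
      proof (rule summable_on_comparison_test)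
        have "(\<lambda>k. \<nu> k / (1 + (t k)\<^sup>2)) summable_on {k\<in>I. \<bar>t k\<bar> > \<bar>t n\<bar>}"
          by (rule summable_on_subset_banach[OF \<nu>_summable]) auto
        then show "(\<lambda>k. (1 + 1 / (t n)\<^sup>2) * (\<nu> k / (1 + (t k)\<^sup>2))) summable_on {k\<in>I. \<bar>t k\<bar> > \<bar>t n\<bar>}"
          by (rule summable_on_cmult_right)
        fix k assume k: "k \<in> {k\<in>I. \<bar>t k\<bar> > \<bar>t n\<bar>}"
        then have tk: "t k \<noteq> 0" and nk: "\<nu> k > 0" using \<nu>_pos by auto
        have "(t n)\<^sup>2 \<le> (t k)\<^sup>2" using k by (intro abs_le_square_iff[THEN iffD1]) auto
        then have "1 / (t k)\<^sup>2 \<le> 1 / (t n)\<^sup>2" using False tk by (intro divide_left_mono) auto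
        then have "(1 + 1 / (t k)\<^sup>2) * (\<nu> k / (1 + (t k)\<^sup>2)) \<le> (1 + 1 / (t n)\<^sup>2) * (\<nu> k / (1 + (t k)\<^sup>2))"
          using nk by (intro mult_right_mono) (auto intro: add_nonneg_nonneg)
        moreover have "(1 + 1 / (t k)\<^sup>2) * (\<nu> k / (1 + (t k)\<^sup>2)) = \<nu> k / (t k)\<^sup>2"
        proof -
          have "1 + 1 / (t k)\<^sup>2 = (1 + (t k)\<^sup>2) / (t k)\<^sup>2" using tk by (simp add: field_simps)
          moreover have "1 + (t k)\<^sup>2 \<noteq> 0" using zero_le_power2[of "t k"] by linarith
          ultimately show ?thesis by simp
        qed
        ultimately show "\<nu> k / (t k)\<^sup>2 \<le> (1 + 1 / (t n)\<^sup>2) * (\<nu> k / (1 + (t k)\<^sup>2))" by simp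
        show "0 \<le> \<nu> k / (t k)\<^sup>2" using nk by simp
      qed
      have "(\<Sum>k\<in>{k\<in>J. \<bar>t k\<bar> > \<bar>t n\<bar>}. \<nu> k / (t k)\<^sup>2) \<le> (\<Sum>\<^sub>\<infinity>k\<in>{k\<in>I. \<bar>t k\<bar> > \<bar>t n\<bar>}. \<nu> k / (t k)\<^sup>2)"
        by (rule finite_sum_le_infsum[OF summ]) (use J \<nu>_pos in \<open>auto intro!: divide_nonneg_nonneg intro: less_imp_le\<close>)
      then have "(t n)\<^sup>2 * (\<Sum>k\<in>{k\<in>J. \<bar>t k\<bar> > \<bar>t n\<bar>}. \<nu> k / (t k)\<^sup>2)
          \<le> (t n)\<^sup>2 * (\<Sum>\<^sub>\<infinity>k\<in>{k\<in>I. \<bar>t k\<bar> > \<bar>t n\<bar>}. \<nu> k / (t k)\<^sup>2)"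
        by (rule mult_left_mono) simp
      then show ?thesis using reg[OF n] nn1[of n] le_max[OF n] by linarith
    qed
  qed simp
qed

definition weight :: "int \<Rightarrow> real" where
  "weight n = 1 / (sqrt (\<nu> n) * norm (deriv A (of_real (t n))))"

lemma weight_pos: "n \<in> I \<Longrightarrow> weight n > 0"
  using \<nu>_pos deriv_A_nonzero by (simp add: weight_def)

lemma cmod_coeff_weight: "F \<in> de_branges E \<Longrightarrow> n \<in> I \<Longrightarrow> cmod (coeff F n) = weight n * cmod (F (of_real (t n)))"
  by (simp add: cmod_coeff weight_def)

lemma maximal_matrix_bound:
  assumes \<beta>_le: "\<And>n k. n \<in> I \<Longrightarrow> k \<in> I \<Longrightarrow> \<beta> k \<bar>t n\<bar> \<le> C * overlap t n k * norm (deriv A (of_real (t n)))"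
    and \<beta>_nn: "\<And>n k. n \<in> I \<Longrightarrow> k \<in> I \<Longrightarrow> \<beta> k \<bar>t n\<bar> \<ge> 0" and C: "C > 0"
  obtains D where "D \<ge> 0"
    "\<And>b J K. finite J \<Longrightarrow> J \<subseteq> I \<Longrightarrow> finite K \<Longrightarrow> K \<subseteq> I \<Longrightarrow> (\<And>k. k \<in> K \<Longrightarrow> b k \<ge> 0) \<Longrightarrow>
       (\<Sum>n\<in>J. (weight n * (\<Sum>k\<in>K. b k * sqrt (\<nu> k) * \<beta> k \<bar>t n\<bar>))\<^sup>2) \<le> D\<^sup>2 * (\<Sum>k\<in>K. (b k)\<^sup>2)"
proof -
  obtain c where c: "c \<ge> 1" and
    regA: "\<And>n J. n \<in> I \<Longrightarrow> finite J \<Longrightarrow> J \<subseteq> I \<Longrightarrow> (\<Sum>k\<in>{k\<in>J. \<bar>t k\<bar> \<le> \<bar>t n\<bar>}. \<nu> k) \<le> c * \<nu> n" and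
    regB: "\<And>n J. n \<in> I \<Longrightarrow> finite J \<Longrightarrow> J \<subseteq> I \<Longrightarrow>
       (t n)\<^sup>2 * (\<Sum>k\<in>{k\<in>J. \<bar>t k\<bar> > \<bar>t n\<bar>}. \<nu> k / (t k)\<^sup>2) \<le> c * \<nu> n"
    using regular_finite_sections by blast
  define D where "D = C * sqrt (368 * c ^ 3)"
  have D2: "D\<^sup>2 = C\<^sup>2 * (368 * c ^ 3)" using c by (simp add: D_def power_mult_distrib)
  show ?thesis
  proof (rule that[of D])
    show "D \<ge> 0" using C c by (simp add: D_def)
    fix b :: "int \<Rightarrow> real" and J K
    assume J: "finite J" "J \<subseteq> I" and K: "finite K" "K \<subseteq> I" and b: "\<And>k. k \<in> K \<Longrightarrow> b k \<ge> 0"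
    define L where "L = J \<union> K"
    define x where "x = (\<lambda>k. if k \<in> K then b k * sqrt (\<nu> k) else 0)"
    have L: "finite L" "L \<subseteq> I" "K \<subseteq> L" "J \<subseteq> L" using J K by (auto simp: L_def)
    have x0: "x k \<ge> 0" if "k \<in> L" for k using b L that \<nu>_pos[of k] by (auto simp: x_def)
    let ?row = "\<lambda>n. \<Sum>k\<in>L. x k * overlap t n k"
    have row: "(weight n * (\<Sum>k\<in>K. b k * sqrt (\<nu> k) * \<beta> k \<bar>t n\<bar>))\<^sup>2 \<le> C\<^sup>2 * ((?row n)\<^sup>2 / \<nu> n)" if n: "n \<in> J" for n
    proof -
      have nI: "n \<in> I" using n J by blast
      have "(\<Sum>k\<in>K. b k * sqrt (\<nu> k) * \<beta> k \<bar>t n\<bar>)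
          \<le> (\<Sum>k\<in>K. b k * sqrt (\<nu> k) * (C * overlap t n k * norm (deriv A (of_real (t n)))))"
        using K nI by (intro sum_mono mult_left_mono \<beta>_le mult_nonneg_nonneg b)
          (auto intro!: less_imp_le \<nu>_pos)
      also have "\<dots> = C * norm (deriv A (of_real (t n))) * (\<Sum>k\<in>K. b k * sqrt (\<nu> k) * overlap t n k)"
        by (simp add: sum_distrib_left mult_ac)
      also have "(\<Sum>k\<in>K. b k * sqrt (\<nu> k) * overlap t n k) = ?row n"
      proof -
        have "?row n = (\<Sum>k\<in>K. x k * overlap t n k)"
          by (rule sum.mono_neutral_right) (use L in \<open>auto simp: x_def\<close>)
        also have "\<dots> = (\<Sum>k\<in>K. b k * sqrt (\<nu> k) * overlap t n k)"
          by (rule sum.cong) (simp_all add: x_def)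
        finally show ?thesis by simp
      qed
      finally have "weight n * (\<Sum>k\<in>K. b k * sqrt (\<nu> k) * \<beta> k \<bar>t n\<bar>)
          \<le> weight n * (C * norm (deriv A (of_real (t n))) * ?row n)"
        by (rule mult_left_mono) (use weight_pos[OF nI] in simp)
      also have "\<dots> = C * (?row n / sqrt (\<nu> n))"
        using deriv_A_nonzero[OF nI] by (simp add: weight_def)
      finally have "(weight n * (\<Sum>k\<in>K. b k * sqrt (\<nu> k) * \<beta> k \<bar>t n\<bar>))\<^sup>2 \<le> (C * (?row n / sqrt (\<nu> n)))\<^sup>2"
        using K \<beta>_nn[OF nI] weight_pos[OF nI]
        by (intro power_mono mult_nonneg_nonneg sum_nonneg b) (auto simp: subset_iff less_imp_le \<nu>_pos)
      also have "\<dots> = C\<^sup>2 * ((?row n)\<^sup>2 / \<nu> n)"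
        using \<nu>_pos[OF nI] by (simp add: power_mult_distrib power_divide)
      finally show ?thesis .
    qed
    have "(\<Sum>n\<in>J. (weight n * (\<Sum>k\<in>K. b k * sqrt (\<nu> k) * \<beta> k \<bar>t n\<bar>))\<^sup>2) \<le> (\<Sum>n\<in>J. C\<^sup>2 * ((?row n)\<^sup>2 / \<nu> n))"
      by (rule sum_mono) (rule row)
    also have "\<dots> \<le> (\<Sum>n\<in>L. C\<^sup>2 * ((?row n)\<^sup>2 / \<nu> n))"
      by (rule sum_mono2) (use L in \<open>auto intro!: mult_nonneg_nonneg divide_nonneg_nonneg intro: less_imp_le \<nu>_pos\<close>)
    also have "\<dots> = C\<^sup>2 * (\<Sum>n\<in>L. (?row n)\<^sup>2 / \<nu> n)" by (simp add: sum_distrib_left)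
    also have "\<dots> \<le> C\<^sup>2 * (368 * c ^ 3 * (\<Sum>k\<in>L. (x k)\<^sup>2 / \<nu> k))"
    proof (intro mult_left_mono regular_data_l2_bound)
      show "inj_on t L" by (rule inj_on_subset[OF t_inj L(2)])
    qed (use L c x0 regA[OF _ L(1,2)] regB[OF _ L(1,2)] \<nu>_pos in auto)
    also have "(\<Sum>k\<in>L. (x k)\<^sup>2 / \<nu> k) = (\<Sum>k\<in>K. (b k)\<^sup>2)"
    proof -
      have "(\<Sum>k\<in>L. (x k)\<^sup>2 / \<nu> k) = (\<Sum>k\<in>K. (x k)\<^sup>2 / \<nu> k)"
        by (rule sum.mono_neutral_right) (use L in \<open>auto simp: x_def\<close>)
      also have "\<dots> = (\<Sum>k\<in>K. (b k)\<^sup>2)"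
      proof (rule sum.cong)
        fix k assume "k \<in> K"
        then show "(x k)\<^sup>2 / \<nu> k = (b k)\<^sup>2" using \<nu>_pos[of k] K by (auto simp: x_def power_mult_distrib)
      qed simp
      finally show ?thesis .
    qed
    finally show "(\<Sum>n\<in>J. (weight n * (\<Sum>k\<in>K. b k * sqrt (\<nu> k) * \<beta> k \<bar>t n\<bar>))\<^sup>2) \<le> D\<^sup>2 * (\<Sum>k\<in>K. (b k)\<^sup>2)"
      by (simp add: D2 mult_ac)
  qed
qed

text \<open>
  The sum \<open>s n\<close> of the moduli of the Fourier coefficients times \<open>sqrt (\<nu> k)\<close> and the majorants at \<open>\<bar>t n\<bar>\<close> dominates \<open>F\<close>
  on the disc of radius \<open>\<bar>t n\<bar>\<close>, and the matrix bound controls it. Applied to a single basis function,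
  the same bound provides a dominating sequence, with which partial products converge to that basis
  function in norm.
\<close>

lemma maximal_function_bound:
  obtains D where "D \<ge> 0"
    "\<And>F. F \<in> de_branges E \<Longrightarrow> \<exists>s :: int \<Rightarrow> real. (\<forall>n\<in>I. \<forall>z. norm z \<le> \<bar>t n\<bar> \<longrightarrow> norm (F z) \<le> s n) \<and>
       (\<forall>J. finite J \<longrightarrow> J \<subseteq> I \<longrightarrow> (\<Sum>n\<in>J. (weight n * s n)\<^sup>2) \<le> (D * de_branges_norm E F)\<^sup>2)"
    "\<And>k \<epsilon>. k \<in> I \<Longrightarrow> \<epsilon> > 0 \<Longrightarrow> \<exists>p. de_branges_norm E
        (\<lambda>z. of_real (sqrt (\<nu> k)) * divided_zero A (of_real (t k)) z - poly p z) \<le> \<epsilon>"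
proof -
  obtain \<beta> C where C: "C > 0"
    and le_\<beta>: "\<And>k z. k \<in> I \<Longrightarrow> norm (divided_zero A (of_real (t k)) z) \<le> \<beta> k (norm z)"
    and \<beta>_mono: "\<And>k r s. k \<in> I \<Longrightarrow> 0 \<le> r \<Longrightarrow> r \<le> s \<Longrightarrow> \<beta> k r \<le> \<beta> k s"
    and \<beta>_le: "\<And>n k. n \<in> I \<Longrightarrow> k \<in> I \<Longrightarrow> \<beta> k \<bar>t n\<bar> \<le> C * overlap t n k * norm (deriv A (of_real (t n)))"
    and approx: "\<And>k. k \<in> I \<Longrightarrow> \<exists>p :: nat \<Rightarrow> complex poly.
        (\<forall>z. (\<lambda>N. poly (p N) z) \<longlonglongrightarrow> divided_zero A (of_real (t k)) z) \<and>
        (\<forall>N z. norm (poly (p N) z) \<le> \<beta> k (norm z))"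
    by (rule basis_majorant) (rule that)
  have \<beta>_nn: "\<beta> k \<bar>t n\<bar> \<ge> 0" if "n \<in> I" "k \<in> I" for n k
    using order_trans[OF norm_ge_zero le_\<beta>[OF that(2), of "of_real (t n)"]] by simp
  obtain D where D: "D \<ge> 0" and matrix:
    "\<And>b J K. finite J \<Longrightarrow> J \<subseteq> I \<Longrightarrow> finite K \<Longrightarrow> K \<subseteq> I \<Longrightarrow> (\<And>k. k \<in> K \<Longrightarrow> b k \<ge> 0) \<Longrightarrow>
       (\<Sum>n\<in>J. (weight n * (\<Sum>k\<in>K. b k * sqrt (\<nu> k) * \<beta> k \<bar>t n\<bar>))\<^sup>2) \<le> D\<^sup>2 * (\<Sum>k\<in>K. (b k)\<^sup>2)"
    using maximal_matrix_bound[OF \<beta>_le \<beta>_nn C] by blast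
  show ?thesis
  proof (rule that[OF D])
    fix F assume F: "F \<in> de_branges E"
    define g where "g = (\<lambda>n k. cmod (coeff F k) * sqrt (\<nu> k) * \<beta> k \<bar>t n\<bar>)"
    have g0: "g n k \<ge> 0" if "n \<in> I" "k \<in> I" for n k
      using \<beta>_nn[OF that] \<nu>_pos[OF that(2)] by (simp add: g_def)
    have finite_bound: "(\<Sum>n\<in>J. (weight n * (\<Sum>k\<in>K. g n k))\<^sup>2) \<le> (D * de_branges_norm E F)\<^sup>2"
      if "finite J" "J \<subseteq> I" "finite K" "K \<subseteq> I" for J K
    proof -
      have "(\<Sum>n\<in>J. (weight n * (\<Sum>k\<in>K. g n k))\<^sup>2) \<le> D\<^sup>2 * (\<Sum>k\<in>K. (cmod (coeff F k))\<^sup>2)"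
        unfolding g_def by (rule matrix[OF that]) simp
      also have "\<dots> \<le> D\<^sup>2 * (de_branges_norm E F)\<^sup>2"
        by (intro mult_left_mono bessel that F) simp
      finally show ?thesis by (simp add: power_mult_distrib)
    qed
    have summ: "g n summable_on I" if n: "n \<in> I" for n
    proof (rule nonneg_bdd_above_summable_on)
      show "bdd_above (sum (g n) ` {K. K \<subseteq> I \<and> finite K})"
      proof (rule bdd_aboveI2)
        fix K assume K: "K \<in> {K. K \<subseteq> I \<and> finite K}"
        have "(weight n * (\<Sum>k\<in>K. g n k))\<^sup>2 \<le> (D * de_branges_norm E F)\<^sup>2"
          using finite_bound[of "{n}" K] n K by simp
        then have "weight n * (\<Sum>k\<in>K. g n k) \<le> D * de_branges_norm E F"
          by (rule power2_le_imp_le) (use D in simp)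
        then show "sum (g n) K \<le> D * de_branges_norm E F / weight n"
          using weight_pos[OF n] by (simp add: field_simps)
      qed
    qed (use g0 n in auto)
    define s where "s = (\<lambda>n. infsum (g n) I)"
    have bot: "finite_subsets_at_top I \<noteq> bot" by (rule finite_subsets_at_top_neq_bot)
    have "norm (F z) \<le> s n" if n: "n \<in> I" and z: "norm z \<le> \<bar>t n\<bar>" for n z
    proof (rule tendsto_upperbound[OF tendsto_norm[OF expansion_pointwise[OF F]] _ bot])
      have "norm (\<Sum>k\<in>J. coeff F k * (of_real (sqrt (\<nu> k)) * divided_zero A (of_real (t k)) z)) \<le> s n"
        if J: "finite J" "J \<subseteq> I" for J
      proof -
        have "norm (\<Sum>k\<in>J. coeff F k * (of_real (sqrt (\<nu> k)) * divided_zero A (of_real (t k)) z)) \<le> (\<Sum>k\<in>J. g n k)"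
        proof (rule sum_norm_le)
          fix k assume "k \<in> J"
          then have k: "k \<in> I" using J by blast
          have "norm (divided_zero A (of_real (t k)) z) \<le> \<beta> k \<bar>t n\<bar>"
            using le_\<beta>[OF k, of z] \<beta>_mono[OF k _ z] by simp
          then have "cmod (coeff F k) * sqrt (\<nu> k) * norm (divided_zero A (of_real (t k)) z)
              \<le> cmod (coeff F k) * sqrt (\<nu> k) * \<beta> k \<bar>t n\<bar>"
            using \<nu>_pos[OF k] by (intro mult_left_mono) auto
          then show "norm (coeff F k * (of_real (sqrt (\<nu> k)) * divided_zero A (of_real (t k)) z)) \<le> g n k"
            using \<nu>_pos[OF k] by (simp add: g_def norm_mult mult.assoc)
        qed
        also have "\<dots> \<le> s n" unfolding s_def
          by (rule finite_sum_le_infsum[OF summ[OF n]]) (use J g0 n in auto)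
        finally show ?thesis .
      qed
      then show "\<forall>\<^sub>F J in finite_subsets_at_top I.
          norm (\<Sum>k\<in>J. coeff F k * (of_real (sqrt (\<nu> k)) * divided_zero A (of_real (t k)) z)) \<le> s n"
        by (intro eventually_finite_subsets_at_top_weakI)
    qed
    moreover have "(\<Sum>n\<in>J. (weight n * s n)\<^sup>2) \<le> (D * de_branges_norm E F)\<^sup>2" if J: "finite J" "J \<subseteq> I" for J
    proof (rule tendsto_upperbound[OF _ _ bot])
      show "((\<lambda>K. \<Sum>n\<in>J. (weight n * (\<Sum>k\<in>K. g n k))\<^sup>2) \<longlongrightarrow> (\<Sum>n\<in>J. (weight n * s n)\<^sup>2)) (finite_subsets_at_top I)"
        unfolding s_def
        by (intro tendsto_sum tendsto_power tendsto_mult_left infsum_tendsto summ) (use J in auto)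
      show "\<forall>\<^sub>F K in finite_subsets_at_top I. (\<Sum>n\<in>J. (weight n * (\<Sum>k\<in>K. g n k))\<^sup>2) \<le> (D * de_branges_norm E F)\<^sup>2"
        by (rule eventually_finite_subsets_at_top_weakI) (rule finite_bound[OF J])
    qed
    ultimately show "\<exists>s. (\<forall>n\<in>I. \<forall>z. norm z \<le> \<bar>t n\<bar> \<longrightarrow> norm (F z) \<le> s n) \<and>
       (\<forall>J. finite J \<longrightarrow> J \<subseteq> I \<longrightarrow> (\<Sum>n\<in>J. (weight n * s n)\<^sup>2) \<le> (D * de_branges_norm E F)\<^sup>2)"
      by blast
  next
    fix k and \<epsilon> :: real assume k: "k \<in> I" and \<epsilon>: "\<epsilon> > 0"
    let ?e = "\<lambda>z. of_real (sqrt (\<nu> k)) * divided_zero A (of_real (t k)) z"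
    obtain p where p_lim: "\<And>z. (\<lambda>N. poly (p N) z) \<longlonglongrightarrow> divided_zero A (of_real (t k)) z"
      and p_le: "\<And>N z. norm (poly (p N) z) \<le> \<beta> k (norm z)"
      using approx[OF k] by blast
    define q where "q = (\<lambda>N. smult (of_real (sqrt (\<nu> k))) (p N))"
    define d where "d = (\<lambda>N z. ?e z - poly (q N) z)"
    define h where "h = (\<lambda>n. (weight n * (2 * (sqrt (\<nu> k) * \<beta> k \<bar>t n\<bar>)))\<^sup>2)"
    have d_mem: "d N \<in> de_branges E" for N
      unfolding d_def by (rule de_branges_diff[OF e_mem[OF k] poly_mem])
    have d_le: "norm (d N (of_real (t n))) \<le> 2 * (sqrt (\<nu> k) * \<beta> k \<bar>t n\<bar>)" for N n
    proof -
      have d_eq: "d N (of_real (t n)) = of_real (sqrt (\<nu> k)) *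
          (divided_zero A (of_real (t k)) (of_real (t n)) - poly (p N) (of_real (t n)))"
        by (simp add: d_def q_def algebra_simps)
      have "norm (divided_zero A (of_real (t k)) (of_real (t n)) - poly (p N) (of_real (t n)))
          \<le> \<beta> k \<bar>t n\<bar> + \<beta> k \<bar>t n\<bar>"
        using le_\<beta>[OF k, of "of_real (t n)"] p_le[of N "of_real (t n)"]
        by (intro order_trans[OF norm_triangle_ineq4] add_mono) auto
      from mult_left_mono[OF this, of "sqrt (\<nu> k)"] show ?thesis
        unfolding d_eq norm_mult norm_of_real using \<nu>_pos[OF k] by simp
    qed
    have coeff_le: "(cmod (coeff (d N) n))\<^sup>2 \<le> h n" if n: "n \<in> I" for N n
      unfolding h_def cmod_coeff_weight[OF d_mem n]
      by (intro power_mono mult_left_mono d_le mult_nonneg_nonneg) (use weight_pos[OF n] in auto)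
    have coeff_lim: "(\<lambda>N. (cmod (coeff (d N) n))\<^sup>2) \<longlonglongrightarrow> 0" if n: "n \<in> I" for n
    proof -
      have "(\<lambda>N. (weight n * norm (?e (of_real (t n)) - of_real (sqrt (\<nu> k)) * poly (p N) (of_real (t n))))\<^sup>2)
         \<longlonglongrightarrow> (weight n * norm (?e (of_real (t n)) - ?e (of_real (t n))))\<^sup>2"
        by (intro tendsto_intros p_lim)
      then show ?thesis unfolding cmod_coeff_weight[OF d_mem n] by (simp add: d_def q_def)
    qed
    have h_summ: "h summable_on I"
    proof (rule nonneg_bdd_above_summable_on)
      show "bdd_above (sum h ` {J. J \<subseteq> I \<and> finite J})"
      proof (rule bdd_aboveI2)
        fix J assume J: "J \<in> {J. J \<subseteq> I \<and> finite J}"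
        have "sum h J = 4 * (\<Sum>n\<in>J. (weight n * (\<Sum>j\<in>{k}. 1 * sqrt (\<nu> j) * \<beta> j \<bar>t n\<bar>))\<^sup>2)"
          by (simp add: h_def sum_distrib_left power_mult_distrib mult_ac)
        also have "\<dots> \<le> 4 * (D\<^sup>2 * (\<Sum>j\<in>{k}. 1\<^sup>2))"
          by (intro mult_left_mono matrix) (use J k in auto)
        finally show "sum h J \<le> 4 * D\<^sup>2" by simp
      qed
    qed (simp add: h_def)
    have \<epsilon>2: "\<epsilon>\<^sup>2 / 2 > 0" using \<epsilon> by simp
    obtain J0 where J0: "finite J0" "J0 \<subseteq> I" and tail: "\<And>J. finite J \<Longrightarrow> J \<subseteq> I - J0 \<Longrightarrow> sum h J \<le> \<epsilon>\<^sup>2 / 2"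
      using summable_on_small_tails[OF h_summ \<epsilon>2] by blast
    have "(\<lambda>N. \<Sum>n\<in>J0. (cmod (coeff (d N) n))\<^sup>2) \<longlonglongrightarrow> (\<Sum>n\<in>J0. 0)"
      by (intro tendsto_sum coeff_lim) (use J0 in auto)
    then have "\<forall>\<^sub>F N in sequentially. (\<Sum>n\<in>J0. (cmod (coeff (d N) n))\<^sup>2) < \<epsilon>\<^sup>2 / 2"
      by (rule order_tendstoD) (use \<epsilon>2 in simp)
    then obtain N where N: "(\<Sum>n\<in>J0. (cmod (coeff (d N) n))\<^sup>2) < \<epsilon>\<^sup>2 / 2"
      by (auto simp: eventually_sequentially)
    have "de_branges_norm E (d N) \<le> \<epsilon>"
    proof (rule norm_le_if_coeff_sums_le[OF d_mem])
      fix J assume J: "finite J" "J \<subseteq> I"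
      have "(\<Sum>n\<in>J. (cmod (coeff (d N) n))\<^sup>2) \<le> (\<Sum>n\<in>J0 \<union> (J - J0). (cmod (coeff (d N) n))\<^sup>2)"
        by (rule sum_mono2) (use J J0 in auto)
      also have "\<dots> = (\<Sum>n\<in>J0. (cmod (coeff (d N) n))\<^sup>2) + (\<Sum>n\<in>J - J0. (cmod (coeff (d N) n))\<^sup>2)"
        by (rule sum.union_disjoint) (use J J0 in auto)
      also have "(\<Sum>n\<in>J - J0. (cmod (coeff (d N) n))\<^sup>2) \<le> sum h (J - J0)"
        by (rule sum_mono) (use J coeff_le in auto)
      also have "\<dots> \<le> \<epsilon>\<^sup>2 / 2" by (rule tail) (use J in auto)
      finally show "(\<Sum>n\<in>J. (cmod (coeff (d N) n))\<^sup>2) \<le> \<epsilon>\<^sup>2" using N by simp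
    qed (use \<epsilon> in simp)
    then show "\<exists>p. de_branges_norm E (\<lambda>z. ?e z - poly p z) \<le> \<epsilon>" unfolding d_def by blast
  qed
qed

end

section \<open>Density of the polynomials\<close>

context regular_lacunary_de_branges
begin

text \<open>
  Polynomials approximate each basis function, hence finite combinations of them, which are dense.
\<close>

lemma polynomials_dense:
  assumes F: "F \<in> de_branges E" and \<epsilon>: "\<epsilon> > 0"
  shows "\<exists>p. de_branges_norm E (\<lambda>z. F z - poly p z) \<le> \<epsilon>"
proof -
  obtain D :: real where approx: "\<And>k \<epsilon>. k \<in> I \<Longrightarrow> \<epsilon> > 0 \<Longrightarrow> \<exists>p. de_branges_norm E
        (\<lambda>z. of_real (sqrt (\<nu> k)) * divided_zero A (of_real (t k)) z - poly p z) \<le> \<epsilon>"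
    by (rule maximal_function_bound) (rule that)
  have add: "\<exists>p. de_branges_norm E (\<lambda>z. (F z + G z) - poly p z) \<le> \<epsilon>"
    if F: "F \<in> de_branges E" and G: "G \<in> de_branges E" and \<epsilon>: "\<epsilon> > 0"
      and aF: "\<And>\<epsilon>. \<epsilon> > 0 \<Longrightarrow> \<exists>p. de_branges_norm E (\<lambda>z. F z - poly p z) \<le> \<epsilon>"
      and aG: "\<And>\<epsilon>. \<epsilon> > 0 \<Longrightarrow> \<exists>p. de_branges_norm E (\<lambda>z. G z - poly p z) \<le> \<epsilon>" for F G \<epsilon>
  proof -
    obtain p where p: "de_branges_norm E (\<lambda>z. F z - poly p z) \<le> \<epsilon> / 2" using aF[of "\<epsilon> / 2"] \<epsilon> by auto
    obtain q where q: "de_branges_norm E (\<lambda>z. G z - poly q z) \<le> \<epsilon> / 2" using aG[of "\<epsilon> / 2"] \<epsilon> by auto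
    have "(\<lambda>z. (F z + G z) - poly (p + q) z) = (\<lambda>z. (F z - poly p z) + (G z - poly q z))"
      by (simp add: fun_eq_iff)
    then have "(de_branges_norm E (\<lambda>z. (F z + G z) - poly (p + q) z))\<^sup>2
        \<le> 2 * (de_branges_norm E (\<lambda>z. F z - poly p z))\<^sup>2 + 2 * (de_branges_norm E (\<lambda>z. G z - poly q z))\<^sup>2"
      using de_branges_norm_add_square_le[OF de_branges_diff[OF F poly_mem] de_branges_diff[OF G poly_mem]] by simp
    also have "\<dots> \<le> 2 * (\<epsilon> / 2)\<^sup>2 + 2 * (\<epsilon> / 2)\<^sup>2"
      by (intro add_mono mult_left_mono power_mono p q) auto
    also have "\<dots> = \<epsilon>\<^sup>2" by (simp add: power_divide)
    finally have "de_branges_norm E (\<lambda>z. (F z + G z) - poly (p + q) z) \<le> \<epsilon>"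
      by (rule power2_le_imp_le) (use \<epsilon> in simp)
    then show ?thesis by blast
  qed
  have scale: "\<exists>p. de_branges_norm E (\<lambda>z. a * F z - poly p z) \<le> \<epsilon>"
    if \<epsilon>: "\<epsilon> > 0" and aF: "\<And>\<epsilon>. \<epsilon> > 0 \<Longrightarrow> \<exists>p. de_branges_norm E (\<lambda>z. F z - poly p z) \<le> \<epsilon>" for F a \<epsilon>
  proof -
    have pos: "\<epsilon> / (cmod a + 1) > 0" using \<epsilon> by (simp add: add_nonneg_pos)
    obtain p where p: "de_branges_norm E (\<lambda>z. F z - poly p z) \<le> \<epsilon> / (cmod a + 1)" using aF[OF pos] by blast
    have "(\<lambda>z. a * F z - poly (smult a p) z) = (\<lambda>z. a * (F z - poly p z))"
      by (simp add: fun_eq_iff algebra_simps)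
    then have "de_branges_norm E (\<lambda>z. a * F z - poly (smult a p) z) = cmod a * de_branges_norm E (\<lambda>z. F z - poly p z)"
      by (simp only: de_branges_norm_scale)
    also have "\<dots> \<le> (cmod a + 1) * (\<epsilon> / (cmod a + 1))"
      by (intro mult_mono p) auto
    also have "\<dots> = \<epsilon>" using norm_ge_zero[of a] by (simp add: add_nonneg_eq_0_iff)
    finally show ?thesis by blast
  qed
  have comb: "\<exists>p. de_branges_norm E (\<lambda>z. (\<Sum>n\<in>J. c n * (of_real (sqrt (\<nu> n)) * divided_zero A (of_real (t n)) z)) - poly p z) \<le> \<epsilon>"
    if "finite J" "J \<subseteq> I" "\<epsilon> > 0" for J c \<epsilon>
    using that
  proof (induction J arbitrary: \<epsilon> rule: finite_induct)
    case empty
    have "de_branges_norm E (\<lambda>z. 0 - poly 0 z) \<le> \<epsilon>" using empty by (simp add: de_branges_norm_def)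
    then show ?case by (intro exI[of _ 0]) simp
  next
    case (insert n J)
    have "\<exists>p. de_branges_norm E (\<lambda>z. (c n * (of_real (sqrt (\<nu> n)) * divided_zero A (of_real (t n)) z)
        + (\<Sum>n\<in>J. c n * (of_real (sqrt (\<nu> n)) * divided_zero A (of_real (t n)) z))) - poly p z) \<le> \<epsilon>"
    proof (rule add)
      have n: "n \<in> I" using insert.prems by simp
      show "(\<lambda>z. c n * (of_real (sqrt (\<nu> n)) * divided_zero A (of_real (t n)) z)) \<in> de_branges E"
        by (rule de_branges_scale[OF e_mem[OF n]])
      show "\<exists>p. de_branges_norm E (\<lambda>z. c n * (of_real (sqrt (\<nu> n)) * divided_zero A (of_real (t n)) z) - poly p z) \<le> \<epsilon>"
        if "\<epsilon> > 0" for \<epsilon>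
        by (rule scale[OF that]) (rule approx[OF n])
      show "(\<lambda>z. \<Sum>n\<in>J. c n * (of_real (sqrt (\<nu> n)) * divided_zero A (of_real (t n)) z)) \<in> de_branges E"
        by (rule e_combination_mem) (use insert in auto)
      show "\<exists>p. de_branges_norm E (\<lambda>z. (\<Sum>n\<in>J. c n * (of_real (sqrt (\<nu> n)) * divided_zero A (of_real (t n)) z)) - poly p z) \<le> \<epsilon>"
        if "\<epsilon> > 0" for \<epsilon>
        by (rule insert.IH) (use insert.prems that in auto)
    qed (rule insert.prems)
    then show ?case using insert.hyps by simp
  qed
  obtain J where J: "finite J" "J \<subseteq> I" and close: "de_branges_norm E
      (\<lambda>z. F z - (\<Sum>n\<in>J. coeff F n * (of_real (sqrt (\<nu> n)) * divided_zero A (of_real (t n)) z))) < \<epsilon> / 2"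
  proof -
    have "\<forall>\<^sub>F J in finite_subsets_at_top I. finite J \<and> J \<subseteq> I"
      by (rule eventually_finite_subsets_at_top_weakI) auto
    moreover have "\<forall>\<^sub>F J in finite_subsets_at_top I. de_branges_norm E
      (\<lambda>z. F z - (\<Sum>n\<in>J. coeff F n * (of_real (sqrt (\<nu> n)) * divided_zero A (of_real (t n)) z))) < \<epsilon> / 2"
      by (rule partial_expansion_close[OF F]) (use \<epsilon> in simp)
    ultimately have "\<forall>\<^sub>F J in finite_subsets_at_top I. (finite J \<and> J \<subseteq> I) \<and> de_branges_norm E
      (\<lambda>z. F z - (\<Sum>n\<in>J. coeff F n * (of_real (sqrt (\<nu> n)) * divided_zero A (of_real (t n)) z))) < \<epsilon> / 2"
      by (rule eventually_conj)
    from eventually_happens'[OF finite_subsets_at_top_neq_bot this] show ?thesis using that by blast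
  qed
  define S where "S = (\<lambda>z. \<Sum>n\<in>J. coeff F n * (of_real (sqrt (\<nu> n)) * divided_zero A (of_real (t n)) z))"
  have S: "S \<in> de_branges E" unfolding S_def by (rule e_combination_mem[OF J])
  obtain p where p: "de_branges_norm E (\<lambda>z. S z - poly p z) \<le> \<epsilon> / 2"
    using comb[OF J, of "\<epsilon> / 2" "coeff F"] \<epsilon> by (auto simp: S_def)
  have "(\<lambda>z. F z - poly p z) = (\<lambda>z. (F z - S z) + (S z - poly p z))" by simp
  then have "(de_branges_norm E (\<lambda>z. F z - poly p z))\<^sup>2
      \<le> 2 * (de_branges_norm E (\<lambda>z. F z - S z))\<^sup>2 + 2 * (de_branges_norm E (\<lambda>z. S z - poly p z))\<^sup>2"
    using de_branges_norm_add_square_le[OF de_branges_diff[OF F S] de_branges_diff[OF S poly_mem]] by simp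
  also have "\<dots> \<le> 2 * (\<epsilon> / 2)\<^sup>2 + 2 * (\<epsilon> / 2)\<^sup>2"
    by (intro add_mono mult_left_mono power_mono p) (use close in \<open>auto simp: S_def\<close>)
  also have "\<dots> = \<epsilon>\<^sup>2" by (simp add: power_divide)
  finally have "de_branges_norm E (\<lambda>z. F z - poly p z) \<le> \<epsilon>"
    by (rule power2_le_imp_le) (use \<epsilon> in simp)
  then show ?thesis by blast
qed

text \<open>
  A function in the space whose real values are dominated by the maximum of \<open>F\<close> on discs is bounded in
  norm by \<open>F\<close>.
\<close>

lemma domination_principle:
  obtains D where "D \<ge> 0"
    "\<And>F G L. F \<in> de_branges E \<Longrightarrow> G \<in> de_branges E \<Longrightarrow> L \<ge> 0 \<Longrightarrow>
       \<forall>x M. (\<forall>z. norm z \<le> \<bar>x\<bar> \<longrightarrow> norm (F z) \<le> M) \<longrightarrow> norm (G (of_real x)) \<le> L * M \<Longrightarrow>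
       de_branges_norm E G \<le> D * L * de_branges_norm E F"
proof -
  obtain D where D: "D \<ge> 0" and maximal:
    "\<And>F. F \<in> de_branges E \<Longrightarrow> \<exists>s :: int \<Rightarrow> real. (\<forall>n\<in>I. \<forall>z. norm z \<le> \<bar>t n\<bar> \<longrightarrow> norm (F z) \<le> s n) \<and>
       (\<forall>J. finite J \<longrightarrow> J \<subseteq> I \<longrightarrow> (\<Sum>n\<in>J. (weight n * s n)\<^sup>2) \<le> (D * de_branges_norm E F)\<^sup>2)"
    by (rule maximal_function_bound) (rule that)
  show ?thesis
  proof (rule that[OF D])
    fix F G :: "complex \<Rightarrow> complex" and L :: real
    assume F: "F \<in> de_branges E" and G: "G \<in> de_branges E" and L: "L \<ge> 0"
      and dom: "\<forall>x M. (\<forall>z. norm z \<le> \<bar>x\<bar> \<longrightarrow> norm (F z) \<le> M) \<longrightarrow> norm (G (of_real x)) \<le> L * M"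
    obtain s where s: "\<forall>n\<in>I. \<forall>z. norm z \<le> \<bar>t n\<bar> \<longrightarrow> norm (F z) \<le> s n"
      and sums: "\<forall>J. finite J \<longrightarrow> J \<subseteq> I \<longrightarrow> (\<Sum>n\<in>J. (weight n * s n)\<^sup>2) \<le> (D * de_branges_norm E F)\<^sup>2"
      using maximal[OF F] by (elim exE conjE)
    show "de_branges_norm E G \<le> D * L * de_branges_norm E F"
    proof (rule norm_le_if_coeff_sums_le[OF G])
      fix J assume J: "finite J" "J \<subseteq> I"
      have "(\<Sum>n\<in>J. (cmod (coeff G n))\<^sup>2) \<le> (\<Sum>n\<in>J. L\<^sup>2 * (weight n * s n)\<^sup>2)"
      proof (rule sum_mono)
        fix n assume "n \<in> J"
        then have n: "n \<in> I" using J by blast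
        have "norm (G (of_real (t n))) \<le> L * s n" by (rule dom[rule_format]) (use s n in simp)
        then have "weight n * norm (G (of_real (t n))) \<le> weight n * (L * s n)"
          using weight_pos[OF n] by (intro mult_left_mono) auto
        then have "(cmod (coeff G n))\<^sup>2 \<le> (weight n * (L * s n))\<^sup>2"
          unfolding cmod_coeff_weight[OF G n] using weight_pos[OF n] by (intro power_mono) auto
        then show "(cmod (coeff G n))\<^sup>2 \<le> L\<^sup>2 * (weight n * s n)\<^sup>2" by (simp add: power_mult_distrib mult_ac)
      qed
      also have "\<dots> = L\<^sup>2 * (\<Sum>n\<in>J. (weight n * s n)\<^sup>2)" by (simp add: sum_distrib_left)
      also have "\<dots> \<le> L\<^sup>2 * (D * de_branges_norm E F)\<^sup>2"
        by (rule mult_left_mono) (use sums J in auto)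
      finally show "(\<Sum>n\<in>J. (cmod (coeff G n))\<^sup>2) \<le> (D * L * de_branges_norm E F)\<^sup>2"
        by (simp add: power_mult_distrib mult_ac)
    qed (use D L in simp)
  qed
qed

end

section \<open>Hausdorff operators\<close>

lemma borel_measurable_halfline_completion:
  fixes f :: "real \<Rightarrow> 'a::topological_space"
  assumes \<mu>: "sets \<mu> = sets (restrict_space borel {0<..})" and f: "continuous_on {0<..} f"
  shows "f \<in> borel_measurable (completion \<mu>)"
proof (rule measurable_completion)
  have "f \<in> borel_measurable (restrict_space borel {0<..})"
    by (rule borel_measurable_continuous_on_restrict[OF f])
  then show "f \<in> borel_measurable \<mu>"
    by (simp add: measurable_cong_sets[OF \<mu> refl])
qed

text \<open>
  The situation in which the operator turns out to be bounded: all moments exist and \<open>\<Phi>\<close> carries no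
  mass on \<open>(0, 1)\<close>. The values \<open>F (z / u)\<close> that matter are then taken in the disc of radius \<open>\<bar>z\<bar>\<close>.
\<close>

locale moment_measure =
  fixes \<mu> :: "real measure" and \<Phi> :: "real \<Rightarrow> real"
  assumes space_\<mu>: "space \<mu> = {0<..}" and sets_\<mu>: "sets \<mu> = sets (restrict_space borel {0<..})"
    and \<Phi>_nonneg: "\<And>u. u > 0 \<Longrightarrow> \<Phi> u \<ge> 0"
    and moments: "\<And>n::nat. integrable (completion \<mu>) (\<lambda>u. \<Phi> u * u powi (- int n))"
    and vanishing: "AE u in \<mu>. u \<in> {0<..<1} \<longrightarrow> \<Phi> u = 0"
begin

definition total_mass :: real where "total_mass = (\<integral>u. \<Phi> u \<partial>completion \<mu>)"

lemma \<Phi>_integrable: "integrable (completion \<mu>) \<Phi>"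
  using moments[of 0] by simp

lemma AE_positive: "AE u in completion \<mu>. u > 0"
  by (rule AE_I2) (simp add: space_\<mu> space_completion)

lemma AE_vanishing: "AE u in completion \<mu>. u < 1 \<longrightarrow> \<Phi> u = 0"
  using AE_completion[OF vanishing] AE_positive by eventually_elim auto

lemma total_mass_nonneg: "total_mass \<ge> 0"
  unfolding total_mass_def
  by (rule integral_nonneg_AE) (use AE_positive in \<open>eventually_elim, simp add: \<Phi>_nonneg\<close>)

lemma set_integral_total_mass: "(LINT u:{1..}|completion \<mu>. \<Phi> u) = total_mass"
  unfolding set_lebesgue_integral_def total_mass_def
proof (rule integral_cong_AE)
  have "continuous_on {0<..} (\<lambda>u::real. u)" by (rule continuous_on_id)
  from borel_measurable_halfline_completion[OF sets_\<mu> this]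
  have [measurable]: "(\<lambda>u. u) \<in> borel_measurable (completion \<mu>)" .
  have [measurable]: "\<Phi> \<in> borel_measurable (completion \<mu>)"
    using \<Phi>_integrable by auto
  show "\<Phi> \<in> borel_measurable (completion \<mu>)" by measurable
  have "(\<lambda>u. indicator {1..} u :: real) \<in> borel_measurable (completion \<mu>)"
    by (rule measurable_compose[of "\<lambda>u. u" _ borel]) auto
  then show "(\<lambda>u. indicator {1..} u *\<^sub>R \<Phi> u) \<in> borel_measurable (completion \<mu>)" by measurable
  show "AE u in completion \<mu>. indicator {1..} u *\<^sub>R \<Phi> u = \<Phi> u"
    using AE_vanishing by eventually_elim (auto simp: indicator_def)
qed

lemma
  assumes F: "F holomorphic_on UNIV" and B: "\<And>w. norm w \<le> norm z \<Longrightarrow> norm (F w) \<le> B"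
  shows hausdorff_integrable: "integrable (completion \<mu>) (\<lambda>u. of_real (\<Phi> u) * F (z / of_real u))"
    and norm_hausdorff_le: "norm (hausdorff_op \<Phi> \<mu> F z) \<le> total_mass * B"
proof -
  have "continuous_on {0<..} (\<lambda>u::real. F (z / of_real u))"
    by (rule continuous_on_compose2[OF holomorphic_on_imp_continuous_on[OF F]]) (auto intro!: continuous_intros)
  from borel_measurable_halfline_completion[OF sets_\<mu> this]
  have [measurable]: "(\<lambda>u. F (z / of_real u)) \<in> borel_measurable (completion \<mu>)" .
  have [measurable]: "\<Phi> \<in> borel_measurable (completion \<mu>)" using \<Phi>_integrable by auto
  have le: "AE u in completion \<mu>. norm (of_real (\<Phi> u) * F (z / of_real u)) \<le> \<Phi> u * B"
    using AE_vanishing AE_positive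
  proof eventually_elim
    case (elim u)
    show ?case
    proof (cases "u < 1")
      case False
      then have "norm (z / of_real u) \<le> norm z" by (simp add: norm_divide divide_le_eq mult_le_cancel_left1)
      then have "norm (F (z / of_real u)) \<le> B" by (rule B)
      then show ?thesis using \<Phi>_nonneg[of u] elim by (simp add: norm_mult mult_left_mono)
    qed (use elim in simp)
  qed
  have int: "integrable (completion \<mu>) (\<lambda>u. \<Phi> u * B)" using \<Phi>_integrable by simp
  have B0: "B \<ge> 0" using order_trans[OF norm_ge_zero B[of 0]] by simp
  show *: "integrable (completion \<mu>) (\<lambda>u. of_real (\<Phi> u) * F (z / of_real u))"
  proof (rule Bochner_Integration.integrable_bound[OF int])
    show "AE u in completion \<mu>. norm (of_real (\<Phi> u) * F (z / of_real u)) \<le> norm (\<Phi> u * B)"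
      unfolding real_norm_def using le by eventually_elim (auto intro: order_trans[OF _ abs_ge_self])
  qed measurable
  have "norm (hausdorff_op \<Phi> \<mu> F z) \<le> (\<integral>u. norm (of_real (\<Phi> u) * F (z / of_real u)) \<partial>completion \<mu>)"
    unfolding hausdorff_op_def by (rule integral_norm_bound)
  also have "\<dots> \<le> (\<integral>u. \<Phi> u * B \<partial>completion \<mu>)"
    by (rule integral_mono_AE[OF integrable_norm[OF *] int le])
  finally have "norm (hausdorff_op \<Phi> \<mu> F z) \<le> (\<integral>u. \<Phi> u * B \<partial>completion \<mu>)" .
  then show "norm (hausdorff_op \<Phi> \<mu> F z) \<le> total_mass * B" by (simp add: total_mass_def)
qed

lemma hausdorff_integrable_entire:
  assumes F: "F holomorphic_on UNIV"
  shows "integrable (completion \<mu>) (\<lambda>u. of_real (\<Phi> u) * F (z / of_real u))"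
proof -
  have "compact (F ` cball 0 (norm z))"
    by (intro compact_continuous_image holomorphic_on_imp_continuous_on holomorphic_on_subset[OF F]) auto
  from compact_imp_bounded[OF this] obtain B where "\<forall>y\<in>F ` cball 0 (norm z). norm y \<le> B"
    unfolding bounded_iff by (elim exE)
  then have "norm (F w) \<le> B" if "norm w \<le> norm z" for w using that by simp
  then show ?thesis by (rule hausdorff_integrable[OF F])
qed

lemma hausdorff_lincomb:
  assumes "F holomorphic_on UNIV" "G holomorphic_on UNIV"
  shows "hausdorff_op \<Phi> \<mu> (\<lambda>z. a * F z + b * G z) = (\<lambda>z. a * hausdorff_op \<Phi> \<mu> F z + b * hausdorff_op \<Phi> \<mu> G z)"
proof
  fix z
  have "(\<lambda>u. of_real (\<Phi> u) * (a * F (z / of_real u) + b * G (z / of_real u)))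
      = (\<lambda>u. a * (of_real (\<Phi> u) * F (z / of_real u)) + b * (of_real (\<Phi> u) * G (z / of_real u)))"
    by (simp add: fun_eq_iff algebra_simps)
  moreover have "(\<integral>u. a * f u + b * g u \<partial>completion \<mu>) = a * (\<integral>u. f u \<partial>completion \<mu>) + b * (\<integral>u. g u \<partial>completion \<mu>)"
    if "integrable (completion \<mu>) f" "integrable (completion \<mu>) g" for f g :: "real \<Rightarrow> complex"
    using that by simp
  ultimately show "hausdorff_op \<Phi> \<mu> (\<lambda>z. a * F z + b * G z) z
      = a * hausdorff_op \<Phi> \<mu> F z + b * hausdorff_op \<Phi> \<mu> G z"
    unfolding hausdorff_op_def
    using hausdorff_integrable_entire[OF assms(1)] hausdorff_integrable_entire[OF assms(2)] by presburger
qed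

lemma hausdorff_poly: "\<exists>q. hausdorff_op \<Phi> \<mu> (poly p) = poly q"
proof -
  define m where "m = (\<lambda>i::nat. \<integral>u. \<Phi> u * u powi (- int i) \<partial>completion \<mu>)"
  define q where "q = (\<Sum>i\<le>degree p. monom (coeff p i * of_real (m i)) i)"
  have "hausdorff_op \<Phi> \<mu> (poly p) z = poly q z" for z
  proof -
    have "hausdorff_op \<Phi> \<mu> (poly p) z
        = (\<integral>u. (\<Sum>i\<le>degree p. (coeff p i * z ^ i) * of_real (\<Phi> u * u powi (- int i))) \<partial>completion \<mu>)"
      unfolding hausdorff_op_def
    proof (rule Bochner_Integration.integral_cong)
      fix u assume "u \<in> space (completion \<mu>)"
      then have "u > 0" by (simp add: space_completion space_\<mu>)
      then show "of_real (\<Phi> u) * poly p (z / of_real u)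
          = (\<Sum>i\<le>degree p. (coeff p i * z ^ i) * of_real (\<Phi> u * u powi (- int i)))"
        by (simp add: poly_altdef sum_distrib_left power_int_minus divide_inverse power_mult_distrib power_inverse mult_ac)
    qed simp
    also have "\<dots> = (\<Sum>i\<le>degree p. (coeff p i * z ^ i) * of_real (m i))"
    proof -
      have int: "integrable (completion \<mu>) (\<lambda>u. complex_of_real (\<Phi> u * u powi (- int i)))" for i
        by (rule integrable_of_real[OF moments])
      have "(\<integral>u. (\<Sum>i\<le>degree p. (coeff p i * z ^ i) * of_real (\<Phi> u * u powi (- int i))) \<partial>completion \<mu>)
          = (\<Sum>i\<le>degree p. \<integral>u. (coeff p i * z ^ i) * of_real (\<Phi> u * u powi (- int i)) \<partial>completion \<mu>)"
        by (rule Bochner_Integration.integral_sum) (rule integrable_mult_right[OF int])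
      then show ?thesis
        by (simp only: integral_mult_right_zero integral_complex_of_real m_def)
    qed
    also have "\<dots> = poly q z" by (simp add: q_def poly_sum poly_monom mult_ac)
    finally show ?thesis .
  qed
  then show ?thesis by blast
qed

end

context regular_lacunary_de_branges
begin

text \<open>
  On polynomials the estimate is the domination principle. Polynomials \<open>p n\<close> that approximate \<open>F\<close>
  with an error proportional to \<open>\<parallel>F\<parallel>\<close> satisfy \<open>\<parallel>p n\<parallel> \<le> 2 * \<parallel>F\<parallel>\<close>, and their images converge locally
  uniformly to the image of \<open>F\<close>, so that the bound passes to the limit with twice the constant.
\<close>

lemma hausdorff_norm_bound:
  obtains D where "D \<ge> 0"
    "\<And>\<mu> \<Phi> F. moment_measure \<mu> \<Phi> \<Longrightarrow> F \<in> de_branges E \<Longrightarrow> hausdorff_op \<Phi> \<mu> F \<in> de_branges E"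
    "\<And>\<mu> \<Phi> F. moment_measure \<mu> \<Phi> \<Longrightarrow> F \<in> de_branges E \<Longrightarrow>
       de_branges_norm E (hausdorff_op \<Phi> \<mu> F) \<le> D * moment_measure.total_mass \<mu> \<Phi> * de_branges_norm E F"
proof -
  obtain D where D: "D \<ge> 0" and dom: "\<And>F G L. F \<in> de_branges E \<Longrightarrow> G \<in> de_branges E \<Longrightarrow> L \<ge> 0 \<Longrightarrow>
       \<forall>x M. (\<forall>z. norm z \<le> \<bar>x\<bar> \<longrightarrow> norm (F z) \<le> M) \<longrightarrow> norm (G (of_real x)) \<le> L * M \<Longrightarrow>
       de_branges_norm E G \<le> D * L * de_branges_norm E F"
    by (rule domination_principle) (rule that)
  have main: "hausdorff_op \<Phi> \<mu> F \<in> de_branges E \<and>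
       de_branges_norm E (hausdorff_op \<Phi> \<mu> F) \<le> 2 * D * moment_measure.total_mass \<mu> \<Phi> * de_branges_norm E F"
    if mm: "moment_measure \<mu> \<Phi>" and F: "F \<in> de_branges E" for \<mu> \<Phi> F
  proof -
    interpret moment_measure \<mu> \<Phi> by (rule mm)
    have F_hol: "F holomorphic_on UNIV" by (rule de_branges_holomorphic[OF F])
    have poly_hol: "poly p holomorphic_on UNIV" for p :: "complex poly"
      by (rule de_branges_holomorphic[OF poly_mem])
    have "\<exists>p. de_branges_norm E (\<lambda>z. F z - poly p z) \<le> de_branges_norm E F / (real n + 1)" for n :: nat
    proof (cases "de_branges_norm E F = 0")
      case True
      then show ?thesis by (intro exI[of _ 0]) simp
    next
      case False
      then show ?thesis using polynomials_dense[OF F, of "de_branges_norm E F / (real n + 1)"]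
        de_branges_norm_nonneg[of F] by (simp add: less_le)
    qed
    then obtain p where p: "\<And>n::nat. de_branges_norm E (\<lambda>z. F z - poly (p n) z) \<le> de_branges_norm E F / (real n + 1)"
      by metis
    define G where "G = (\<lambda>n. hausdorff_op \<Phi> \<mu> (poly (p n)))"
    have G_mem: "G n \<in> de_branges E" for n
      using hausdorff_poly[of "p n"] poly_mem by (auto simp: G_def)
    have p_norm: "de_branges_norm E (poly (p n)) \<le> 2 * de_branges_norm E F" for n
    proof (rule power2_le_imp_le)
      have eq: "poly (p n) = (\<lambda>z. F z + (- 1) * (F z - poly (p n) z))" by (simp add: fun_eq_iff)
      have diff: "(\<lambda>z. F z - poly (p n) z) \<in> de_branges E" by (rule de_branges_diff[OF F poly_mem])
      have small: "de_branges_norm E (\<lambda>z. F z - poly (p n) z) \<le> de_branges_norm E F"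
      proof (rule order_trans[OF p])
        have "de_branges_norm E F / (real n + 1) \<le> de_branges_norm E F / 1"
          by (rule divide_left_mono) auto
        then show "de_branges_norm E F / (real n + 1) \<le> de_branges_norm E F" by simp
      qed
      have "(de_branges_norm E (poly (p n)))\<^sup>2 \<le> 2 * (de_branges_norm E F)\<^sup>2
          + 2 * (de_branges_norm E (\<lambda>z. (- 1) * (F z - poly (p n) z)))\<^sup>2"
        by (subst eq) (rule de_branges_norm_add_square_le[OF F de_branges_scale[OF diff]])
      also have "de_branges_norm E (\<lambda>z. (- 1) * (F z - poly (p n) z)) = de_branges_norm E (\<lambda>z. F z - poly (p n) z)"
        by (subst de_branges_norm_scale) simp
      also have "2 * (de_branges_norm E F)\<^sup>2 + 2 * (de_branges_norm E (\<lambda>z. F z - poly (p n) z))\<^sup>2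
          \<le> 2 * (de_branges_norm E F)\<^sup>2 + 2 * (de_branges_norm E F)\<^sup>2"
        by (intro add_mono mult_left_mono power_mono small order_refl) auto
      also have "\<dots> = (2 * de_branges_norm E F)\<^sup>2" by (simp add: power_mult_distrib)
      finally show "(de_branges_norm E (poly (p n)))\<^sup>2 \<le> (2 * de_branges_norm E F)\<^sup>2" .
    qed simp
    have G_norm: "de_branges_norm E (G n) \<le> 2 * D * total_mass * de_branges_norm E F" for n
    proof -
      have "de_branges_norm E (G n) \<le> D * total_mass * de_branges_norm E (poly (p n))"
      proof (rule dom[OF poly_mem G_mem total_mass_nonneg], intro allI impI)
        fix x M assume M: "\<forall>z. norm z \<le> \<bar>x\<bar> \<longrightarrow> norm (poly (p n) z) \<le> M"
        show "norm (G n (of_real x)) \<le> total_mass * M"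
          unfolding G_def by (rule norm_hausdorff_le[OF poly_hol]) (use M in simp)
      qed
      also have "\<dots> \<le> D * total_mass * (2 * de_branges_norm E F)"
        by (rule mult_left_mono[OF p_norm]) (use D total_mass_nonneg in simp)
      finally show ?thesis by simp
    qed
    have unif: "uniform_limit (cball 0 R) G (hausdorff_op \<Phi> \<mu> F) sequentially" for R
    proof -
      obtain C where C: "C > 0" "\<And>F z. F \<in> de_branges E \<Longrightarrow> norm z \<le> R \<Longrightarrow> norm (F z) \<le> C * de_branges_norm E F"
        by (rule evaluation_bounded[of R]) (rule that)
      have close: "norm (G n z - hausdorff_op \<Phi> \<mu> F z) \<le> total_mass * (C * (de_branges_norm E F / (real n + 1)))"
        if z: "norm z \<le> R" for n z
      proof -
        have "hausdorff_op \<Phi> \<mu> (\<lambda>z. 1 * F z + (- 1) * poly (p n) z)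
            = (\<lambda>z. 1 * hausdorff_op \<Phi> \<mu> F z + (- 1) * hausdorff_op \<Phi> \<mu> (poly (p n)) z)"
          by (rule hausdorff_lincomb[OF F_hol poly_hol])
        then have "norm (G n z - hausdorff_op \<Phi> \<mu> F z) = norm (hausdorff_op \<Phi> \<mu> (\<lambda>z. F z - poly (p n) z) z)"
          by (simp add: G_def norm_minus_commute)
        also have "\<dots> \<le> total_mass * (C * (de_branges_norm E F / (real n + 1)))"
        proof (rule norm_hausdorff_le)
          show "(\<lambda>z. F z - poly (p n) z) holomorphic_on UNIV" by (intro holomorphic_on_diff F_hol poly_hol)
          fix w :: complex assume "norm w \<le> norm z"
          then have "norm (F w - poly (p n) w) \<le> C * de_branges_norm E (\<lambda>z. F z - poly (p n) z)"
            using z by (intro C(2)[OF de_branges_diff[OF F poly_mem]]) simp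
          also have "\<dots> \<le> C * (de_branges_norm E F / (real n + 1))"
            by (rule mult_left_mono[OF p]) (use C in simp)
          finally show "norm (F w - poly (p n) w) \<le> C * (de_branges_norm E F / (real n + 1))" .
        qed
        finally show ?thesis .
      qed
      have "(\<lambda>n. total_mass * (C * (de_branges_norm E F / (real n + 1)))) \<longlonglongrightarrow> total_mass * (C * 0)"
      proof (intro tendsto_mult_left)
        have "(\<lambda>n. de_branges_norm E F * inverse (real (Suc n))) \<longlonglongrightarrow> de_branges_norm E F * 0"
          by (intro tendsto_mult_left LIMSEQ_inverse_real_of_nat)
        then show "(\<lambda>n. de_branges_norm E F / (real n + 1)) \<longlonglongrightarrow> 0"
          by (simp add: divide_inverse add.commute)
      qed
      then have lim: "(\<lambda>n. total_mass * (C * (de_branges_norm E F / (real n + 1)))) \<longlonglongrightarrow> 0" by simp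
      show ?thesis
      proof (rule uniform_limitI)
        fix e :: real assume "e > 0"
        with lim have "\<forall>\<^sub>F n in sequentially. total_mass * (C * (de_branges_norm E F / (real n + 1))) < e"
          by (rule order_tendstoD(2))
        then show "\<forall>\<^sub>F n in sequentially. \<forall>z\<in>cball 0 R. dist (G n z) (hausdorff_op \<Phi> \<mu> F z) < e"
        proof eventually_elim
          case (elim n)
          show ?case unfolding dist_norm
          proof
            fix z assume "z \<in> cball (0::complex) R"
            then have "norm z \<le> R" by simp
            from close[OF this, of n] elim show "norm (G n z - hausdorff_op \<Phi> \<mu> F z) < e"
              by (rule order_le_less_trans)
          qed
        qed
      qed
    qed
    have lim: "(\<lambda>n. G n z) \<longlonglongrightarrow> hausdorff_op \<Phi> \<mu> F z" for z
      by (rule tendsto_uniform_limitI[OF unif[of "norm z"]]) simp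
    have hol: "hausdorff_op \<Phi> \<mu> F holomorphic_on UNIV"
    proof (rule holomorphic_uniform_sequence[where f = G])
      show "G n holomorphic_on UNIV" for n by (rule de_branges_holomorphic[OF G_mem])
      fix z :: complex
      have "uniform_limit (cball z 1) G (hausdorff_op \<Phi> \<mu> F) sequentially"
        by (rule uniform_limit_on_subset[OF unif[of "norm z + 1"]]) (simp add: cball_subset_cball_iff)
      then show "\<exists>d>0. cball z d \<subseteq> UNIV \<and> uniform_limit (cball z d) G (hausdorff_op \<Phi> \<mu> F) sequentially"
        by (intro exI[of _ 1]) auto
    qed simp
    show ?thesis using de_branges_closed[OF G_mem G_norm lim hol] by blast
  qed
  show ?thesis
    by (rule that[of "2 * D"]) (use D main in auto)
qed

lemma monomial_mem: "(\<lambda>z. z ^ n) \<in> de_branges E"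
proof -
  have "(\<lambda>z. z ^ n) = poly (monom (1::complex) n)" by (simp add: poly_monom fun_eq_iff)
  then show ?thesis using poly_mem[of "monom 1 n"] by simp
qed

lemma monomial_norm_pos: "de_branges_norm E (\<lambda>z. z ^ n) > 0"
proof (rule ccontr)
  assume "\<not> de_branges_norm E (\<lambda>z. z ^ n) > 0"
  then have zero: "de_branges_norm E (\<lambda>z. z ^ n) = 0"
    using de_branges_norm_nonneg[of "\<lambda>z. z ^ n"] by linarith
  obtain C where "C > 0" and C: "\<And>F z. F \<in> de_branges E \<Longrightarrow> norm z \<le> 1 \<Longrightarrow> norm (F z) \<le> C * de_branges_norm E F"
    by (rule evaluation_bounded[of 1]) (rule that)
  from C[OF monomial_mem, of 1 n] show False using zero by simp
qed

text \<open>
  The monomials are eigenvectors, and the eigenvalues of a bounded operator are bounded. If \<open>\<Phi>\<close> had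
  mass below some \<open>r < 1\<close>, the \<open>n\<close>-th moment would be at least that mass times \<open>r\<^bsup>-n\<^esup>\<close>.
\<close>

lemma bounded_imp_moments:
  assumes space: "space \<mu> = {0<..}" and sets: "sets \<mu> = sets (restrict_space borel {0<..})"
    and nn: "\<And>u. u > 0 \<Longrightarrow> \<Phi> u \<ge> 0"
    and bounded: "hausdorff_bounded E \<Phi> \<mu>"
  shows "integrable (completion \<mu>) (\<lambda>u. \<Phi> u * u powi (- int n))"
    and "bdd_above (range (\<lambda>n::nat. \<integral>u. \<Phi> u * u powi (- int n) \<partial>completion \<mu>))"
    and "AE u in \<mu>. u \<in> {0<..<1} \<longrightarrow> \<Phi> u = 0"
proof -
  let ?M = "completion \<mu>"
  have pos: "AE u in ?M. u > 0" by (rule AE_I2) (simp add: space space_completion)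
  have monomial: "of_real (\<Phi> u) * (z / of_real u) ^ n = z ^ n * complex_of_real (\<Phi> u * u powi (- int n))"
    if "u > 0" for u z n
    by (simp add: power_int_minus power_divide divide_inverse power_mult_distrib power_inverse mult_ac)
  have int: "integrable ?M (\<lambda>u. \<Phi> u * u powi (- int n))" for n
  proof -
    have "integrable ?M (\<lambda>u. of_real (\<Phi> u) * (1 / complex_of_real u) ^ n)"
      using bounded[unfolded hausdorff_bounded_def, THEN conjunct1, THEN bspec, OF monomial_mem[of n]] by blast
    then have "integrable ?M (\<lambda>u. complex_of_real (\<Phi> u * u powi (- int n)))"
      by (rule Bochner_Integration.integrable_cong[THEN iffD1, rotated 2])
         (use monomial[of _ 1] in \<open>auto simp: space space_completion\<close>)
    from integrable_Re[OF this] show ?thesis by (simp only: Re_complex_of_real)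
  qed
  then show "integrable ?M (\<lambda>u. \<Phi> u * u powi (- int n))" .
  define m where "m = (\<lambda>n::nat. \<integral>u. \<Phi> u * u powi (- int n) \<partial>?M)"
  have op: "hausdorff_op \<Phi> \<mu> (\<lambda>z. z ^ n) = (\<lambda>z. of_real (m n) * z ^ n)" for n
  proof
    fix z
    have "hausdorff_op \<Phi> \<mu> (\<lambda>z. z ^ n) z = (\<integral>u. z ^ n * complex_of_real (\<Phi> u * u powi (- int n)) \<partial>?M)"
      unfolding hausdorff_op_def
      by (rule Bochner_Integration.integral_cong) (use monomial in \<open>auto simp: space space_completion\<close>)
    also have "\<dots> = z ^ n * of_real (m n)" by (simp only: integral_mult_right_zero integral_complex_of_real m_def)
    finally show "hausdorff_op \<Phi> \<mu> (\<lambda>z. z ^ n) z = of_real (m n) * z ^ n" by (simp add: mult.commute)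
  qed
  obtain c where c: "\<forall>F\<in>de_branges E. de_branges_norm E (hausdorff_op \<Phi> \<mu> F) \<le> c * de_branges_norm E F"
    using bounded unfolding hausdorff_bounded_def de_branges_bounded_linear_def by (elim conjE exE)
  have m_le: "m n \<le> c" for n
  proof -
    have "\<bar>m n\<bar> * de_branges_norm E (\<lambda>z. z ^ n) \<le> c * de_branges_norm E (\<lambda>z. z ^ n)"
      using bspec[OF c monomial_mem, of n] unfolding op de_branges_norm_scale by simp
    then have "\<bar>m n\<bar> \<le> c" using monomial_norm_pos[of n] by simp
    then show ?thesis by simp
  qed
  then show "bdd_above (range (\<lambda>n::nat. \<integral>u. \<Phi> u * u powi (- int n) \<partial>?M))"
    unfolding m_def[symmetric] by (intro bdd_aboveI2)
  have part: "AE u in ?M. u < 1 - 1 / real (Suc (Suc k)) \<longrightarrow> \<Phi> u = 0" for k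
  proof -
    define r where "r = 1 - 1 / real (Suc (Suc k))"
    have r: "0 < r" "r < 1" by (auto simp: r_def)
    define g where "g = (\<lambda>u. indicator {..<r} u * \<Phi> u)"
    have [measurable]: "(\<lambda>u. u) \<in> borel_measurable ?M"
      by (rule borel_measurable_halfline_completion[OF sets continuous_on_id])
    have \<Phi>_int: "integrable ?M \<Phi>" using int[of 0] by simp
    have g_int: "integrable ?M g"
    proof (rule Bochner_Integration.integrable_bound[OF \<Phi>_int])
      have [measurable]: "\<Phi> \<in> borel_measurable ?M" using \<Phi>_int by auto
      have "(\<lambda>u. indicator {..<r} u :: real) \<in> borel_measurable ?M"
        by (rule measurable_compose[of "\<lambda>u. u" _ borel]) auto
      then show "g \<in> borel_measurable ?M" unfolding g_def by measurable
    qed (auto simp: g_def indicator_def)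
    have g_le: "(\<integral>u. g u \<partial>?M) \<le> r ^ n * c" for n
    proof -
      have "(\<integral>u. g u \<partial>?M) \<le> (\<integral>u. r ^ n * (\<Phi> u * u powi (- int n)) \<partial>?M)"
      proof (rule integral_mono_AE)
        show "AE u in ?M. g u \<le> r ^ n * (\<Phi> u * u powi (- int n))"
          using pos
        proof eventually_elim
          case (elim u)
          show ?case
          proof (cases "u < r")
            case True
            have "1 \<le> (r / u) ^ n" using True elim by (intro one_le_power) simp
            then have "\<Phi> u * 1 \<le> \<Phi> u * (r / u) ^ n" using nn[OF elim] by (rule mult_left_mono)
            then show ?thesis using True
              by (simp add: g_def power_int_minus power_divide divide_inverse power_mult_distrib power_inverse mult_ac)
          next
            case False
            then show ?thesis using elim r nn[OF elim] by (simp add: g_def)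
          qed
        qed
      qed (use g_int int[of n] in auto)
      also have "\<dots> = r ^ n * m n" by (simp add: m_def)
      also have "\<dots> \<le> r ^ n * c" by (rule mult_left_mono[OF m_le]) (use r in simp)
      finally show ?thesis .
    qed
    have "(\<lambda>n. r ^ n * c) \<longlonglongrightarrow> 0 * c" by (intro tendsto_mult_right LIMSEQ_realpow_zero) (use r in auto)
    then have "(\<integral>u. g u \<partial>?M) \<le> 0"
      by (intro LIMSEQ_le_const[of "\<lambda>n. r ^ n * c"]) (use g_le in auto)
    have g_nn: "AE u in ?M. g u \<ge> 0"
      using pos by eventually_elim (simp add: g_def nn)
    then have "(\<integral>u. g u \<partial>?M) \<ge> 0" by (rule integral_nonneg_AE)
    with \<open>(\<integral>u. g u \<partial>?M) \<le> 0\<close> have "(\<integral>u. g u \<partial>?M) = 0" by simp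
    then have "AE u in ?M. g u = 0" using integral_nonneg_eq_0_iff_AE[OF g_int g_nn] by simp
    then show ?thesis unfolding r_def[symmetric] by eventually_elim (auto simp: g_def indicator_def)
  qed
  have "AE u in ?M. \<forall>k. u < 1 - 1 / real (Suc (Suc k)) \<longrightarrow> \<Phi> u = 0"
    unfolding AE_all_countable by (rule allI) (rule part)
  then have "AE u in ?M. u \<in> {0<..<1} \<longrightarrow> \<Phi> u = 0"
  proof eventually_elim
    case (elim u)
    show ?case
    proof
      assume u: "u \<in> {0<..<1}"
      obtain k where k: "1 / (1 - u) < real k" using reals_Archimedean2 by blast
      then have "1 / real (Suc (Suc k)) < 1 - u" using u by (simp add: field_simps) 
      then have "u < 1 - 1 / real (Suc (Suc k))" by linarith
      with elim show "\<Phi> u = 0" by blast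
    qed
  qed
  then show "AE u in \<mu>. u \<in> {0<..<1} \<longrightarrow> \<Phi> u = 0"
    by (simp add: AE_completion_iff)
qed

end

lemma (in regular_lacunary_de_branges) hausdorff_characterization:
  "\<exists>const. \<forall>\<mu> \<Phi>. regular_borel_halfline \<mu> \<and> (\<forall>u>0. \<Phi> u \<ge> 0) \<longrightarrow>
    (hausdorff_bounded E \<Phi> \<mu> \<longleftrightarrow>
       (\<forall>n::nat. integrable (completion \<mu>) (\<lambda>u. \<Phi> u * u powi (- int n))) \<and>
       bdd_above (range (\<lambda>n::nat. \<integral>u. \<Phi> u * u powi (- int n) \<partial>completion \<mu>)) \<and>
       (AE u in \<mu>. u \<in> {0<..<1} \<longrightarrow> \<Phi> u = 0)) \<and>
    (hausdorff_bounded E \<Phi> \<mu> \<longrightarrow>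
       de_branges_onorm E (hausdorff_op \<Phi> \<mu>) \<le> const * (LINT u:{1..}|completion \<mu>. \<Phi> u))"
proof -
  obtain D where D: "D \<ge> 0"
    and mem: "\<And>\<mu> \<Phi> F. moment_measure \<mu> \<Phi> \<Longrightarrow> F \<in> de_branges E \<Longrightarrow> hausdorff_op \<Phi> \<mu> F \<in> de_branges E"
    and bound: "\<And>\<mu> \<Phi> F. moment_measure \<mu> \<Phi> \<Longrightarrow> F \<in> de_branges E \<Longrightarrow>
       de_branges_norm E (hausdorff_op \<Phi> \<mu> F) \<le> D * moment_measure.total_mass \<mu> \<Phi> * de_branges_norm E F"
    by (rule hausdorff_norm_bound) (rule that)
  show ?thesis
  proof (intro exI[of _ D] allI impI, elim conjE)
    fix \<mu> :: "real measure" and \<Phi> :: "real \<Rightarrow> real"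
    assume \<mu>: "regular_borel_halfline \<mu>" and nn: "\<forall>u>0. \<Phi> u \<ge> 0"
    have space: "space \<mu> = {0<..}" and sets: "sets \<mu> = sets (restrict_space borel {0<..})"
      using \<mu> by (auto simp: regular_borel_halfline_def)
    let ?mom = "\<forall>n::nat. integrable (completion \<mu>) (\<lambda>u. \<Phi> u * u powi (- int n))"
    let ?bdd = "bdd_above (range (\<lambda>n::nat. \<integral>u. \<Phi> u * u powi (- int n) \<partial>completion \<mu>))"
    let ?van = "AE u in \<mu>. u \<in> {0<..<1} \<longrightarrow> \<Phi> u = 0"
    have mm: "moment_measure \<mu> \<Phi>" if ?mom ?van
      by unfold_locales (use space sets nn that in auto)
    have forward: "?mom \<and> ?bdd \<and> ?van" if "hausdorff_bounded E \<Phi> \<mu>"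
      by (intro conjI allI bounded_imp_moments[OF space sets _ that]) (use nn in auto)
    have backward: "hausdorff_bounded E \<Phi> \<mu>" if "?mom" "?van"
    proof -
      interpret moment_measure \<mu> \<Phi> by (rule mm[OF that])
      show ?thesis unfolding hausdorff_bounded_def de_branges_bounded_linear_def
        using hausdorff_integrable_entire hausdorff_lincomb de_branges_holomorphic[of _ E UNIV]
          mem[OF mm[OF that]] bound[OF mm[OF that]]
        by (intro conjI ballI allI exI[of _ "D * total_mass"]) simp_all
    qed
    have onorm: "de_branges_onorm E (hausdorff_op \<Phi> \<mu>) \<le> D * (LINT u:{1..}|completion \<mu>. \<Phi> u)"
      if "?mom" "?van"
    proof -
      interpret moment_measure \<mu> \<Phi> by (rule mm[OF that])
      have "de_branges_norm E (hausdorff_op \<Phi> \<mu> F) / de_branges_norm E F \<le> D * total_mass"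
        if F: "F \<in> de_branges E" for F
      proof (cases "de_branges_norm E F = 0")
        case True
        then show ?thesis using D total_mass_nonneg by simp
      next
        case False
        then have "de_branges_norm E F > 0" using de_branges_norm_nonneg[of F] by linarith
        then show ?thesis using bound[OF mm[OF \<open>?mom\<close> \<open>?van\<close>] F] by (simp add: pos_divide_le_eq)
      qed
      then show ?thesis unfolding de_branges_onorm_def set_integral_total_mass
        by (intro cSUP_least) (use one_mem in auto)
    qed
    show "(hausdorff_bounded E \<Phi> \<mu> \<longleftrightarrow> ?mom \<and> ?bdd \<and> ?van) \<and>
      (hausdorff_bounded E \<Phi> \<mu> \<longrightarrow>
         de_branges_onorm E (hausdorff_op \<Phi> \<mu>) \<le> D * (LINT u:{1..}|completion \<mu>. \<Phi> u))"
    proof (intro conjI impI iffI)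
      assume b: "hausdorff_bounded E \<Phi> \<mu>"
      note moments = forward[OF b]
      show ?mom ?bdd ?van using moments by simp_all
      show "de_branges_onorm E (hausdorff_op \<Phi> \<mu>) \<le> D * (LINT u:{1..}|completion \<mu>. \<Phi> u)"
        using moments by (intro onorm) simp_all
    next
      assume "?mom \<and> ?bdd \<and> ?van"
      then show "hausdorff_bounded E \<Phi> \<mu>" by (intro backward) simp_all
    qed
  qed
qed

theorem theorem7:
  fixes E :: "complex \<Rightarrow> complex"
  assumes "hermite_biehler E"
    and "\<And>p :: complex poly. poly p \<in> de_branges E"
  shows "\<exists>const :: real. \<forall>(I :: int set) (t :: int \<Rightarrow> real) (\<nu> :: int \<Rightarrow> real)
      (\<mu> :: real measure) (\<Phi> :: real \<Rightarrow> real).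
    spectral_data E I t \<nu> \<and> regular_data I t \<nu> \<and> lacunary I t \<and>
    regular_borel_halfline \<mu> \<and> \<Phi> \<in> borel_measurable (completion \<mu>) \<and> (\<forall>u>0. \<Phi> u \<ge> 0) \<longrightarrow>
    (hausdorff_bounded E \<Phi> \<mu> \<longleftrightarrow>
       (\<forall>n::nat. integrable (completion \<mu>) (\<lambda>u. \<Phi> u * u powi (- int n))) \<and>
       bdd_above (range (\<lambda>n::nat. \<integral>u. \<Phi> u * u powi (- int n) \<partial>completion \<mu>)) \<and>
       (AE u in \<mu>. u \<in> {0<..<1} \<longrightarrow> \<Phi> u = 0)) \<and>
    (hausdorff_bounded E \<Phi> \<mu> \<longrightarrow>
       de_branges_onorm E (hausdorff_op \<Phi> \<mu>) \<le> const * (LINT u:{1..}|completion \<mu>. \<Phi> u))"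
proof (cases "\<exists>I t \<nu>. spectral_data E I t \<nu> \<and> regular_data I t \<nu> \<and> lacunary I t")
  case False
  show ?thesis
    by (intro exI[of _ 0] allI impI, elim conjE, rule notE[OF False], intro exI conjI)
next
  case True
  then obtain I t \<nu> where sd: "spectral_data E I t \<nu>" and rd: "regular_data I t \<nu>" and lac: "lacunary I t"
    by (elim exE conjE)
  obtain A where A: "A holomorphic_on UNIV" "{z. A z = 0} = (\<lambda>n. of_real (t n)) ` I"
      "\<forall>n\<in>I. deriv A (of_real (t n)) \<noteq> 0"
      "de_branges_orthonormal_basis E I (\<lambda>n z. of_real (sqrt (\<nu> n)) * divided_zero A (of_real (t n)) z)"
    using sd unfolding spectral_data_def by (elim conjE exE)
  have "(\<lambda>_::complex. 1) = poly 1" by (simp add: fun_eq_iff)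
  then have one: "(\<lambda>_. 1) \<in> de_branges E" using assms(2)[of 1] by simp
  interpret regular_lacunary_de_branges E I t \<nu> A
  proof unfold_locales
    show "inj_on t I" using sd by (auto simp: spectral_data_def intro: strict_mono_on_imp_inj_on)
  qed (use assms one sd rd lac A in \<open>auto simp: spectral_data_def\<close>)
  show ?thesis
  proof (rule ex_forward[OF hausdorff_characterization], intro allI impI, goal_cases)
    case (1 const I' t' \<nu>' \<mu> \<Phi>)
    from 1(2) have "regular_borel_halfline \<mu> \<and> (\<forall>u>0. \<Phi> u \<ge> 0)" by simp
    from 1(1)[THEN spec, THEN spec, THEN mp, OF this] show ?case .
  qed
qed

end
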